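(* Let $$f:(D_1,\lambda_1g_{D_1})\times\cdots\times(D_k,\lambda_kg_{D_k})\to(\Omega_1,\mu_1g_{\Omega_1})\times\cdots\times(\Omega_m,\mu_mg_{\Omega_m})$$ be a holomorphic isometric embedding, where $k,m$ are positive integers, $D_1,\dots,D_k,\Omega_1,\dots,\Omega_m$ are irreducible bounded symmetric domains in complex Euclidean spaces in their Harish-Chandra realizations, and $\lambda_i>0$ ($1\le i\le k$), $\mu_j>0$ ($1\le j\le m$) are real constants. Write $D:=D_1\times\cdots\times D_k$, $\Omega:=\Omega_1\times\cdots\times\Omega_m$, $S:=f(D)$, $n:=\dim_{\mathbb C}(D)$ and $N:=\dim_{\mathbb C}(\Omega)$. Suppose $f(\mathbf 0)=\mathbf 0$. Then there exist an $n$-by-$N$ matrix $M(f)$ of rank $n$, a bounded balanced convex domain $D_f\subset\Omega\subset\mathbb C^N$, and a holomorphic submersion $\widetilde\pi_f:D_f\to D$ defined by $\widetilde\pi_f(z_1,\dots,z_N):=(z_1,\dots,z_N)M(f)^T$ for $(z_1,\dots,z_N)\in D_f$, such that $S=f(D)\subset D_f$ and $\widetilde\pi_f(f(w))=w$ for all $w\in D$. In addition, $$T_{f(w)}(\Omega)=T_{f(w)}(S)\oplus\ker d\widetilde\pi_f(f(w))\qquad\forall\,w\in D,$$ and thus $T_\Omega|_S=T_S\oplus(\ker d\widetilde\pi_f)|_S$ is a holomorphic splitting. In general, without assuming $f(\mathbf 0)=\mathbf 0$, $f:D\to\Omega$ is a proper holomorphic isometric embedding, so that $f(D)\subset\Omega$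 is a closed embedded complex submanifold, and there still exist a bounded domain of holomorphy $D_f$ in $\mathbb C^N$ and a holomorphic submersion $\widetilde\pi_f:D_f\to D$ such that $f(D)\subset D_f\subset\Omega$, $\widetilde\pi_f\circ f=\mathrm{Id}_D$, and $T_\Omega|_S=(\ker d\widetilde\pi_f)|_S\oplus T_S$ is a holomorphic splitting. As a consequence, the tangent sequence $$0\to T_S\xrightarrow{\iota_*}T_\Omega|_S\to N_{S|\Omega}\to0$$ also splits holomorphically over $S$.
   Context: For an irreducible bounded symmetric domain $U\Subset\mathbb C^d$ in its Harish-Chandra realization, $g_U$ denotes the canonical Kähler–Einstein metric normalized so that minimal disks of $U$ have constant Gaussian curvature $-2$. Its Kähler form is $\omega_{g_U}=-\sqrt{-1}\,\partial\overline\partial\log h_U(z,z)$, where $h_U(z,\xi)$ is a polynomial in $(z,\overline\xi)$ (the Bergman kernel of $U$ is a positive constant times a negative integer power of $h_U$); the Harish-Chandra coordinates are chosen such that $h_U(z,\xi)=1-\sum_jz_j\overline{\xi_j}+\sum_l(-1)^{\deg G_l}G_l(z)\overline{G_l(\xi)}$ for finitely many homogeneous polynomials $G_l$ of degree $\ge2$ (none if $U$ is the unit ball). That $f$ is a holomorphic isometric embedding between the products means that $f=(f_1,\dots,f_m)$ is a holomorphic embedding preserving the product metrics: $\sum_{j=1}^m\mu_jf_j^*\omega_{g_{\Omega_j}}=\sum_{i=1}^k\lambda_i\mathrm{Pr}_i^*\omega_{g_{D_i}}$, where $f_j:D\to\Omega_j$ is the $j$-th component of $f$ and $\mathrm{Pr}_i:D\to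 D_i$ is the projection. A subset $U\subset\mathbb C^N$ is balanced if $\lambda z\in U$ whenever $z\in U$, $\lambda\in\mathbb C$, $|\lambda|\le1$. $T_\Omega,T_S$ are the holomorphic tangent bundles, $N_{S|\Omega}=T_\Omega|_S/T_S$ is the normal bundle, and $\iota_*:T_S\to T_\Omega|_S$ is the inclusion. A short exact sequence $0\to E'\to E\to E''\to0$ of holomorphic vector bundles over $S$ splits holomorphically if there is a holomorphic bundle map $E\to E'$ that is a left inverse of $E'\to E$. Saying that $T_\Omega|_S=T_S\oplus(\ker d\widetilde\pi_f)|_S$ is a holomorphic splitting means that the direct sum decomposition yields a short exact sequence $0\to T_S\to T_\Omega|_S\to(\ker d\widetilde\pi_f)|_S\to0$ (the second map being the projection along $T_S$) of holomorphic vector bundles that splits holomorphically. *)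

theory Defs
  imports "HOL-Analysis.Analysis"
begin

text \<open>
  For an index set \<open>I\<close> the space of all vectors supported in \<open>I\<close> is the model of the complex
  Euclidean space of dimension \<open>card I\<close>. A product of domains lying in spaces of different
  dimensions is modelled by partitioning the index type of the ambient space into blocks.
\<close>

definition coord_space :: "'n set \<Rightarrow> (complex^'n::finite) set" where
  "coord_space I = {x. \<forall>a. a \<notin> I \<longrightarrow> x $ a = 0}"

definition coord_proj :: "'n set \<Rightarrow> complex^'n \<Rightarrow> complex^'n::finite" where
  "coord_proj I x = (\<chi> a. if a \<in> I then x $ a else 0)"

definition coord_domain :: "'n set \<Rightarrow> (complex^'n::finite) set \<Rightarrow> bool" where
  "coord_domain I U \<longleftrightarrow>
     openin (top_of_set (coord_space I)) U \<and> connected U \<and> U \<noteq> {}"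

text \<open>
  The derivative is taken within the set \<open>X\<close>, so that the following notion is the usual one
  on open sets, on relatively open subsets of coordinate spaces and on complex submanifolds
  (where it says that the differential along the submanifold is complex linear everywhere).
\<close>

definition hol_fun :: "(complex^'n::finite \<Rightarrow> complex) \<Rightarrow> (complex^'n) set \<Rightarrow> bool" where
  "hol_fun g X \<longleftrightarrow>
     (\<forall>z\<in>X. \<exists>L. (g has_derivative L) (at z within X) \<and> (\<forall>v. L (\<i> *s v) = \<i> * L v))"

definition hol_map :: "(complex^'n::finite \<Rightarrow> complex^'m::finite) \<Rightarrow> (complex^'n) set \<Rightarrow> bool" where
  "hol_map F X \<longleftrightarrow> (\<forall>a. hol_fun (\<lambda>z. F z $ a) X)"

definition hol_matrix ::
    "(complex^'n::finite \<Rightarrow> complex^'m::finite^'l::finite) \<Rightarrow> (complex^'n) set \<Rightarrow> bool" where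
  "hol_matrix A X \<longleftrightarrow> (\<forall>a b. hol_fun (\<lambda>z. A z $ a $ b) X)"

definition biholomorphic ::
    "(complex^'n::finite) set \<Rightarrow> (complex^'m::finite) set \<Rightarrow> (complex^'n \<Rightarrow> complex^'m) \<Rightarrow> bool" where
  "biholomorphic U V \<phi> \<longleftrightarrow> hol_map \<phi> U \<and> bij_betw \<phi> U V \<and> hol_map (inv_into U \<phi>) V"

definition balanced :: "(complex^'n::finite) set \<Rightarrow> bool" where
  "balanced U \<longleftrightarrow> (\<forall>z\<in>U. \<forall>c. cmod c \<le> 1 \<longrightarrow> c *s z \<in> U)"

definition domain_of_holomorphy :: "(complex^'n::finite) set \<Rightarrow> bool" where
  "domain_of_holomorphy W \<longleftrightarrow> open W \<and> connected W \<and> W \<noteq> {} \<and>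
     \<not> (\<exists>V A. open V \<and> connected V \<and> \<not> V \<subseteq> W \<and> open A \<and> A \<noteq> {} \<and> A \<subseteq> V \<inter> W \<and>
          (\<forall>g. hol_fun g W \<longrightarrow> (\<exists>G. hol_fun G V \<and> (\<forall>z\<in>A. G z = g z))))"

definition hol_submersion ::
    "(complex^'n::finite) set \<Rightarrow> (complex^'m::finite) set \<Rightarrow> (complex^'n \<Rightarrow> complex^'m) \<Rightarrow> bool" where
  "hol_submersion W D \<pi> \<longleftrightarrow> hol_map \<pi> W \<and> \<pi> ` W \<subseteq> D \<and>
     (\<forall>z\<in>W. range (frechet_derivative \<pi> (at z)) = UNIV)"

definition hol_embedding ::
    "(complex^'n::finite) set \<Rightarrow> (complex^'m::finite) set \<Rightarrow> (complex^'n \<Rightarrow> complex^'m) \<Rightarrow> bool" where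
  "hol_embedding D W f \<longleftrightarrow> hol_map f D \<and> f ` D \<subseteq> W \<and>
     (\<forall>w\<in>D. inj (frechet_derivative f (at w))) \<and>
     homeomorphism D (f ` D) f (inv_into D f)"

definition embedded_complex_submanifold :: "nat \<Rightarrow> (complex^'n::finite) set \<Rightarrow> bool" where
  "embedded_complex_submanifold d S \<longleftrightarrow>
     (\<forall>p\<in>S. \<exists>V (\<psi> :: complex^'n \<Rightarrow> complex^'n) J.
        open V \<and> p \<in> V \<and> open (\<psi> ` V) \<and> biholomorphic V (\<psi> ` V) \<psi> \<and>
        card J = d \<and> \<psi> ` (S \<inter> V) = \<psi> ` V \<inter> coord_space J)"

text \<open>
  In coordinates these are \<open>\<Sum>\<^sub>a v\<^sub>a \<partial>u/\<partial>z\<^sub>a\<close> and the sum of the \<open>cnj v\<^sub>a\<close> times the derivatives of \<open>u\<close>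
  by the conjugates of the \<open>z\<^sub>a\<close>.
\<close>

definition wirt :: "(complex^'n::finite \<Rightarrow> complex) \<Rightarrow> complex^'n \<Rightarrow> complex^'n \<Rightarrow> complex" where
  "wirt u v z =
     (frechet_derivative u (at z) v - \<i> * frechet_derivative u (at z) (\<i> *s v)) / 2"

definition wirt_bar :: "(complex^'n::finite \<Rightarrow> complex) \<Rightarrow> complex^'n \<Rightarrow> complex^'n \<Rightarrow> complex" where
  "wirt_bar u v z =
     (frechet_derivative u (at z) v + \<i> * frechet_derivative u (at z) (\<i> *s v)) / 2"

definition levi :: "(complex^'n::finite \<Rightarrow> real) \<Rightarrow> complex^'n \<Rightarrow> complex^'n \<Rightarrow> complex^'n \<Rightarrow> complex" where
  "levi u z v w = wirt (wirt_bar (\<lambda>\<zeta>. complex_of_real (u \<zeta>)) w) v z"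

text \<open>
  The Hermitian form \<open>\<Sum> g\<^sub>a\<^sub>b v\<^sub>a cnj w\<^sub>b\<close> with potential \<open>- log h(z,z)\<close>, and the associated 2-form,
  i.e. \<open>\<i>\<close> times the sum of the \<open>g\<^sub>a\<^sub>b\<close> times the wedge product of \<open>dz\<^sub>a\<close> and the conjugate
  of \<open>dz\<^sub>b\<close>, evaluated on two real tangent vectors.
\<close>

definition herm_metric ::
    "(complex^'n::finite \<Rightarrow> complex^'n \<Rightarrow> complex) \<Rightarrow> complex^'n \<Rightarrow> complex^'n \<Rightarrow> complex^'n \<Rightarrow> complex" where
  "herm_metric h z v w = - levi (\<lambda>\<zeta>. ln (Re (h \<zeta> \<zeta>))) z v w"

definition kahler_form ::
    "(complex^'n::finite \<Rightarrow> complex^'n \<Rightarrow> complex) \<Rightarrow> complex^'n \<Rightarrow> complex^'n \<Rightarrow> complex^'n \<Rightarrow> complex" where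
  "kahler_form h z v w = \<i> * (herm_metric h z v w - herm_metric h z w v)"

text \<open>
  For \<open>X\<close> relatively open in a coordinate space, the derivative within \<open>X\<close> is determined
  on that coordinate space only; there the pullback is the expected one.
\<close>

definition pullback ::
    "(complex^'n::finite) set \<Rightarrow> (complex^'n \<Rightarrow> complex^'m::finite) \<Rightarrow>
     (complex^'m \<Rightarrow> complex^'m \<Rightarrow> complex^'m \<Rightarrow> complex) \<Rightarrow>
     complex^'n \<Rightarrow> complex^'n \<Rightarrow> complex^'n \<Rightarrow> complex" where
  "pullback X F \<omega> z v w =
     \<omega> (F z) (frechet_derivative F (at z within X) v) (frechet_derivative F (at z within X) w)"

text \<open>
  The metric tensor in the coordinates from \<open>I\<close>, completed by the identity so that \<open>det\<close> is
  the determinant of the \<open>I\<close>-block.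
\<close>

definition metric_matrix ::
    "'n set \<Rightarrow> (complex^'n::finite \<Rightarrow> complex^'n \<Rightarrow> complex) \<Rightarrow> complex^'n \<Rightarrow> complex^'n^'n" where
  "metric_matrix I h z =
     (\<chi> a b. if a \<in> I \<and> b \<in> I then herm_metric h z (axis a 1) (axis b 1)
             else if a = b then 1 else 0)"

definition ricci ::
    "'n set \<Rightarrow> (complex^'n::finite \<Rightarrow> complex^'n \<Rightarrow> complex) \<Rightarrow>
     complex^'n \<Rightarrow> complex^'n \<Rightarrow> complex^'n \<Rightarrow> complex" where
  "ricci I h z v w = - levi (\<lambda>\<zeta>. ln (Re (det (metric_matrix I h \<zeta>)))) z v w"

definition kahler_einstein ::
    "'n set \<Rightarrow> (complex^'n::finite) set \<Rightarrow> (complex^'n \<Rightarrow> complex^'n \<Rightarrow> complex) \<Rightarrow> bool" where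
  "kahler_einstein I U h \<longleftrightarrow>
     (\<forall>z\<in>U. \<forall>v\<in>coord_space I. v \<noteq> 0 \<longrightarrow> Re (herm_metric h z v v) > 0) \<and>
     (\<exists>c::real. \<forall>z\<in>U. \<forall>v\<in>coord_space I. \<forall>w\<in>coord_space I.
        ricci I h z v w = c * herm_metric h z v w)"

text \<open>
  Gaussian curvature at \<open>z\<close> of the complex line through \<open>z\<close> in direction \<open>e\<close>. With
  \<open>g = herm_metric h z e e\<close>, the Riemannian metric of the Kaehler form on this line is
  \<open>2 g |d\<zeta>|\<^sup>2\<close>, and a conformal metric \<open>E |d\<zeta>|\<^sup>2\<close> has curvature \<open>- \<Delta> (log E) / (2 E)\<close>, where the
  Laplacian is four times the mixed Wirtinger derivative.
\<close>

definition gauss_curvature ::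
    "(complex^'n::finite \<Rightarrow> complex^'n \<Rightarrow> complex) \<Rightarrow> complex^'n \<Rightarrow> complex^'n \<Rightarrow> complex" where
  "gauss_curvature h e z =
     - levi (\<lambda>\<zeta>. ln (Re (herm_metric h \<zeta> e e))) z e e / herm_metric h z e e"

definition symmetric_domain :: "(complex^'n::finite) set \<Rightarrow> bool" where
  "symmetric_domain U \<longleftrightarrow>
     (\<forall>p\<in>U. \<exists>s. biholomorphic U U s \<and> (\<forall>z\<in>U. s (s z) = z) \<and> s p = p \<and>
        (\<exists>\<epsilon>>0. \<forall>z\<in>U. s z = z \<and> dist z p < \<epsilon> \<longrightarrow> z = p))"

definition irreducible_domain :: "'n set \<Rightarrow> (complex^'n::finite) set \<Rightarrow> bool" where
  "irreducible_domain I U \<longleftrightarrow> I \<noteq> {} \<and>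
     \<not> (\<exists>J K V W \<phi>. J \<noteq> {} \<and> K \<noteq> {} \<and> J \<inter> K = {} \<and> J \<union> K = I \<and>
          coord_domain J V \<and> coord_domain K W \<and>
          biholomorphic U {x + y | x y. x \<in> V \<and> y \<in> W} \<phi>)"

definition herm_prod :: "complex^'n::finite \<Rightarrow> complex^'n \<Rightarrow> complex" where
  "herm_prod v w = (\<Sum>a\<in>UNIV. v $ a * cnj (w $ a))"

text \<open>
  In the Harish-Chandra embedding the ambient space is the abelian subalgebra \<open>p\<^sup>+\<close> of the
  complexified Lie algebra of the automorphism group. The brackets of \<open>p\<^sup>+\<close>, of its conjugate
  and of \<open>p\<^sup>+\<close> again turn it into a positive Hermitian Jordan triple system, whose product is
  written \<open>T x y z\<close>, and the image of the embedding is the open unit ball of that triple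
  system: the set of all \<open>x\<close> for which \<open>Id - D(x,x)\<close> is positive definite, where
  \<open>D(x,y) z = T x y z\<close>. The triple product is normalized so that \<open>T x y z = x (cnj y) z\<close> for
  the unit disc.
\<close>

definition positive_hermitian_jts ::
    "'n set \<Rightarrow> (complex^'n::finite \<Rightarrow> complex^'n \<Rightarrow> complex^'n \<Rightarrow> complex^'n) \<Rightarrow> bool" where
  "positive_hermitian_jts I T \<longleftrightarrow>
     (\<forall>x\<in>coord_space I. \<forall>y\<in>coord_space I. \<forall>z\<in>coord_space I.
        T x y z \<in> coord_space I \<and> T x y z = T z y x \<and>
        (\<forall>u\<in>coord_space I. T (x + u) y z = T x y z + T u y z \<and>
                            T x (y + u) z = T x y z + T x u z) \<and>
        (\<forall>c. T (c *s x) y z = c *s T x y z \<and> T x (c *s y) z = cnj c *s T x y z)) \<and>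
     (\<forall>a\<in>coord_space I. \<forall>b\<in>coord_space I. \<forall>x\<in>coord_space I. \<forall>y\<in>coord_space I. \<forall>z\<in>coord_space I.
        T a b (T x y z) = T (T a b x) y z - T x (T b a y) z + T x y (T a b z)) \<and>
     (\<forall>x\<in>coord_space I. \<forall>y\<in>coord_space I. \<forall>u\<in>coord_space I. \<forall>v\<in>coord_space I.
        herm_prod (T x y u) v = herm_prod u (T y x v)) \<and>
     (\<forall>x\<in>coord_space I. \<forall>v\<in>coord_space I. Re (herm_prod (T x x v) v) \<ge> 0) \<and>
     (\<forall>x\<in>coord_space I. T x x x = 0 \<longrightarrow> x = 0)"

definition jts_ball ::
    "'n set \<Rightarrow> (complex^'n::finite \<Rightarrow> complex^'n \<Rightarrow> complex^'n \<Rightarrow> complex^'n) \<Rightarrow> (complex^'n) set" where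
  "jts_ball I T = {x \<in> coord_space I. \<forall>v\<in>coord_space I. v \<noteq> 0 \<longrightarrow>
     Re (herm_prod (T x x v) v) < Re (herm_prod v v)}"

text \<open>
  For a minimal tripotent \<open>e\<close> the set of all multiples of \<open>e\<close> in the ball is a minimal disk
  through the origin; every minimal disk is the image of one of these under an automorphism.
\<close>

definition minimal_tripotent ::
    "'n set \<Rightarrow> (complex^'n::finite \<Rightarrow> complex^'n \<Rightarrow> complex^'n \<Rightarrow> complex^'n) \<Rightarrow> complex^'n \<Rightarrow> bool" where
  "minimal_tripotent I T e \<longleftrightarrow> e \<in> coord_space I \<and> e \<noteq> 0 \<and> T e e e = e \<and>
     (\<forall>v\<in>coord_space I. \<exists>c. T e v e = c *s e)"

text \<open>Lebesgue measure of a coordinate space, as a measure on the ambient space.\<close>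

definition coord_measure :: "'n set \<Rightarrow> (complex^'n::finite) measure" where
  "coord_measure I =
     distr (\<Pi>\<^sub>M a\<in>I. (lborel :: complex measure)) borel (\<lambda>x. \<chi> a. if a \<in> I then x a else 0)"

definition bergman_space :: "'n set \<Rightarrow> (complex^'n::finite) set \<Rightarrow> (complex^'n \<Rightarrow> complex) set" where
  "bergman_space I U =
     {g. hol_fun g U \<and> set_integrable (coord_measure I) U (\<lambda>z. (cmod (g z))\<^sup>2)}"

definition bergman_kernel ::
    "'n set \<Rightarrow> (complex^'n::finite) set \<Rightarrow> (complex^'n \<Rightarrow> complex^'n \<Rightarrow> complex) \<Rightarrow> bool" where
  "bergman_kernel I U K \<longleftrightarrow>
     (\<forall>\<xi>\<in>U. (\<lambda>z. K z \<xi>) \<in> bergman_space I U) \<and>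
     (\<forall>g\<in>bergman_space I U. \<forall>\<xi>\<in>U.
        g \<xi> = set_lebesgue_integral (coord_measure I) U (\<lambda>z. g z * cnj (K z \<xi>)))"

definition homogeneous_poly :: "'n set \<Rightarrow> nat \<Rightarrow> (complex^'n::finite \<Rightarrow> complex) \<Rightarrow> bool" where
  "homogeneous_poly I d G \<longleftrightarrow>
     (\<exists>(A :: ('n \<Rightarrow> nat) set) c. finite A \<and> (\<forall>\<alpha>\<in>A. (\<Sum>a\<in>I. \<alpha> a) = d) \<and>
        (\<forall>z. G z = (\<Sum>\<alpha>\<in>A. c \<alpha> * (\<Prod>a\<in>I. (z $ a) ^ \<alpha> a))))"

text \<open>
  The polynomial \<open>h\<close> is a function on the whole ambient space that involves the coordinates
  from \<open>I\<close> only, so derivatives at points of \<open>U\<close> may be taken in the ambient space.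
\<close>

definition hc_polynomial ::
    "'n set \<Rightarrow> (complex^'n::finite) set \<Rightarrow> (complex^'n \<Rightarrow> complex^'n \<Rightarrow> complex) \<Rightarrow> bool" where
  "hc_polynomial I U h \<longleftrightarrow>
     (\<exists>(L::nat) d G. (\<forall>l<L. d l \<ge> 2 \<and> homogeneous_poly I (d l) (G l)) \<and>
        (\<forall>z \<xi>. h z \<xi> = 1 - (\<Sum>a\<in>I. z $ a * cnj (\<xi> $ a))
                         + (\<Sum>l<L. (-1) ^ d l * G l z * cnj (G l \<xi>))) \<and>
        (U = ball 0 1 \<inter> coord_space I \<longrightarrow> L = 0)) \<and>
     (\<exists>K (c::real) (p::nat). bergman_kernel I U K \<and> c > 0 \<and> p > 0 \<and>
        (\<forall>z\<in>U. \<forall>\<xi>\<in>U. K z \<xi> = c * inverse (h z \<xi> ^ p)))"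

text \<open>
  \<open>hc_domain I U h\<close>: \<open>U\<close> is an irreducible bounded symmetric domain in its Harish-Chandra
  realization in the coordinate space of \<open>I\<close>, and \<open>h\<close> is the polynomial whose associated
  form \<open>kahler_form h\<close> is the Kaehler form of the canonical (in particular invariant under all
  automorphisms) Kaehler-Einstein metric for which minimal disks have curvature \<open>-2\<close>.
\<close>

definition hc_domain ::
    "'n set \<Rightarrow> (complex^'n::finite) set \<Rightarrow> (complex^'n \<Rightarrow> complex^'n \<Rightarrow> complex) \<Rightarrow> bool" where
  "hc_domain I U h \<longleftrightarrow>
     coord_domain I U \<and> bounded U \<and> symmetric_domain U \<and> irreducible_domain I U \<and>
     hc_polynomial I U h \<and> kahler_einstein I U h \<and>
     (\<forall>\<phi>. biholomorphic U U \<phi> \<longrightarrow> (\<forall>z\<in>U. \<forall>v\<in>coord_space I. \<forall>w\<in>coord_space I.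
        pullback U \<phi> (kahler_form h) z v w = kahler_form h z v w)) \<and>
     (\<exists>T. positive_hermitian_jts I T \<and> U = jts_ball I T \<and>
        (\<forall>e. minimal_tripotent I T e \<longrightarrow>
           (\<forall>c. c *s e \<in> U \<longrightarrow> gauss_curvature h e (c *s e) = -2)))"

text \<open>The block map \<open>b\<close> sends a coordinate of the product to the factor it belongs to.\<close>

definition block_proj :: "('n \<Rightarrow> 'k) \<Rightarrow> 'k \<Rightarrow> complex^'n \<Rightarrow> complex^'n::finite" where
  "block_proj b i = coord_proj (b -` {i})"

definition domain_product ::
    "('n::finite \<Rightarrow> 'k) \<Rightarrow> ('k \<Rightarrow> (complex^'n) set) \<Rightarrow> (complex^'n) set" where
  "domain_product b D = {w. \<forall>i. block_proj b i w \<in> D i}"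

definition hol_isometric_embedding ::
    "('n::finite \<Rightarrow> 'k::finite) \<Rightarrow> ('k \<Rightarrow> (complex^'n) set) \<Rightarrow>
     ('k \<Rightarrow> complex^'n \<Rightarrow> complex^'n \<Rightarrow> complex) \<Rightarrow> ('k \<Rightarrow> real) \<Rightarrow>
     ('N::finite \<Rightarrow> 'm::finite) \<Rightarrow> ('m \<Rightarrow> (complex^'N) set) \<Rightarrow>
     ('m \<Rightarrow> complex^'N \<Rightarrow> complex^'N \<Rightarrow> complex) \<Rightarrow> ('m \<Rightarrow> real) \<Rightarrow>
     (complex^'n \<Rightarrow> complex^'N) \<Rightarrow> bool" where
  "hol_isometric_embedding b D hD lam b' W hO mu f \<longleftrightarrow>
     hol_embedding (domain_product b D) (domain_product b' W) f \<and>
     (\<forall>w\<in>domain_product b D. \<forall>v v'.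
        (\<Sum>j\<in>UNIV. complex_of_real (mu j) *
           pullback (domain_product b D) (\<lambda>x. block_proj b' j (f x)) (kahler_form (hO j)) w v v') =
        (\<Sum>i\<in>UNIV. complex_of_real (lam i) *
           pullback (domain_product b D) (block_proj b i) (kahler_form (hD i)) w v v'))"

text \<open>
  A chart \<open>(V, J, \<tau>)\<close> trivializes the bundle over the intersection of the base with the open set
  \<open>V\<close>: each \<open>\<tau> q\<close> identifies the fibre over \<open>q\<close> with the coordinate space of \<open>J\<close>. The vector
  space structure of the fibres is the one transported by the charts. All bundles needed here
  have rank at most the dimension of the ambient space.
\<close>

record ('N, 'b) hvb =
  fibre :: "complex^'N \<Rightarrow> 'b set"
  charts :: "((complex^'N) set \<times> 'N set \<times> (complex^'N \<Rightarrow> 'b \<Rightarrow> complex^'N)) set"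

definition bundle_map ::
    "(complex^'N::finite) set \<Rightarrow> ('N, 'b) hvb \<Rightarrow> ('N, 'c) hvb \<Rightarrow> (complex^'N \<Rightarrow> 'b \<Rightarrow> 'c) \<Rightarrow> bool" where
  "bundle_map S E F \<Phi> \<longleftrightarrow>
     (\<forall>q\<in>S. \<Phi> q ` fibre E q \<subseteq> fibre F q) \<and>
     (\<forall>(V, J, \<tau>)\<in>charts E. \<forall>(W, K, \<sigma>)\<in>charts F.
        \<exists>A :: complex^'N \<Rightarrow> complex^'N^'N. hol_matrix A (S \<inter> V \<inter> W) \<and>
          (\<forall>q\<in>S \<inter> V \<inter> W. \<forall>x\<in>coord_space J.
             \<sigma> q (\<Phi> q (inv_into (fibre E q) (\<tau> q) x)) = A q *v x))"

text \<open>The last conjunct says that the transition functions are linear and holomorphic.\<close>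

definition hol_vector_bundle :: "(complex^'N::finite) set \<Rightarrow> ('N, 'b) hvb \<Rightarrow> bool" where
  "hol_vector_bundle S E \<longleftrightarrow>
     (\<forall>(V, J, \<tau>)\<in>charts E. open V \<and> (\<forall>q\<in>S \<inter> V. bij_betw (\<tau> q) (fibre E q) (coord_space J))) \<and>
     S \<subseteq> (\<Union>(V, J, \<tau>)\<in>charts E. V) \<and>
     bundle_map S E E (\<lambda>q v. v)"

definition fibre_zero :: "('N::finite, 'b) hvb \<Rightarrow> complex^'N \<Rightarrow> 'b \<Rightarrow> bool" where
  "fibre_zero E q v \<longleftrightarrow> v \<in> fibre E q \<and> (\<forall>(V, J, \<tau>)\<in>charts E. q \<in> V \<longrightarrow> \<tau> q v = 0)"

definition short_exact ::
    "(complex^'N::finite) set \<Rightarrow> ('N, 'a) hvb \<Rightarrow> (complex^'N \<Rightarrow> 'a \<Rightarrow> 'b) \<Rightarrow> ('N, 'b) hvb \<Rightarrow>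
     (complex^'N \<Rightarrow> 'b \<Rightarrow> 'c) \<Rightarrow> ('N, 'c) hvb \<Rightarrow> bool" where
  "short_exact S E' i E p E'' \<longleftrightarrow>
     hol_vector_bundle S E' \<and> hol_vector_bundle S E \<and> hol_vector_bundle S E'' \<and>
     bundle_map S E' E i \<and> bundle_map S E E'' p \<and>
     (\<forall>q\<in>S. inj_on (i q) (fibre E' q) \<and> p q ` fibre E q = fibre E'' q \<and>
        i q ` fibre E' q = {v \<in> fibre E q. fibre_zero E'' q (p q v)})"

definition splits_holomorphically ::
    "(complex^'N::finite) set \<Rightarrow> ('N, 'a) hvb \<Rightarrow> (complex^'N \<Rightarrow> 'a \<Rightarrow> 'b) \<Rightarrow> ('N, 'b) hvb \<Rightarrow>
     (complex^'N \<Rightarrow> 'b \<Rightarrow> 'c) \<Rightarrow> ('N, 'c) hvb \<Rightarrow> bool" where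
  "splits_holomorphically S E' i E p E'' \<longleftrightarrow>
     short_exact S E' i E p E'' \<and>
     (\<exists>r. bundle_map S E E' r \<and> (\<forall>q\<in>S. \<forall>v\<in>fibre E' q. r q (i q v) = v))"

text \<open>
  Subbundles of the trivial bundle: the charts are the inverses of the holomorphic local frames,
  a frame over \<open>S \<inter> V\<close> being given by the columns \<open>a \<in> J\<close> of a matrix \<open>A q\<close>.
\<close>

definition subbundle ::
    "(complex^'N::finite) set \<Rightarrow> (complex^'N \<Rightarrow> (complex^'N) set) \<Rightarrow> ('N, complex^'N) hvb" where
  "subbundle S F =
     \<lparr> fibre = F,
       charts = {(V, J, \<tau>). open V \<and>
         (\<exists>A :: complex^'N \<Rightarrow> complex^'N^'N. hol_matrix A (S \<inter> V) \<and>
            (\<forall>q\<in>S \<inter> V. bij_betw (\<lambda>x. A q *v x) (coord_space J) (F q) \<and>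
               (\<forall>x\<in>coord_space J. \<tau> q (A q *v x) = x)))} \<rparr>"

definition coset :: "(complex^'N::finite) set \<Rightarrow> complex^'N \<Rightarrow> (complex^'N) set" where
  "coset E v = {v + e | e. e \<in> E}"

text \<open>
  The quotient of \<open>F\<close> by its subbundle \<open>E\<close>: a chart is induced by a holomorphic family of linear
  maps from the fibres of \<open>F\<close> onto the coordinate space of \<open>J\<close>, with kernels the fibres of \<open>E\<close>.
\<close>

definition quotient_bundle ::
    "(complex^'N::finite) set \<Rightarrow> (complex^'N \<Rightarrow> (complex^'N) set) \<Rightarrow>
     (complex^'N \<Rightarrow> (complex^'N) set) \<Rightarrow> ('N, (complex^'N) set) hvb" where
  "quotient_bundle S F E =
     \<lparr> fibre = (\<lambda>q. coset (E q) ` F q),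
       charts = {(V, J, \<tau>). open V \<and>
         (\<exists>A :: complex^'N \<Rightarrow> complex^'N^'N. hol_matrix A (S \<inter> V) \<and>
            (\<forall>q\<in>S \<inter> V. (\<lambda>v. A q *v v) ` F q = coord_space J \<and>
               E q = {v \<in> F q. A q *v v = 0} \<and>
               (\<forall>v\<in>F q. \<tau> q (coset (E q) v) = A q *v v)))} \<rparr>"

text \<open>
  The holomorphic tangent space of a complex submanifold is identified with its real tangent
  space, the set of velocities of curves in the submanifold.
\<close>

definition tangent_space :: "(complex^'N::finite) set \<Rightarrow> complex^'N \<Rightarrow> (complex^'N) set" where
  "tangent_space X p =
     {v. \<exists>\<gamma> :: real \<Rightarrow> complex^'N. \<gamma> 0 = p \<and> (\<forall>t. \<gamma> t \<in> X) \<and>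
           (\<gamma> has_vector_derivative v) (at 0)}"

definition kernel_of_differential ::
    "(complex^'N::finite) set \<Rightarrow> (complex^'N \<Rightarrow> complex^'n::finite) \<Rightarrow>
     complex^'N \<Rightarrow> (complex^'N) set" where
  "kernel_of_differential \<Omega> \<pi> q = {v \<in> tangent_space \<Omega> q. frechet_derivative \<pi> (at q) v = 0}"

definition direct_sum :: "(complex^'N::finite) set \<Rightarrow> (complex^'N) set \<Rightarrow> (complex^'N) set \<Rightarrow> bool" where
  "direct_sum A B C \<longleftrightarrow> vec.subspace B \<and> vec.subspace C \<and>
     A = {x + y | x y. x \<in> B \<and> y \<in> C} \<and> B \<inter> C = {0}"

definition projection_along ::
    "(complex^'N::finite) set \<Rightarrow> (complex^'N) set \<Rightarrow> complex^'N \<Rightarrow> complex^'N" where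
  "projection_along B C v = (THE y. y \<in> C \<and> v - y \<in> B)"

definition holomorphic_splitting ::
    "(complex^'N::finite) set \<Rightarrow> (complex^'N) set \<Rightarrow> (complex^'N \<Rightarrow> complex^'n::finite) \<Rightarrow> bool" where
  "holomorphic_splitting \<Omega> S \<pi> \<longleftrightarrow>
     (\<forall>q\<in>S. direct_sum (tangent_space \<Omega> q) (tangent_space S q) (kernel_of_differential \<Omega> \<pi> q)) \<and>
     splits_holomorphically S
       (subbundle S (tangent_space S)) (\<lambda>q v. v)
       (subbundle S (tangent_space \<Omega>))
       (\<lambda>q. projection_along (tangent_space S q) (kernel_of_differential \<Omega> \<pi> q))
       (subbundle S (kernel_of_differential \<Omega> \<pi>))"

definition tangent_sequence_splits ::
    "(complex^'N::finite) set \<Rightarrow> (complex^'N) set \<Rightarrow> bool" where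
  "tangent_sequence_splits \<Omega> S \<longleftrightarrow>
     splits_holomorphically S
       (subbundle S (tangent_space S)) (\<lambda>q v. v)
       (subbundle S (tangent_space \<Omega>))
       (\<lambda>q. coset (tangent_space S q))
       (quotient_bundle S (tangent_space \<Omega>) (tangent_space S))"

end

theory Submission
  imports Defs "HOL-Complex_Analysis.Conformal_Mappings"
begin

text \<open>
  Write \<open>h(z, \<xi>) = 1 + \<Sum>\<^sub>k \<epsilon>\<^sub>k g\<^sub>k(z) cnj (g\<^sub>k(\<xi>))\<close> for each factor. The isometry condition is an identity for the
  mixed second derivatives of \<open>log h\<close> on the diagonal of \<open>D \<times> D\<close>. As some power of \<open>1 / h\<close> is a multiple of
  the Bergman kernel, \<open>h\<close> has no zeros on a factor, and the identity polarizes to all of \<open>D \<times> D\<close>. Integrated in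
  the first variable and evaluated at \<open>\<xi> = 0\<close>, where \<open>h(w, \<xi>)\<close> is \<open>1 - \<Sum>\<^sub>a w\<^sub>a cnj \<xi>\<^sub>a\<close> to first order, it
  expresses every coordinate of \<open>w\<close> as a holomorphic function of \<open>f(w)\<close> that is defined on all of \<open>\<Omega>\<close>.
  This is the retraction \<open>\<pi>\<close>, and it is linear if \<open>f(0) = 0\<close>; the base point \<open>f(0)\<close> may be arbitrary, so
  no automorphisms of \<open>\<Omega>\<close> are used. With \<open>P = df \<circ> d\<pi>\<close> the holomorphic projections \<open>P\<close> and \<open>1 - P\<close> split the
  tangent sequence. A second integration preserves Calabi's diastasis, which is unbounded at the boundary of
  \<open>D\<close> since \<open>h\<close> vanishes there; hence \<open>f\<close> is proper. The factors are convex, as a positive semidefinite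
  Hermitian form is convex on the diagonal; so \<open>\<Omega> \<inter> \<pi>\<^sup>-\<^sup>1(D)\<close> minus the zeros of \<open>det (d\<pi> \<circ> df)\<close> has
  a domain of holomorphy as its component containing \<open>f(D)\<close>.
\<close>

section \<open>Holomorphic functions on subsets of complex Euclidean space\<close>

text \<open>Polarizing \<open>log h(z, \<xi>)\<close> itself would require branches of the logarithm
  off the diagonal. Its mixed derivative avoids this: it is rational in the \<open>g_k\<close> and
  their derivatives, with the square of \<open>h\<close> as denominator, so that \<open>h\<close>
  having no zeros is all that polarization requires. Convexity of \<open>D\<close> supplies the
  complex lines for polarization, which meet \<open>D\<close> in connected sets, and the
  connectedness needed to integrate. Several variables are reduced to one by restriction to such
  lines; as derivatives enter the polarized identity, they must be known to be holomorphic
  themselves.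

  For the bundles the obstacle is that the charts comprise all holomorphic frames. A bundle map has
  to be written in arbitrary frames, and its coefficients, determined pointwise by linear systems,
  must be shown to be holomorphic.

  The zeros of the determinant are removed because a submersion is required: the differential of the
  retraction is onto along \<open>f(D)\<close>, but perhaps not elsewhere. A linear retraction has
  constant differential, so nothing is removed, and convexity survives.\<close>

lemma scaleR_eq_smult: "c *\<^sub>R v = complex_of_real c *s (v::complex^'n::finite)"
  by (simp add: vec_eq_iff) (simp add: scaleR_conv_of_real)

lemma clinear_smult:
  fixes L :: "complex^'n::finite \<Rightarrow> complex"
  assumes "linear L" "\<forall>v. L (\<i> *s v) = \<i> * L v"
  shows "L (c *s v) = c * L v"
proof -
  have "c *s v = Re c *\<^sub>R v + Im c *\<^sub>R (\<i> *s v)"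
    by (simp add: vec_eq_iff complex_eq_iff)
  then show ?thesis
    using assms by (simp add: linear_add linear_scale)
      (simp add: complex_eq_iff scaleR_conv_of_real algebra_simps)
qed

lemma has_derivative_vec_iff:
  fixes f :: "'a::real_normed_vector \<Rightarrow> complex^'m::finite"
  shows "(f has_derivative f') (at x within S) \<longleftrightarrow>
    (\<forall>a. ((\<lambda>x. f x $ a) has_derivative (\<lambda>v. f' v $ a)) (at x within S))"
proof
  assume "(f has_derivative f') (at x within S)"
  then show "\<forall>a. ((\<lambda>x. f x $ a) has_derivative (\<lambda>v. f' v $ a)) (at x within S)"
    using bounded_linear.has_derivative[OF bounded_linear_vec_nth] by blast
next
  assume *: "\<forall>a. ((\<lambda>x. f x $ a) has_derivative (\<lambda>v. f' v $ a)) (at x within S)"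
  have "((\<lambda>x. f x \<bullet> b) has_derivative (\<lambda>v. f' v \<bullet> b)) (at x within S)" if "b \<in> Basis" for b
  proof -
    from that obtain a c where b: "b = axis a c"
      by (auto simp: Basis_vec_def)
    show ?thesis
      unfolding b inner_axis using * by (intro has_derivative_inner_left) auto
  qed
  then show "(f has_derivative f') (at x within S)"
    by (subst has_derivative_componentwise_within) auto
qed

lemma hol_funE:
  assumes "hol_fun g X" "z \<in> X"
  obtains L where "(g has_derivative L) (at z within X)" "\<And>c v. L (c *s v) = c * L v"
proof -
  obtain L where L: "(g has_derivative L) (at z within X)" "\<forall>v. L (\<i> *s v) = \<i> * L v"
    using assms unfolding hol_fun_def by blast
  then have "L (c *s v) = c * L v" for c v
    using clinear_smult[OF has_derivative_linear] by blast
  with L(1) that show thesis by blast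
qed

lemma hol_funI:
  assumes "\<And>z. z \<in> X \<Longrightarrow> \<exists>L. (g has_derivative L) (at z within X) \<and> (\<forall>c v. L (c *s v) = c * L v)"
  shows "hol_fun g X"
  using assms unfolding hol_fun_def by blast

lemma hol_fun_subset: "hol_fun g X \<Longrightarrow> Y \<subseteq> X \<Longrightarrow> hol_fun g Y"
  unfolding hol_fun_def by (meson has_derivative_subset subset_eq)

lemma hol_map_subset: "hol_map g X \<Longrightarrow> Y \<subseteq> X \<Longrightarrow> hol_map g Y"
  unfolding hol_map_def using hol_fun_subset by blast

lemma hol_matrix_subset: "hol_matrix g X \<Longrightarrow> Y \<subseteq> X \<Longrightarrow> hol_matrix g Y"
  unfolding hol_matrix_def using hol_fun_subset by blast

lemma hol_fun_continuous_on: "hol_fun g X \<Longrightarrow> continuous_on X g"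
  unfolding hol_fun_def continuous_on_eq_continuous_within
  using has_derivative_continuous by blast

lemma hol_map_continuous_on: "hol_map F X \<Longrightarrow> continuous_on X F"
  using continuous_on_vec_lambda[of X "\<lambda>a z. F z $ a"]
  unfolding hol_map_def by (simp add: hol_fun_continuous_on)

lemma hol_fun_cong:
  assumes "\<And>z. z \<in> X \<Longrightarrow> f z = g z"
  shows "hol_fun f X \<longleftrightarrow> hol_fun g X"
  unfolding hol_fun_def using assms by (metis has_derivative_transform)

lemma hol_fun_local:
  assumes "\<And>z. z \<in> X \<Longrightarrow> \<exists>V. open V \<and> z \<in> V \<and> hol_fun g (X \<inter> V)"
  shows "hol_fun g X"
proof (rule hol_funI)
  fix z assume "z \<in> X"
  then obtain V where V: "open V" "z \<in> V" "hol_fun g (X \<inter> V)" using assms by blast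
  with \<open>z \<in> X\<close> obtain L where L: "(g has_derivative L) (at z within X \<inter> V)" "\<And>c v. L (c *s v) = c * L v"
    by (metis IntI hol_funE)
  have "at z within X \<inter> V = at z within X"
    by (rule at_within_nhd[OF V(2,1)]) blast
  with L show "\<exists>L. (g has_derivative L) (at z within X) \<and> (\<forall>c v. L (c *s v) = c * L v)"
    by metis
qed

section \<open>Algebra of holomorphic functions, maps and matrices\<close>

lemma hol_fun_const: "hol_fun (\<lambda>z. c) X"
  by (rule hol_funI) (auto intro!: exI[of _ "\<lambda>_. 0"])

lemma hol_fun_nth: "hol_fun (\<lambda>z. z $ a) X"
  by (rule hol_funI, rule exI[of _ "\<lambda>v. v $ a"])
    (auto intro!: bounded_linear_imp_has_derivative bounded_linear_vec_nth)

lemma hol_fun_add: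
  assumes "hol_fun f X" "hol_fun g X"
  shows "hol_fun (\<lambda>z. f z + g z) X"
proof (rule hol_funI)
  fix z assume z: "z \<in> X"
  obtain L where L: "(f has_derivative L) (at z within X)" "\<And>c v. L (c *s v) = c * L v"
    using hol_funE[OF assms(1) z] by blast
  obtain M where M: "(g has_derivative M) (at z within X)" "\<And>c v. M (c *s v) = c * M v"
    using hol_funE[OF assms(2) z] by blast
  show "\<exists>L. ((\<lambda>z. f z + g z) has_derivative L) (at z within X) \<and> (\<forall>c v. L (c *s v) = c * L v)"
    using L M by (intro exI[of _ "\<lambda>v. L v + M v"]) (auto intro!: derivative_eq_intros simp: algebra_simps)
qed

lemma hol_fun_mult:
  assumes "hol_fun f X" "hol_fun g X"
  shows "hol_fun (\<lambda>z. f z * g z) X"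
proof (rule hol_funI)
  fix z assume z: "z \<in> X"
  obtain L where L: "(f has_derivative L) (at z within X)" "\<And>c v. L (c *s v) = c * L v"
    using hol_funE[OF assms(1) z] by blast
  obtain M where M: "(g has_derivative M) (at z within X)" "\<And>c v. M (c *s v) = c * M v"
    using hol_funE[OF assms(2) z] by blast
  show "\<exists>L. ((\<lambda>z. f z * g z) has_derivative L) (at z within X) \<and> (\<forall>c v. L (c *s v) = c * L v)"
    using L M by (intro exI[of _ "\<lambda>v. f z * M v + L v * g z"]) (auto intro!: derivative_eq_intros simp: algebra_simps)
qed

lemma hol_fun_inverse:
  assumes "hol_fun f X" "\<And>z. z \<in> X \<Longrightarrow> f z \<noteq> 0"
  shows "hol_fun (\<lambda>z. inverse (f z)) X"
proof (rule hol_funI)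
  fix z assume z: "z \<in> X"
  obtain L where L: "(f has_derivative L) (at z within X)" "\<And>c v. L (c *s v) = c * L v"
    using hol_funE[OF assms(1) z] by blast
  show "\<exists>L. ((\<lambda>z. inverse (f z)) has_derivative L) (at z within X) \<and> (\<forall>c v. L (c *s v) = c * L v)"
    using L assms(2)[OF z]
    by (intro exI[of _ "\<lambda>v. - (inverse (f z) * L v * inverse (f z))"])
      (use Deriv.has_derivative_inverse[OF _ L(1)] in \<open>auto simp: algebra_simps\<close>)
qed

lemma hol_fun_uminus: "hol_fun f X \<Longrightarrow> hol_fun (\<lambda>z. - f z) X"
  using hol_fun_mult[OF hol_fun_const[of "-1"], of f X] by simp

lemma hol_fun_diff: "hol_fun f X \<Longrightarrow> hol_fun g X \<Longrightarrow> hol_fun (\<lambda>z. f z - g z) X"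
  using hol_fun_add[OF _ hol_fun_uminus, of f X g] by simp

lemma hol_fun_divide:
  "hol_fun f X \<Longrightarrow> hol_fun g X \<Longrightarrow> (\<And>z. z \<in> X \<Longrightarrow> g z \<noteq> 0) \<Longrightarrow> hol_fun (\<lambda>z. f z / g z) X"
  unfolding divide_inverse by (intro hol_fun_mult hol_fun_inverse)

lemma hol_fun_sum: "(\<And>k. k \<in> K \<Longrightarrow> hol_fun (f k) X) \<Longrightarrow> hol_fun (\<lambda>z. \<Sum>k\<in>K. f k z) X"
  by (induction K rule: infinite_finite_induct) (auto intro: hol_fun_const hol_fun_add hol_fun_mult)

lemma hol_fun_prod: "(\<And>k. k \<in> K \<Longrightarrow> hol_fun (f k) X) \<Longrightarrow> hol_fun (\<lambda>z. \<Prod>k\<in>K. f k z) X"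
  by (induction K rule: infinite_finite_induct) (auto intro: hol_fun_const hol_fun_add hol_fun_mult)

lemma hol_fun_power: "hol_fun f X \<Longrightarrow> hol_fun (\<lambda>z. f z ^ n) X"
  by (induction n) (auto intro: hol_fun_const hol_fun_mult)

lemma hol_map_vec_lambda: "(\<And>a. hol_fun (f a) X) \<Longrightarrow> hol_map (\<lambda>z. \<chi> a. f a z) X"
  unfolding hol_map_def by simp

lemma hol_map_nth: "hol_map F X \<Longrightarrow> hol_fun (\<lambda>z. F z $ a) X"
  unfolding hol_map_def by simp

lemma hol_matrix_nth: "hol_matrix A X \<Longrightarrow> hol_fun (\<lambda>z. A z $ a $ b) X"
  unfolding hol_matrix_def by simp

lemma hol_map_id: "hol_map (\<lambda>z. z) X"
  unfolding hol_map_def by (simp add: hol_fun_nth)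

lemma hol_map_const: "hol_map (\<lambda>z. c) X"
  unfolding hol_map_def by (simp add: hol_fun_const)

lemma hol_map_add: "hol_map F X \<Longrightarrow> hol_map G X \<Longrightarrow> hol_map (\<lambda>z. F z + G z) X"
  unfolding hol_map_def by (simp add: hol_fun_add)

lemma hol_map_diff: "hol_map F X \<Longrightarrow> hol_map G X \<Longrightarrow> hol_map (\<lambda>z. F z - G z) X"
  unfolding hol_map_def by (simp add: hol_fun_diff)

lemma hol_matrix_const: "hol_matrix (\<lambda>z. A) X"
  unfolding hol_matrix_def by (simp add: hol_fun_const)

lemma hol_matrix_add: "hol_matrix A X \<Longrightarrow> hol_matrix B X \<Longrightarrow> hol_matrix (\<lambda>z. A z + B z) X"
  unfolding hol_matrix_def by (simp add: hol_fun_add)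

lemma hol_matrix_diff: "hol_matrix A X \<Longrightarrow> hol_matrix B X \<Longrightarrow> hol_matrix (\<lambda>z. A z - B z) X"
  unfolding hol_matrix_def by (simp add: hol_fun_diff)

lemma hol_matrix_mult: "hol_matrix A X \<Longrightarrow> hol_matrix B X \<Longrightarrow> hol_matrix (\<lambda>z. A z ** B z) X"
  unfolding hol_matrix_def matrix_matrix_mult_def by (simp add: hol_fun_sum hol_fun_mult)

lemma hol_map_matrix_vector: "hol_matrix A X \<Longrightarrow> hol_map F X \<Longrightarrow> hol_map (\<lambda>z. A z *v F z) X"
  unfolding hol_matrix_def hol_map_def matrix_vector_mult_def by (simp add: hol_fun_sum hol_fun_mult)

lemma hol_fun_det: "hol_matrix A X \<Longrightarrow> hol_fun (\<lambda>z. det (A z)) X"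
  unfolding det_def by (intro hol_fun_sum hol_fun_mult hol_fun_prod hol_fun_const hol_matrix_nth)

lemma hol_mapE:
  assumes "hol_map F X" "z \<in> X"
  obtains L where "(F has_derivative L) (at z within X)" "\<And>c v. L (c *s v) = c *s L v"
proof -
  have "\<forall>a. \<exists>L. ((\<lambda>z. F z $ a) has_derivative L) (at z within X) \<and> (\<forall>c v. L (c *s v) = c * L v)"
    using assms unfolding hol_map_def by (metis hol_funE)
  then obtain L where L: "\<And>a. ((\<lambda>z. F z $ a) has_derivative L a) (at z within X)"
      "\<And>a c v. L a (c *s v) = c * L a v" by metis
  then have "(F has_derivative (\<lambda>v. \<chi> a. L a v)) (at z within X)"
    by (simp add: has_derivative_vec_iff)
  then show thesis by (rule that) (simp add: L vec_eq_iff)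
qed

text \<open>Derivatives are taken within sets, so the chain rule needs no openness of
  \<open>X\<close> or \<open>Y\<close>. This is what makes restriction to the submanifold, which is
  not open, harmless.\<close>

lemma hol_fun_compose:
  assumes "hol_map F X" "hol_fun g Y" "F ` X \<subseteq> Y"
  shows "hol_fun (\<lambda>z. g (F z)) X"
proof (rule hol_funI)
  fix z assume z: "z \<in> X"
  obtain L where L: "(F has_derivative L) (at z within X)" "\<And>c v. L (c *s v) = c *s L v"
    using hol_mapE[OF assms(1) z] by blast
  have "F z \<in> Y" using assms(3) z by blast
  then obtain M where M: "(g has_derivative M) (at (F z) within Y)" "\<And>c v. M (c *s v) = c * M v"
    using hol_funE[OF assms(2)] by blast
  have "((\<lambda>z. g (F z)) has_derivative (\<lambda>v. M (L v))) (at z within X)"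
    using diff_chain_within[OF L(1) has_derivative_subset[OF M(1) assms(3)]]
    by (simp add: o_def)
  then show "\<exists>L. ((\<lambda>z. g (F z)) has_derivative L) (at z within X) \<and> (\<forall>c v. L (c *s v) = c * L v)"
    by (intro exI[of _ "\<lambda>v. M (L v)"] conjI) (simp_all add: L(2) M(2))
qed

lemma hol_map_compose:
  "hol_map F X \<Longrightarrow> hol_map G Y \<Longrightarrow> F ` X \<subseteq> Y \<Longrightarrow> hol_map (\<lambda>z. G (F z)) X"
  unfolding hol_map_def[of G] hol_map_def[of "\<lambda>z. G (F z)"] 
  by (auto intro!: hol_fun_compose[where F = F and X = X and Y = Y])

lemma hol_matrix_compose:
  "hol_map F X \<Longrightarrow> hol_matrix G Y \<Longrightarrow> F ` X \<subseteq> Y \<Longrightarrow> hol_matrix (\<lambda>z. G (F z)) X"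
  unfolding hol_matrix_def by (auto intro!: hol_fun_compose[where F = F and X = X and Y = Y])

lemma hol_map_has_derivative:
  assumes "hol_map F X" "open X" "z \<in> X"
  shows "(F has_derivative frechet_derivative F (at z)) (at z)"
    and "frechet_derivative F (at z) (c *s v) = c *s frechet_derivative F (at z) v"
proof -
  obtain L where L: "(F has_derivative L) (at z within X)" "\<And>c v. L (c *s v) = c *s L v"
    using hol_mapE[OF assms(1,3)] by blast
  note L = L(1)[unfolded at_within_open[OF assms(3,2)]] L(2)
  have "frechet_derivative F (at z) = L" using frechet_derivative_at[OF L(1)] by simp
  with L show "(F has_derivative frechet_derivative F (at z)) (at z)"
    and "frechet_derivative F (at z) (c *s v) = c *s frechet_derivative F (at z) v" by auto
qed

lemma hol_fun_has_derivative:
  assumes "hol_fun F X" "open X" "z \<in> X"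
  shows "(F has_derivative frechet_derivative F (at z)) (at z)"
    and "frechet_derivative F (at z) (c *s v) = c * frechet_derivative F (at z) v"
proof -
  obtain L where L: "(F has_derivative L) (at z within X)" "\<And>c v. L (c *s v) = c * L v"
    using hol_funE[OF assms(1,3)] by blast
  note L = L(1)[unfolded at_within_open[OF assms(3,2)]] L(2)
  have "frechet_derivative F (at z) = L" using frechet_derivative_at[OF L(1)] by simp
  with L show "(F has_derivative frechet_derivative F (at z)) (at z)"
    and "frechet_derivative F (at z) (c *s v) = c * frechet_derivative F (at z) v" by auto
qed

lemma frechet_derivative_nth:
  assumes "hol_map F X" "open X" "z \<in> X"
  shows "frechet_derivative (\<lambda>z. F z $ a) (at z) v = frechet_derivative F (at z) v $ a"
  using frechet_derivative_at[OF has_derivative_vec_iff[THEN iffD1, rule_format,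
      OF hol_map_has_derivative(1)[OF assms], of a]] by (simp add: fun_eq_iff)

section \<open>Restriction to complex lines\<close>

lemma hol_fun_line:
  assumes "hol_fun g X" "open X" "w + s *s v \<in> X"
  shows "((\<lambda>s. g (w + s *s v)) has_field_derivative frechet_derivative g (at (w + s *s v)) v) (at s)"
proof -
  let ?L = "frechet_derivative g (at (w + s *s v))"
  have "((\<lambda>s. w + s *s v) has_derivative (\<lambda>t. t *s v)) (at s)"
    by (subst has_derivative_vec_iff) (auto intro!: derivative_eq_intros)
  then have "((\<lambda>s. g (w + s *s v)) has_derivative (\<lambda>t. ?L (t *s v))) (at s)"
    by (rule has_derivative_compose[where g = g]) (rule hol_fun_has_derivative(1)[OF assms])
  then show ?thesis
    unfolding has_field_derivative_def using hol_fun_has_derivative(2)[OF assms]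
    by (simp add: mult_commute_abs)
qed

lemma continuous_on_line: "continuous_on T (\<lambda>s. w + s *s (v::complex^'n::finite))"
  by (subst vec_lambda_eta[symmetric], intro continuous_on_vec_lambda)
    (auto intro!: continuous_intros)

lemma open_line: "open X \<Longrightarrow> open {s. w + s *s (v::complex^'n::finite) \<in> X}"
  using open_vimage[OF _ continuous_on_line[of UNIV w v]] by (simp add: vimage_def)

lemma hol_fun_line_holomorphic:
  assumes "hol_fun g X" "open X"
  shows "(\<lambda>s. g (w + s *s v)) holomorphic_on {s. w + s *s v \<in> X}"
  unfolding holomorphic_on_open[OF open_line[OF assms(2)]] using hol_fun_line[OF assms] by blast

text \<open>Cauchy's formula for the first derivative on the circle
  \<open>u = r exp(2 pi i t)\<close>: as \<open>du = 2 pi i u dt\<close>, the kernel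
  \<open>1 / u^2\<close> becomes \<open>1 / u\<close>, and the factor \<open>2 pi i\<close>
  cancels.\<close>

lemma deriv_circle_integral:
  assumes "\<phi> holomorphic_on ball 0 R" "0 < r" "r < R"
  shows "deriv \<phi> 0 = integral {0..1} (\<lambda>t. \<phi> (complex_of_real r * exp (2 * of_real pi * \<i> * of_real t)) *
      (exp (- (2 * of_real pi * \<i> * of_real t)) / of_real r))"
proof -
  have holc: "\<phi> holomorphic_on ball 0 r" "continuous_on (cball 0 r) \<phi>"
    using assms by (auto intro!: holomorphic_on_subset[OF assms(1)]
        continuous_on_subset[OF holomorphic_on_imp_continuous_on[OF assms(1)]])
  have vd: "vector_derivative (circlepath 0 r) (at t within {0..1}) =
      2 * pi * \<i> * r * exp (2 * of_real pi * \<i> * of_real t)" if "0 \<le> t" "t \<le> 1" for t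
    using vector_derivative_circlepath01[of t 0 r] that by simp
  have cp: "circlepath 0 r t = of_real r * exp (2 * of_real pi * \<i> * of_real t)" for t
    by (simp add: circlepath)
  have "((\<lambda>u. \<phi> u / (u - 0)^(Suc 1)) has_contour_integral
      ((2 * pi) * \<i> / (fact 1) * (deriv ^^ 1) \<phi> 0)) (circlepath 0 r)"
    using Cauchy_has_contour_integral_higher_derivative_circlepath[OF holc(2,1), of 0 1] assms(2) by simp
  then have "((\<lambda>t. \<phi> (circlepath 0 r t) / (circlepath 0 r t)^2 *
      vector_derivative (circlepath 0 r) (at t within {0..1})) has_integral (2 * pi) * \<i> * deriv \<phi> 0) {0..1}"
    by (simp add: has_contour_integral_def power2_eq_square)
  then have "((\<lambda>t. (\<phi> (circlepath 0 r t) / (circlepath 0 r t)^2 *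
      vector_derivative (circlepath 0 r) (at t within {0..1})) / (2 * pi * \<i>)) has_integral
      ((2 * pi) * \<i> * deriv \<phi> 0) / (2 * pi * \<i>)) {0..1}"
    by (rule has_integral_divide)
  then have "((\<lambda>t. \<phi> (r * exp (2 * of_real pi * \<i> * of_real t)) *
      (exp (- (2 * of_real pi * \<i> * of_real t)) / of_real r)) has_integral deriv \<phi> 0) {0..1}"
    by (rule has_integral_eq_rhs[OF has_integral_eq[rotated]])
      (use assms(2) in \<open>auto simp: cp vd exp_minus field_simps power2_eq_square\<close>)
  then show ?thesis by (rule integral_unique[symmetric])
qed

lemma hol_fun_derivative_integral:
  assumes g: "hol_fun g X" and "open X" and r: "0 < r" "r < R" and sub: "\<And>s. cmod s < R \<Longrightarrow> z + s *s v \<in> X"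
  shows "frechet_derivative g (at z) v = integral {0..1} (\<lambda>t. g (z + (of_real r * exp (2 * of_real pi * \<i> * of_real t)) *s v) *
      (exp (- (2 * of_real pi * \<i> * of_real t)) / of_real r))"
proof -
  have hol: "(\<lambda>s. g (z + s *s v)) holomorphic_on ball 0 R"
    by (rule holomorphic_on_subset[OF hol_fun_line_holomorphic[OF g \<open>open X\<close>]]) (auto intro: sub)
  have "deriv (\<lambda>s. g (z + s *s v)) 0 = frechet_derivative g (at z) v"
    using hol_fun_line[OF g \<open>open X\<close>, of z 0 v] sub[of 0] r by (simp add: DERIV_imp_deriv)
  then show ?thesis by (subst (asm) deriv_circle_integral[OF hol r]) simp
qed

lemma norm_smult: "norm (s *s (v::complex^'n::finite)) = cmod s * norm v"
  unfolding norm_vec_def by (simp add: norm_mult L2_set_right_distrib)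

lemma continuous_on_smult:
  "continuous_on S f \<Longrightarrow> continuous_on S g \<Longrightarrow> continuous_on S (\<lambda>x. f x *s (g x :: complex^'n::finite))"
  unfolding vector_scalar_mult_def
  by (intro continuous_on_vec_lambda continuous_on_mult) (auto intro: continuous_on_component)

text \<open>The circle \<open>e\<close> and the kernel \<open>k\<close> do not depend on the point
  \<open>z\<close> near \<open>z0\<close>, so the derivative in direction \<open>v\<close> is a
  parameter integral over a fixed interval. This form serves both for its continuity and for
  differentiating it again.\<close>

lemma hol_fun_derivative_formula:
  assumes g: "hol_fun g X" and "open X" and z0: "z0 \<in> X"
  obtains d and e k :: "real \<Rightarrow> complex" where "d > 0"
    "continuous_on UNIV e" "continuous_on UNIV k"
    "\<And>z t. z \<in> ball z0 d \<Longrightarrow> z + e t *s v \<in> X"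
    "\<And>z. z \<in> ball z0 d \<Longrightarrow>
      frechet_derivative g (at z) v = integral (cbox 0 1) (\<lambda>t. g (z + e t *s v) * k t)"
proof -
  obtain d where d: "d > 0" "ball z0 d \<subseteq> X" using \<open>open X\<close> z0 openE by blast
  have n: "norm v + 1 > 0" by (simp add: add_nonneg_pos)
  \<comment> \<open>The summand 1 admits \<open>v = 0\<close>. Displacements by
    \<open>s *s v\<close> with \<open>cmod s \<le> R\<close> stay below \<open>d / 2\<close>, which
    leaves the other half of \<open>d\<close> for the centre \<open>z\<close>.\<close>
  define R where "R = d / (2 * (norm v + 1))"
  define r where "r = R / 2"
  have "R > 0" unfolding R_def using d(1) n by simp
  moreover have "R * norm v = d / 2 * (norm v / (norm v + 1))" by (simp add: R_def)
  moreover have "norm v / (norm v + 1) < 1" using n by simp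
  ultimately have R: "R > 0" "R * norm v < d / 2"
    using mult_strict_left_mono[of "norm v / (norm v + 1)" 1 "d/2"] d(1) by auto
  have r: "0 < r" "r < R" using R(1) by (auto simp: r_def)
  have sub: "z + s *s v \<in> X" if "z \<in> ball z0 (d/2)" "cmod s \<le> R" for z s
  proof -
    have "norm (s *s v) < d/2"
      using mult_right_mono[OF that(2), of "norm v"] R(2) by (simp add: norm_smult)
    then have "z + s *s v \<in> ball z0 d"
      using that(1) norm_triangle_ineq4[of "z0 - z" "s *s v"]
      by (simp add: dist_norm diff_diff_eq)
    then show ?thesis using d(2) by blast
  qed
  define e where "e = (\<lambda>t::real. of_real r * exp (2 * of_real pi * \<i> * of_real t))"
  define k where "k = (\<lambda>t::real. exp (- (2 * of_real pi * \<i> * of_real t)) / of_real r)"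
  have ne: "cmod (e t) = r" for t using r by (simp add: e_def norm_mult)
  show thesis
  proof
    show "continuous_on UNIV e"
      unfolding e_def by (intro continuous_on_mult continuous_on_const continuous_on_exp continuous_on_of_real continuous_on_id)
    show "continuous_on UNIV k"
      unfolding k_def divide_inverse
      by (intro continuous_on_mult continuous_on_const continuous_on_exp continuous_on_of_real continuous_on_id continuous_on_minus)
    show "z + e t *s v \<in> X" if "z \<in> ball z0 (d/2)" for z t
      using sub[OF that] ne r by simp
    show "frechet_derivative g (at z) v = integral (cbox 0 1) (\<lambda>t. g (z + e t *s v) * k t)"
      if "z \<in> ball z0 (d/2)" for z
      unfolding cbox_interval e_def k_def
      by (rule hol_fun_derivative_integral[OF g \<open>open X\<close> r]) (use sub[OF that] in simp)
  qed (use d in auto)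
qed

lemma hol_fun_derivative_continuous:
  assumes g: "hol_fun g X" and "open X"
  shows "continuous_on X (\<lambda>z. frechet_derivative g (at z) v)"
proof -
  have "isCont (\<lambda>z. frechet_derivative g (at z) v) z0" if z0: "z0 \<in> X" for z0
  proof -
    obtain d e k where d: "d > 0" and ce: "continuous_on UNIV e" and ck: "continuous_on UNIV k"
      and sub: "\<And>z t. z \<in> ball z0 d \<Longrightarrow> z + e t *s v \<in> X"
      and formula: "\<And>z. z \<in> ball z0 d \<Longrightarrow>
        frechet_derivative g (at z) v = integral (cbox (0::real) 1) (\<lambda>t. g (z + e t *s v) * k t)"
      by (rule hol_fun_derivative_formula[OF g \<open>open X\<close> z0, of v]) (rule that)
    have "continuous_on (ball z0 d) (\<lambda>z. integral (cbox 0 1) (\<lambda>t. g (z + e t *s v) * k t))"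
    proof (rule integral_continuous_on_param)
      show "continuous_on (ball z0 d \<times> cbox 0 1) (\<lambda>(z, t). g (z + e t *s v) * k t)"
        unfolding case_prod_unfold
      proof (intro continuous_on_mult continuous_on_compose2[OF ck] continuous_on_snd continuous_on_id)
        show "continuous_on (ball z0 d \<times> cbox 0 1) (\<lambda>p. g (fst p + e (snd p) *s v))"
          by (rule continuous_on_compose2[OF hol_fun_continuous_on[OF g]])
            (auto intro!: sub continuous_on_add continuous_on_smult continuous_on_const continuous_on_fst
              continuous_on_compose2[OF ce] continuous_on_snd continuous_on_id simp: sub)
      qed simp
    qed
    then have "continuous_on (ball z0 d) (\<lambda>z. frechet_derivative g (at z) v)"
      by (rule continuous_on_eq) (rule formula[symmetric])
    then show ?thesis using d(1) by (simp add: continuous_on_eq_continuous_at)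
  qed
  then show ?thesis by (simp add: continuous_at_imp_continuous_on)
qed

text \<open>Leibniz's rule applied to the integral formula; its continuity condition on the
  derivative of the integrand is the preceding lemma. Complex linearity passes through the
  integral.\<close>

lemma hol_fun_frechet_derivative:
  assumes g: "hol_fun g X" and "open X"
  shows "hol_fun (\<lambda>z. frechet_derivative g (at z) v) X"
proof (rule hol_funI)
  fix z0 assume z0: "z0 \<in> X"
  let ?d = "\<lambda>z. frechet_derivative g (at z)"
  obtain d e k where d: "d > 0" and ce: "continuous_on UNIV e" and ck: "continuous_on UNIV k"
    and sub: "\<And>z t. z \<in> ball z0 d \<Longrightarrow> z + e t *s v \<in> X"
    and formula: "\<And>z. z \<in> ball z0 d \<Longrightarrow>
      ?d z v = integral (cbox (0::real) 1) (\<lambda>t. g (z + e t *s v) * k t)"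
    by (rule hol_fun_derivative_formula[OF g \<open>open X\<close> z0, of v]) (rule that)
  define fx where "fx = (\<lambda>z t. Blinfun (\<lambda>u. ?d (z + e t *s v) u * k t))"
  have bl: "bounded_linear (\<lambda>u. ?d y u * c)" if "y \<in> X" for y c
    using has_derivative_bounded_linear[OF hol_fun_has_derivative(1)[OF g \<open>open X\<close> that]]
    by (rule bounded_linear_mult_const)
  have fx: "blinfun_apply (fx z t) = (\<lambda>u. ?d (z + e t *s v) u * k t)" if "z \<in> ball z0 d" for z t
    unfolding fx_def by (rule bounded_linear_Blinfun_apply[OF bl[OF sub[OF that]]])
  have cfx: "continuous_on (ball z0 d \<times> cbox 0 1) (\<lambda>(z, t). fx z t)"
  proof (rule continuous_on_blinfun_componentwise)
    fix u :: "complex^'a"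
    have "continuous_on (ball z0 d \<times> cbox 0 1) (\<lambda>p. ?d (fst p + e (snd p) *s v) u * k (snd p))"
    proof (intro continuous_on_mult continuous_on_compose2[OF ck] continuous_on_snd continuous_on_id)
      show "continuous_on (ball z0 d \<times> cbox 0 1) (\<lambda>p. ?d (fst p + e (snd p) *s v) u)"
        by (rule continuous_on_compose2[OF hol_fun_derivative_continuous[OF g \<open>open X\<close>]])
          (auto intro!: sub continuous_on_add continuous_on_smult continuous_on_const continuous_on_fst
              continuous_on_compose2[OF ce] continuous_on_snd continuous_on_id simp: sub)
    qed simp
    then show "continuous_on (ball z0 d \<times> cbox 0 1) (\<lambda>p. blinfun_apply (case p of (z, t) \<Rightarrow> fx z t) u)"
      by (rule continuous_on_eq) (auto simp: fx)
  qed
  have ig: "(\<lambda>t. g (z + e t *s v) * k t) integrable_on cbox 0 1" if "z \<in> ball z0 d" for z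
  proof (intro integrable_continuous continuous_on_mult continuous_on_subset[OF ck])
    show "continuous_on (cbox 0 1) (\<lambda>t. g (z + e t *s v))"
      by (rule continuous_on_compose2[OF hol_fun_continuous_on[OF g]])
        (use sub[OF that] in \<open>auto intro!: continuous_on_add continuous_on_smult continuous_on_const
          continuous_on_subset[OF ce]\<close>)
  qed simp
  let ?L = "integral (cbox 0 1) (fx z0)"
  have z0d: "z0 \<in> ball z0 d" using d by simp
  have "((\<lambda>z. integral (cbox 0 1) (\<lambda>t. g (z + e t *s v) * k t)) has_derivative ?L) (at z0 within ball z0 d)"
  proof (rule leibniz_rule[where fx = fx, OF _ ig cfx])
    fix z and t :: real assume z: "z \<in> ball z0 d"
    have "((\<lambda>z. z + e t *s v) has_derivative (\<lambda>u. u)) (at z within ball z0 d)"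
      by (auto intro!: derivative_eq_intros)
    then have "((\<lambda>z. g (z + e t *s v)) has_derivative ?d (z + e t *s v)) (at z within ball z0 d)"
      by (rule has_derivative_compose[where g = g]) (rule hol_fun_has_derivative(1)[OF g \<open>open X\<close> sub[OF z]])
    then show "((\<lambda>z. g (z + e t *s v) * k t) has_derivative blinfun_apply (fx z t)) (at z within ball z0 d)"
      unfolding fx[OF z] by (rule has_derivative_mult_left)
  qed (use d in auto)
  then have "((\<lambda>z. ?d z v) has_derivative ?L) (at z0 within ball z0 d)"
    by (rule has_derivative_transform[OF z0d formula, rotated])
  then have "((\<lambda>z. ?d z v) has_derivative ?L) (at z0)"
    unfolding at_within_open[OF z0d open_ball] .
  then have der: "((\<lambda>z. ?d z v) has_derivative ?L) (at z0 within X)"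
    by (rule has_derivative_at_withinI)
  have L: "?L u = integral (cbox 0 1) (\<lambda>t. ?d (z0 + e t *s v) u * k t)" for u
  proof -
    have "continuous_on (cbox 0 1) (\<lambda>t. (\<lambda>(z, t). fx z t) (z0, t))"
      by (rule continuous_on_compose2[OF cfx]) (use d in \<open>auto intro!: continuous_intros\<close>)
    then have "fx z0 integrable_on cbox 0 1" by (simp add: integrable_continuous_real)
    then show ?thesis by (simp add: blinfun_apply_integral fx[OF z0d])
  qed
  have "?L (c *s u) = c * ?L u" for c u
    unfolding L hol_fun_has_derivative(2)[OF g \<open>open X\<close> sub[OF z0d]] mult.assoc by simp
  with der show "\<exists>L. ((\<lambda>z. ?d z v) has_derivative L) (at z0 within X) \<and> (\<forall>c u. L (c *s u) = c * L u)"
    by blast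
qed

section \<open>Identity theorem and polarization\<close>

lemma holomorphic_eq_zero_nearby:
  assumes "f holomorphic_on S" "open S" "connected S" "0 < e" "\<And>s. s \<in> ball a e \<Longrightarrow> s \<in> S \<and> f s = 0" "t \<in> S"
  shows "f t = 0"
proof (rule analytic_continuation_open[of "ball a e" S f "\<lambda>_. 0"])
  show "ball a e \<noteq> {}" "ball a e \<subseteq> S" using assms by auto
qed (use assms in \<open>auto intro: holomorphic_intros\<close>)

lemma convex_line: "convex X \<Longrightarrow> convex {s. w + s *s (v::complex^'n::finite) \<in> X}"
proof -
  assume "convex X"
  have "linear (\<lambda>s. s *s v)"
    by (auto simp: linear_iff vec_eq_iff algebra_simps)
  moreover have "{s. w + s *s v \<in> X} = (\<lambda>s. s *s v) -` ((+) (- w) ` X)"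
    by (force simp: image_iff)
  ultimately show "convex {s. w + s *s v \<in> X}" using \<open>convex X\<close>
    using convex_linear_vimage[of "\<lambda>s. s *s v" "(+) (- w) ` X"] convex_translation[of X "- w"] by simp
qed

text \<open>The complex line through \<open>a\<close> and \<open>z\<close> meets \<open>X\<close> in
  a convex, hence connected set, on which the one-variable identity theorem carries zeros near
  \<open>a\<close> to \<open>z\<close>.\<close>

lemma hol_fun_zero_convex:
  assumes g: "hol_fun g X" and "open X" "convex X" and A: "open A" "a \<in> A" "A \<subseteq> X" "\<And>y. y \<in> A \<Longrightarrow> g y = 0"
    and z: "z \<in> X"
  shows "g z = 0"
proof -
  define b where "b = z - a"
  have "(0::complex) \<in> {s. a + s *s b \<in> A}" using A(2) by simp
  then obtain e where e: "e > 0" "ball 0 e \<subseteq> {s. a + s *s b \<in> A}"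
    using openE[OF open_line[OF A(1)]] by blast
  have "(\<lambda>s. g (a + s *s b)) 1 = 0"
  proof (rule holomorphic_eq_zero_nearby[OF hol_fun_line_holomorphic[OF g \<open>open X\<close>]
          open_line[OF \<open>open X\<close>] convex_connected[OF convex_line[OF \<open>convex X\<close>]] e(1), where a = 0])
    show "s \<in> {s. a + s *s b \<in> X} \<and> g (a + s *s b) = 0" if "s \<in> ball 0 e" for s
      using e(2) A(3,4) that by blast
    show "1 \<in> {s. a + s *s b \<in> X}" using z by (simp add: b_def)
  qed
  then show ?thesis by (simp add: b_def)
qed

text \<open>The interior of the zero set is also closed in \<open>V\<close>: a ball around a limit
  point meets it, and balls are covered by the convex case.\<close>

lemma hol_fun_identity:
  assumes g: "hol_fun g V" and V: "open V" "connected V" and A: "open A" "A \<noteq> {}" "A \<subseteq> V"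
    "\<And>y. y \<in> A \<Longrightarrow> g y = 0" and z: "z \<in> V"
  shows "g z = 0"
proof -
  define Z where "Z = interior {y \<in> V. g y = 0}"
  have sub: "Z \<subseteq> V" unfolding Z_def using interior_subset by blast
  have "A \<subseteq> Z" unfolding Z_def by (rule interior_maximal) (use A in auto)
  have "openin (top_of_set V) Z" using sub by (simp add: Z_def open_subset)
  moreover have "closedin (top_of_set V) Z"
  proof -
    have "y \<in> Z" if y: "y \<in> V" "y \<in> closure Z" for y
    proof -
      obtain r where r: "r > 0" "ball y r \<subseteq> V" using V y openE by blast
      obtain x where x: "x \<in> Z" "x \<in> ball y r"
        using y r(1) by (metis closure_approachable dist_commute mem_ball)
      have "g t = 0" if "t \<in> ball y r" for t
        by (rule hol_fun_zero_convex[OF hol_fun_subset[OF g r(2)] open_ball convex_ball, of "Z \<inter> ball y r" x])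
          (use x that interior_subset[of "{y \<in> V. g y = 0}"] in \<open>auto simp: Z_def\<close>)
      then show ?thesis unfolding Z_def
        by (intro interiorI[OF open_ball, of y y r]) (use r in auto)
    qed
    then show ?thesis using sub by (auto simp: closedin_closed intro!: exI[of _ "closure Z"] closure_subset[THEN subsetD])
  qed
  ultimately have "Z = V" using V(2) A \<open>A \<subseteq> Z\<close> unfolding connected_clopen by blast
  then show ?thesis using z interior_subset unfolding Z_def by blast
qed

text \<open>Substituting \<open>t = r\<^sup>2 / s\<close> turns the hypothesis on the antidiagonal into one on the circle \<open>cmod s = r\<close>.\<close>

lemma polarization_disc:
  fixes q :: "complex \<Rightarrow> complex \<Rightarrow> complex"
  assumes hol: "\<And>T \<sigma> \<tau>. open T \<Longrightarrow> \<sigma> holomorphic_on T \<Longrightarrow> \<tau> holomorphic_on T \<Longrightarrow>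
      \<sigma> ` T \<subseteq> ball 0 R \<Longrightarrow> \<tau> ` T \<subseteq> ball 0 R \<Longrightarrow> (\<lambda>u. q (\<sigma> u) (\<tau> u)) holomorphic_on T"
    and diag: "\<And>s. cmod s < R \<Longrightarrow> q s (cnj s) = 0"
    and st: "cmod s < R" "cmod t < R"
  shows "q s t = 0"
proof -
  have nz: "q s (of_real (r^2) / s) = 0" if r: "0 < r" "r < R" and s: "r^2 / R < cmod s" "cmod s < R" for r s
  proof -
    \<comment> \<open>The annulus consists of the \<open>u\<close> for which \<open>u\<close> and
      \<open>r^2 / u\<close> both lie in the disc of radius \<open>R\<close>. It contains the circle
      of radius \<open>r\<close>, where \<open>r^2 / u\<close> is the conjugate of
      \<open>u\<close>.\<close>
    define T where "T = {u::complex. r^2 / R < norm (u - 0) \<and> norm (u - 0) < R}"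
    have R: "0 < R" using r by simp
    have lt: "r^2 / R < r" using r R by (simp add: power2_eq_square field_simps)
    have "open T" unfolding T_def
      by (intro open_Collect_conj open_Collect_less continuous_intros)
    have T: "u \<noteq> 0" "cmod (of_real (r^2) / u) < R" if "u \<in> T" for u
    proof -
      have u: "r^2 / R < cmod u" using that by (simp add: T_def)
      then have "cmod u > 0" using R r by (smt (verit) divide_nonneg_pos zero_le_power2)
      then show "u \<noteq> 0" "cmod (of_real (r^2) / u) < R"
        using u R by (auto simp: norm_divide norm_power field_simps)
    qed
    have "connected T"
      unfolding T_def by (rule connected_annulus) simp
    have hol': "(\<lambda>u. q u (of_real (r^2) / u)) holomorphic_on T"
      by (rule hol[OF \<open>open T\<close>]) (use T in \<open>auto intro!: holomorphic_intros simp: T_def\<close>)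
    have sphere_ne: "sphere 0 r \<noteq> {x}" for x :: complex
    proof
      assume *: "sphere 0 r = {x}"
      have "complex_of_real r \<in> sphere 0 r" "- complex_of_real r \<in> sphere 0 r" using r by simp_all
      then have "complex_of_real r = - complex_of_real r" unfolding * by simp
      then show False using r by simp
    qed
    show ?thesis
    proof (rule analytic_continuation[OF hol' \<open>open T\<close> \<open>connected T\<close>, where U = "sphere 0 r" and \<xi> = "of_real r"])
      show "sphere 0 r \<subseteq> T" using lt r by (auto simp: T_def)
      show "complex_of_real r \<in> T" using lt r by (auto simp: T_def)
      show "complex_of_real r islimpt sphere 0 r"
        by (rule connected_imp_perfect[OF connected_sphere])
          (use r sphere_ne in auto)
      show "q u (of_real (r^2) / u) = 0" if u: "u \<in> sphere 0 r" for u
      proof -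
        have "cnj u = of_real (r^2) / u"
          using u r complex_norm_square[of u] by (auto simp: field_simps)
        then show ?thesis using diag[of u] u r by auto
      qed
      show "s \<in> T" using s by (simp add: T_def)
    qed
  qed
  have R: "0 < R" using st(1) by (smt (verit) norm_ge_zero)
  \<comment> \<open>For fixed \<open>s\<close> the values \<open>t = x / s\<close> with small
    \<open>x > 0\<close> are covered by \<open>nz\<close> with \<open>r = sqrt x\<close>. They
    accumulate at 0, so \<open>q s\<close> vanishes on the whole disc.\<close>
  have nz2: "q s t = 0" if s: "s \<noteq> 0" "cmod s < R" for s
  proof (rule analytic_continuation[of "\<lambda>t. q s t" "ball 0 R" "(\<lambda>x. of_real x / s) ` {0<..<min (R^2) (R * cmod s)}" 0])
    show "q s holomorphic_on ball 0 R"
      by (rule hol) (use s in \<open>auto intro!: holomorphic_intros\<close>)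
    show "0 islimpt (\<lambda>x. of_real x / s) ` {0<..<min (R^2) (R * cmod s)}"
      unfolding islimpt_approachable
    proof (intro allI impI)
      fix e :: real assume e: "0 < e"
      define x where "x = min (min (R^2) (R * cmod s)) (e * cmod s) / 2"
      have m: "min (min (R^2) (R * cmod s)) (e * cmod s) > 0" using R s e by simp
      then have "x > 0" "x < min (R^2) (R * cmod s)" "x < e * cmod s"
        unfolding x_def by linarith+
      then show "\<exists>y\<in>(\<lambda>x. of_real x / s) ` {0<..<min (R^2) (R * cmod s)}. y \<noteq> 0 \<and> dist y 0 < e"
        using s by (intro bexI[of _ "of_real x / s"]) (auto simp: norm_divide field_simps)
    qed
    show "q s y = 0" if y: "y \<in> (\<lambda>x. of_real x / s) ` {0<..<min (R^2) (R * cmod s)}" for y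
    proof -
      obtain x where x: "0 < x" "x < R^2" "x < R * cmod s" "y = of_real x / s" using y by auto
      have "sqrt x < R" using x R real_less_lsqrt by auto
      moreover have "sqrt x ^ 2 / R < cmod s" using x R by (simp add: field_simps)
      ultimately show ?thesis using nz[of "sqrt x" s] x s by simp
    qed
    show "(\<lambda>x. of_real x / s) ` {0<..<min (R^2) (R * cmod s)} \<subseteq> ball 0 R"
    proof clarify
      fix x assume "x \<in> {0<..<min (R^2) (R * cmod s)}"
      then show "of_real x / s \<in> ball 0 R" using s by (simp add: norm_divide field_simps)
    qed
  qed (use R st in auto)
  \<comment> \<open>The remaining value \<open>s = 0\<close> is a limit point of the others, with
    \<open>t\<close> fixed.\<close>
  show ?thesis
  proof (rule analytic_continuation[of "\<lambda>s. q s t" "ball 0 R" "ball 0 R - {0}" 0])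
    show "(\<lambda>s. q s t) holomorphic_on ball 0 R"
      by (rule hol) (use st in \<open>auto intro!: holomorphic_intros\<close>)
    show "0 islimpt ball 0 R - {0::complex}"
      using R by (simp add: islimpt_ball islimpt_punctured[symmetric])
  qed (use R st nz2 in auto)
qed

text \<open>Any two points of a convex set lie on one complex line meeting it in a convex set.\<close>

lemma polarization:
  fixes Q :: "complex^'n::finite \<Rightarrow> complex^'n \<Rightarrow> complex"
  assumes D: "open D" "convex D"
    and hol: "\<And>T a b \<sigma> \<tau>. open T \<Longrightarrow> \<sigma> holomorphic_on T \<Longrightarrow> \<tau> holomorphic_on T \<Longrightarrow>
      (\<And>u. u \<in> T \<Longrightarrow> a + \<sigma> u *s b \<in> D) \<Longrightarrow> (\<And>u. u \<in> T \<Longrightarrow> a + cnj (\<tau> u) *s b \<in> D) \<Longrightarrow>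
      (\<lambda>u. Q (a + \<sigma> u *s b) (a + cnj (\<tau> u) *s b)) holomorphic_on T"
    and diag: "\<And>w. w \<in> D \<Longrightarrow> Q w w = 0"
    and w: "w \<in> D" "\<xi> \<in> D"
  shows "Q w \<xi> = 0"
proof -
  define b where "b = w - \<xi>"
  define q where "q = (\<lambda>s t. Q (\<xi> + s *s b) (\<xi> + cnj t *s b))"
  let ?S = "{s. \<xi> + s *s b \<in> D}"
  \<comment> \<open>The parameter 0 is the point \<open>\<xi>\<close>, the parameter 1 is
    \<open>w\<close>.\<close>
  have S: "open ?S" "convex ?S" "0 \<in> ?S" "1 \<in> ?S"
    by (rule open_line[OF D(1)], rule convex_line[OF D(2)]) (use w in \<open>simp_all add: b_def\<close>)
  obtain R where R: "R > 0" "ball 0 R \<subseteq> ?S" using openE[OF S(1,3)] by blast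
  have holq: "(\<lambda>u. q (\<sigma> u) (\<tau> u)) holomorphic_on T"
    if "open T" "\<sigma> holomorphic_on T" "\<tau> holomorphic_on T" "\<sigma> ` T \<subseteq> ?S" "cnj ` \<tau> ` T \<subseteq> ?S" for T \<sigma> \<tau>
    unfolding q_def by (rule hol) (use that in auto)
  \<comment> \<open>Since \<open>\<xi>\<close> has parameter 0, only \<open>q s 0\<close> is of
    interest. It is determined on a small disc and then continued in \<open>s\<close> along the
    slice up to \<open>s = 1\<close>.\<close>
  have zero: "q s 0 = 0" if s: "cmod s < R" for s
  proof (rule polarization_disc[where R = R and q = q])
    show "(\<lambda>u. q (\<sigma> u) (\<tau> u)) holomorphic_on T"
      if "open T" "\<sigma> holomorphic_on T" "\<tau> holomorphic_on T" "\<sigma> ` T \<subseteq> ball 0 R" "\<tau> ` T \<subseteq> ball 0 R" for T \<sigma> \<tau>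
    proof (rule holq[OF that(1-3)])
      show "cnj ` \<tau> ` T \<subseteq> ?S"
      proof clarify
        fix u assume "u \<in> T"
        then have "cnj (\<tau> u) \<in> ball 0 R" using that(5) by auto
        then show "\<xi> + cnj (\<tau> u) *s b \<in> D" using R(2) by blast
      qed
    qed (use that(4) R(2) in blast)
    show "q s (cnj s) = 0" if that: "cmod s < R" for s
    proof -
      have "s \<in> ?S" using R(2) that by auto
      then show ?thesis unfolding q_def using diag by simp
    qed
  qed (use s R in auto)
  have "(\<lambda>s. q s 0) holomorphic_on ?S"
    by (rule holq[where \<sigma> = "\<lambda>s. s" and \<tau> = "\<lambda>s. 0"]) (use S(1) w(2) in auto)
  then have "q 1 0 = 0"
    by (rule holomorphic_eq_zero_nearby[OF _ S(1) convex_connected[OF S(2)] R(1), where a = 0])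
      (use R(2) zero S(4) in auto)
  then show ?thesis by (simp add: q_def b_def)
qed

section \<open>Hermitian potentials\<close>

definition hform :: "nat \<Rightarrow> (nat \<Rightarrow> real) \<Rightarrow> (nat \<Rightarrow> complex) \<Rightarrow> (nat \<Rightarrow> complex) \<Rightarrow> complex" where
  "hform m \<epsilon> x y = (\<Sum>k<m. of_real (\<epsilon> k) * x k * cnj (y k))"

text \<open>
  With \<open>H = 1 + hform x y\<close>, where \<open>x\<close> depends holomorphically on one point and \<open>y\<close> on another, this is
  minus the mixed derivative of \<open>log H\<close>; \<open>x'\<close> and \<open>y'\<close> are the derivatives of \<open>x\<close> and \<open>y\<close>.
\<close>

definition log_hessian ::
    "nat \<Rightarrow> (nat \<Rightarrow> real) \<Rightarrow> (nat \<Rightarrow> complex) \<Rightarrow> (nat \<Rightarrow> complex) \<Rightarrow> (nat \<Rightarrow> complex) \<Rightarrow> (nat \<Rightarrow> complex) \<Rightarrow> complex" where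
  "log_hessian m \<epsilon> x x' y y' =
     (hform m \<epsilon> x' y * hform m \<epsilon> x y' - hform m \<epsilon> x' y' * (1 + hform m \<epsilon> x y)) / (1 + hform m \<epsilon> x y)\<^sup>2"

lemma cnj_hform: "cnj (hform m \<epsilon> x y) = hform m \<epsilon> y x"
  by (simp add: hform_def mult_ac)

lemma hform_zero_right [simp]: "hform m \<epsilon> x (\<lambda>k. 0) = 0"
  by (simp add: hform_def)

lemma hform_smult_left: "hform m \<epsilon> (\<lambda>k. c * x k) y = c * hform m \<epsilon> x y"
  and hform_smult_right: "hform m \<epsilon> x (\<lambda>k. c * y k) = cnj c * hform m \<epsilon> x y"
  by (simp_all add: hform_def sum_distrib_left mult_ac)

lemma has_derivative_hform_left:
  assumes "\<And>k. k < m \<Longrightarrow> ((\<lambda>w. x w k) has_derivative (\<lambda>v. x' v k)) F"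
  shows "((\<lambda>w. hform m \<epsilon> (x w) y) has_derivative (\<lambda>v. hform m \<epsilon> (x' v) y)) F"
  unfolding hform_def by (intro has_derivative_sum has_derivative_mult_left has_derivative_mult_right assms) simp

lemma has_derivative_hform:
  assumes "\<And>k. k < m \<Longrightarrow> ((\<lambda>w. x w k) has_derivative (\<lambda>v. x' v k)) (at w within S)"
    and "\<And>k. k < m \<Longrightarrow> ((\<lambda>w. y w k) has_derivative (\<lambda>v. y' v k)) (at w within S)"
  shows "((\<lambda>w. hform m \<epsilon> (x w) (y w)) has_derivative (\<lambda>v. hform m \<epsilon> (x w) (y' v) + hform m \<epsilon> (x' v) (y w))) (at w within S)"
proof -
  have "((\<lambda>w. hform m \<epsilon> (x w) (y w)) has_derivative
      (\<lambda>v. \<Sum>k<m. (of_real (\<epsilon> k) * x w k) * cnj (y' v k) + (of_real (\<epsilon> k) * x' v k) * cnj (y w k))) (at w within S)"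
    unfolding hform_def
    by (intro has_derivative_sum has_derivative_mult has_derivative_mult_right has_derivative_cnj assms) simp_all
  then show ?thesis by (simp add: hform_def sum.distrib)
qed

lemma holomorphic_along_line:
  assumes g: "hol_fun g D" and "open D" and T: "open T" "\<sigma> holomorphic_on T" "\<And>u. u \<in> T \<Longrightarrow> a + \<sigma> u *s b \<in> D"
  shows "(\<lambda>u. g (a + \<sigma> u *s b)) holomorphic_on T"
  using holomorphic_on_compose_gen[OF T(2) hol_fun_line_holomorphic[OF g \<open>open D\<close>, of a b]] T(3)
  by (auto simp: o_def)

text \<open>Conjugating the parameter as well as the value turns a holomorphic function into a
  holomorphic one. Hence functions antiholomorphic in the second point become holomorphic in the
  parameter that polarization uses.\<close>

lemma cnj_holomorphic_along_line:
  assumes g: "hol_fun g D" and "open D" and T: "open T" "\<tau> holomorphic_on T" "\<And>u. u \<in> T \<Longrightarrow> a + cnj (\<tau> u) *s b \<in> D"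
  shows "(\<lambda>u. cnj (g (a + cnj (\<tau> u) *s b))) holomorphic_on T"
proof -
  let ?B = "{s. a + cnj s *s b \<in> D}"
  have "open ?B"
    using open_vimage[OF open_line[OF \<open>open D\<close>], of cnj a b] continuous_on_cnj[OF continuous_on_id]
    by (simp add: vimage_def)
  moreover have "(\<lambda>s. g (a + s *s b)) holomorphic_on cnj ` ?B"
    by (rule holomorphic_on_subset[OF hol_fun_line_holomorphic[OF g \<open>open D\<close>, of a b]]) auto
  ultimately have "cnj \<circ> (\<lambda>s. g (a + s *s b)) \<circ> cnj holomorphic_on ?B"
    by (intro holomorphic_on_compose_cnj_cnj)
  then show ?thesis
    using holomorphic_on_compose_gen[OF T(2), of "cnj \<circ> (\<lambda>s. g (a + s *s b)) \<circ> cnj" ?B] T(3)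
    by (auto simp: o_def)
qed

text \<open>Both sides of the isometry condition are gathered into one sum with real weights of
  arbitrary sign. The assumption \<open>nz\<close> concerns pairs of points, since the denominators
  have to survive off the diagonal.\<close>

locale hermitian_potentials =
  fixes D :: "(complex^'n::finite) set" and J :: "'j set" and c :: "'j \<Rightarrow> real" and m :: "'j \<Rightarrow> nat"
    and \<epsilon> :: "'j \<Rightarrow> nat \<Rightarrow> real" and F :: "'j \<Rightarrow> nat \<Rightarrow> complex^'n \<Rightarrow> complex"
  assumes D: "open D" "convex D" "0 \<in> D"
    and hol: "\<And>j k. j \<in> J \<Longrightarrow> k < m j \<Longrightarrow> hol_fun (F j k) D"
    and nz: "\<And>j w \<xi>. j \<in> J \<Longrightarrow> w \<in> D \<Longrightarrow> \<xi> \<in> D \<Longrightarrow> 1 + hform (m j) (\<epsilon> j) (\<lambda>k. F j k w) (\<lambda>k. F j k \<xi>) \<noteq> 0"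
    and diagonal: "\<And>w v v'. w \<in> D \<Longrightarrow>
      (\<Sum>j\<in>J. of_real (c j) * log_hessian (m j) (\<epsilon> j)
         (\<lambda>k. F j k w) (\<lambda>k. frechet_derivative (F j k) (at w) v)
         (\<lambda>k. F j k w) (\<lambda>k. frechet_derivative (F j k) (at w) v')) = 0"
begin

abbreviation dF :: "'j \<Rightarrow> complex^'n \<Rightarrow> complex^'n \<Rightarrow> nat \<Rightarrow> complex" where
  "dF j w v \<equiv> \<lambda>k. frechet_derivative (F j k) (at w) v"

abbreviation H :: "'j \<Rightarrow> complex^'n \<Rightarrow> complex^'n \<Rightarrow> complex" where
  "H j w \<xi> \<equiv> 1 + hform (m j) (\<epsilon> j) (\<lambda>k. F j k w) (\<lambda>k. F j k \<xi>)"

text \<open>Each \<open>log_hessian\<close> is a quotient that is holomorphic in \<open>w\<close>,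
  antiholomorphic in \<open>\<xi>\<close>, and has the non-vanishing denominator \<open>H^2\<close>.
  The sum vanishes for \<open>w = \<xi>\<close>, so it can be polarized.\<close>

lemma polarized_metric:
  assumes "w \<in> D" "\<xi> \<in> D"
  shows "(\<Sum>j\<in>J. of_real (c j) * log_hessian (m j) (\<epsilon> j)
      (\<lambda>k. F j k w) (dF j w v) (\<lambda>k. F j k \<xi>) (dF j \<xi> v')) = 0"
proof (rule polarization[OF D(1,2), where w = w and \<xi> = \<xi>])
  fix T a b \<sigma> \<tau>
  assume T: "open T" "\<sigma> holomorphic_on T" "\<tau> holomorphic_on T"
    and \<sigma>: "\<And>u. u \<in> T \<Longrightarrow> a + \<sigma> u *s b \<in> D" and \<tau>: "\<And>u. u \<in> T \<Longrightarrow> a + cnj (\<tau> u) *s b \<in> D"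
  have hf: "(\<lambda>u. hform (m j) (\<epsilon> j) (\<lambda>k. f k (a + \<sigma> u *s b)) (\<lambda>k. g k (a + cnj (\<tau> u) *s b))) holomorphic_on T"
    if "\<And>k. k < m j \<Longrightarrow> hol_fun (f k) D" "\<And>k. k < m j \<Longrightarrow> hol_fun (g k) D" for j f g
    unfolding hform_def
    by (intro holomorphic_on_sum holomorphic_on_mult holomorphic_on_const
        holomorphic_along_line[OF _ D(1) T(1,2) \<sigma>] cnj_holomorphic_along_line[OF _ D(1) T(1,3) \<tau>] that) auto
  show "(\<lambda>u. \<Sum>j\<in>J. of_real (c j) * log_hessian (m j) (\<epsilon> j)
      (\<lambda>k. F j k (a + \<sigma> u *s b)) (dF j (a + \<sigma> u *s b) v)
      (\<lambda>k. F j k (a + cnj (\<tau> u) *s b)) (dF j (a + cnj (\<tau> u) *s b) v')) holomorphic_on T"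
    unfolding log_hessian_def
    by (intro holomorphic_on_sum holomorphic_on_mult holomorphic_on_const holomorphic_on_divide holomorphic_on_diff
        holomorphic_on_add holomorphic_on_power hf hol hol_fun_frechet_derivative[OF hol D(1)])
      (use nz \<sigma> \<tau> in auto)
qed (use assms diagonal in auto)

lemma has_derivative_F: "j \<in> J \<Longrightarrow> k < m j \<Longrightarrow> w \<in> D \<Longrightarrow>
    ((\<lambda>w. F j k w) has_derivative (\<lambda>v. dF j w v k)) (at w within S)"
  using hol_fun_has_derivative(1)[OF hol D(1)] has_derivative_at_withinI by blast

text \<open>The quotients are the derivatives of \<open>log H j w \<xi>\<close> in the conjugate of
  \<open>\<xi>\<close>, and their differential in \<open>w\<close> is minus the
  \<open>log_hessian\<close>. By the polarized identity the weighted sum has zero differential on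
  the convex set \<open>D\<close> and equals its value at 0.\<close>

lemma integrated_metric:
  assumes "w \<in> D" "\<xi> \<in> D"
  shows "(\<Sum>j\<in>J. of_real (c j) * (hform (m j) (\<epsilon> j) (\<lambda>k. F j k w) (dF j \<xi> v) / H j w \<xi>)) =
    (\<Sum>j\<in>J. of_real (c j) * (hform (m j) (\<epsilon> j) (\<lambda>k. F j k 0) (dF j \<xi> v) / H j 0 \<xi>))"
proof -
  let ?\<psi> = "\<lambda>w. \<Sum>j\<in>J. of_real (c j) * (hform (m j) (\<epsilon> j) (\<lambda>k. F j k w) (dF j \<xi> v) / H j w \<xi>)"
  have "(?\<psi> has_derivative (\<lambda>h. 0)) (at x within D)" if x: "x \<in> D" for x
  proof -
    have "((\<lambda>w. hform (m j) (\<epsilon> j) (\<lambda>k. F j k w) (dF j \<xi> v) / H j w \<xi>) has_derivative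
        (\<lambda>u. - log_hessian (m j) (\<epsilon> j) (\<lambda>k. F j k x) (dF j x u) (\<lambda>k. F j k \<xi>) (dF j \<xi> v))) (at x within D)"
      if j: "j \<in> J" for j
    proof -
      have d: "((\<lambda>w. hform (m j) (\<epsilon> j) (\<lambda>k. F j k w) y) has_derivative
          (\<lambda>u. hform (m j) (\<epsilon> j) (dF j x u) y)) (at x within D)" for y
        by (rule has_derivative_hform_left[OF has_derivative_F[OF j _ x]])
      have d1: "((\<lambda>w. H j w \<xi>) has_derivative
          (\<lambda>u. hform (m j) (\<epsilon> j) (dF j x u) (\<lambda>k. F j k \<xi>))) (at x within D)"
        using has_derivative_add[OF has_derivative_const d] by simp
      show ?thesis
        by (rule has_derivative_eq_rhs[OF has_derivative_divide'[OF d d1 nz[OF j x assms(2)]]])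
          (simp add: log_hessian_def fun_eq_iff power2_eq_square algebra_simps diff_divide_distrib)
    qed
    then have "(?\<psi> has_derivative (\<lambda>u. \<Sum>j\<in>J. of_real (c j) *
        - log_hessian (m j) (\<epsilon> j) (\<lambda>k. F j k x) (dF j x u) (\<lambda>k. F j k \<xi>) (dF j \<xi> v))) (at x within D)"
      by (intro has_derivative_sum has_derivative_mult_right)
    then show ?thesis
      using polarized_metric[OF x assms(2)] by (simp add: sum_negf)
  qed
  then obtain C where C: "\<forall>x\<in>D. ?\<psi> x = C"
    using has_derivative_zero_constant[OF D(2)] by blast
  show ?thesis using bspec[OF C assms(1)] bspec[OF C D(3)] by simp
qed

text \<open>The function \<open>\<Sum>\<^sub>j c\<^sub>j (log H\<^sub>j(w,w) - log |H\<^sub>j(w,0)|\<^sup>2)\<close> is Calabi's diastasis up to a constant.\<close>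

lemma diastasis:
  assumes pos: "\<And>j w. j \<in> J \<Longrightarrow> w \<in> D \<Longrightarrow> Re (H j w w) > 0" and w: "w \<in> D"
  shows "(\<Sum>j\<in>J. c j * (ln (Re (H j w w)) - ln ((cmod (H j w 0))\<^sup>2))) =
    (\<Sum>j\<in>J. c j * (ln (Re (H j 0 0)) - ln ((cmod (H j 0 0))\<^sup>2)))"
proof -
  let ?p = "\<lambda>t. complex_of_real t *s w"
  let ?G = "\<lambda>t. \<Sum>j\<in>J. c j * (ln (Re (H j (?p t) (?p t))) - ln ((cmod (H j (?p t) 0))\<^sup>2))"
  have p: "?p t \<in> D" if "t \<in> {0..1}" for t
    using convexD_alt[OF D(2,3) w, of t] that by (simp add: scaleR_eq_smult)
  have "(?G has_derivative (\<lambda>h. 0)) (at t within {0..1})" if t: "t \<in> {0..1}" for t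
  proof -
    \<comment> \<open>Along the segment \<open>t w\<close> the derivative of the summand with index
      \<open>j\<close> is \<open>2 Re (A j - B j)\<close>. The weighted sums of \<open>A\<close> and
      \<open>B\<close> agree by the integrated identity with both of its points equal to
      \<open>t w\<close>.\<close>
    define A B where "A = (\<lambda>j. hform (m j) (\<epsilon> j) (\<lambda>k. F j k (?p t)) (dF j (?p t) w) / H j (?p t) (?p t))"
      and "B = (\<lambda>j. hform (m j) (\<epsilon> j) (\<lambda>k. F j k 0) (dF j (?p t) w) / H j 0 (?p t))"
    have "((\<lambda>t. ln (Re (H j (?p t) (?p t))) - ln ((cmod (H j (?p t) 0))\<^sup>2)) has_derivative
        (\<lambda>h. h * (2 * Re (A j) - 2 * Re (B j)))) (at t within {0..1})" if j: "j \<in> J" for j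
    proof -
      have dF: "((\<lambda>t. F j k (?p t)) has_derivative (\<lambda>h. of_real h * dF j (?p t) w k)) (at t within {0..1})"
        if "k < m j" for k
        using has_vector_derivative_real_field[OF hol_fun_line[OF hol[OF j that] D(1), of 0 "of_real t" w]] p[OF t]
        by (auto simp: has_vector_derivative_def scaleR_conv_of_real intro: has_derivative_at_withinI)
      define h1 where "h1 = hform (m j) (\<epsilon> j) (\<lambda>k. F j k (?p t)) (dF j (?p t) w)"
      define h2 where "h2 = hform (m j) (\<epsilon> j) (dF j (?p t) w) (\<lambda>k. F j k 0)"
      have "((\<lambda>t. H j (?p t) (?p t)) has_derivative (\<lambda>h. 0 + (hform (m j) (\<epsilon> j) (\<lambda>k. F j k (?p t)) (\<lambda>k. of_real h * dF j (?p t) w k)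
          + hform (m j) (\<epsilon> j) (\<lambda>k. of_real h * dF j (?p t) w k) (\<lambda>k. F j k (?p t))))) (at t within {0..1})"
        by (intro has_derivative_add has_derivative_const has_derivative_hform dF)
      then have d1: "((\<lambda>t. H j (?p t) (?p t)) has_derivative (\<lambda>h. of_real h * (h1 + cnj h1))) (at t within {0..1})"
        by (simp add: hform_smult_left hform_smult_right cnj_hform h1_def distrib_left)
      have "((\<lambda>t. H j (?p t) 0) has_derivative (\<lambda>h. 0 + hform (m j) (\<epsilon> j) (\<lambda>k. of_real h * dF j (?p t) w k) (\<lambda>k. F j k 0)))
          (at t within {0..1})"
        by (intro has_derivative_add has_derivative_const has_derivative_hform_left dF)
      then have d2: "((\<lambda>t. H j (?p t) 0) has_derivative (\<lambda>h. of_real h * h2)) (at t within {0..1})"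
        by (simp add: hform_smult_left h2_def)
      \<comment> \<open>Hermitian symmetry makes \<open>H\<close> real on the diagonal.\<close>
      have real: "H j (?p t) (?p t) = of_real (Re (H j (?p t) (?p t)))"
        using cnj_hform[of "m j" "\<epsilon> j"] by (simp add: complex_eq_iff) (metis cnj.sel(2) equal_neg_zero)
      have A: "Re (A j) = Re h1 / Re (H j (?p t) (?p t))"
        unfolding A_def h1_def[symmetric] by (subst real) simp
      have cnjB: "B j = cnj (h2 / H j (?p t) 0)"
        by (simp add: B_def h2_def cnj_hform)
      have nz2: "H j (?p t) 0 \<noteq> 0" by (rule nz[OF j p[OF t] D(3)])
      have B: "Re (B j) = (Re h2 * Re (H j (?p t) 0) + Im h2 * Im (H j (?p t) 0)) / (cmod (H j (?p t) 0))\<^sup>2"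
        unfolding cnjB cmod_power2 by (simp add: Re_divide)
      have "((\<lambda>t. (Re (H j (?p t) 0))\<^sup>2 + (Im (H j (?p t) 0))\<^sup>2) has_derivative
          (\<lambda>h. h * (2 * (Re h2 * Re (H j (?p t) 0) + Im h2 * Im (H j (?p t) 0))))) (at t within {0..1})"
        by (rule has_derivative_eq_rhs[OF has_derivative_add[OF has_derivative_power[OF has_derivative_Re[OF d2]]
              has_derivative_power[OF has_derivative_Im[OF d2]]]])
          (simp add: fun_eq_iff algebra_simps)
      then have d3: "((\<lambda>t. (cmod (H j (?p t) 0))\<^sup>2) has_derivative
          (\<lambda>h. h * (2 * (Re h2 * Re (H j (?p t) 0) + Im h2 * Im (H j (?p t) 0))))) (at t within {0..1})"
        unfolding cmod_power2 .
      have "((\<lambda>t. ln (Re (H j (?p t) (?p t))) - ln ((cmod (H j (?p t) 0))\<^sup>2)) has_derivative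
         (\<lambda>h. Re (of_real h * (h1 + cnj h1)) * inverse (Re (H j (?p t) (?p t))) -
           h * (2 * (Re h2 * Re (H j (?p t) 0) + Im h2 * Im (H j (?p t) 0))) * inverse ((cmod (H j (?p t) 0))\<^sup>2)))
         (at t within {0..1})"
        by (intro has_derivative_diff has_derivative_ln has_derivative_Re d1 d3 pos[OF j p[OF t]]) (use nz2 in simp)
      then show ?thesis
        by (rule has_derivative_eq_rhs) (simp add: A B fun_eq_iff divide_inverse algebra_simps)
    qed
    then have "(?G has_derivative (\<lambda>h. \<Sum>j\<in>J. c j * (h * (2 * Re (A j) - 2 * Re (B j))))) (at t within {0..1})"
      by (intro has_derivative_sum has_derivative_mult_right)
    moreover have "(\<Sum>j\<in>J. c j * (h * (2 * Re (A j) - 2 * Re (B j)))) = 0" for h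
    proof -
      have "(\<Sum>j\<in>J. of_real (c j) * A j) = (\<Sum>j\<in>J. of_real (c j) * B j)"
        unfolding A_def B_def by (rule integrated_metric[OF p[OF t] p[OF t]])
      then have "Re (\<Sum>j\<in>J. of_real (c j) * A j) = Re (\<Sum>j\<in>J. of_real (c j) * B j)" by simp
      then have "(\<Sum>j\<in>J. c j * Re (A j)) = (\<Sum>j\<in>J. c j * Re (B j))" by simp
      moreover have "(\<Sum>j\<in>J. c j * (h * (2 * Re (A j) - 2 * Re (B j)))) =
          2 * h * ((\<Sum>j\<in>J. c j * Re (A j)) - (\<Sum>j\<in>J. c j * Re (B j)))"
        by (simp add: sum_distrib_left sum_subtractf algebra_simps)
      ultimately show ?thesis by simp
    qed
    ultimately show ?thesis by simp
  qed
  then obtain C where C: "\<forall>t\<in>{0..1}. ?G t = C"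
    using has_derivative_zero_constant[OF convex_real_interval(5)] by blast
  show ?thesis using bspec[OF C, of 1] bspec[OF C, of 0] by simp
qed

end

section \<open>Jordan triple systems and the defining polynomial\<close>

lemma coord_space_0 [simp]: "0 \<in> coord_space I"
  and coord_space_add: "x \<in> coord_space I \<Longrightarrow> y \<in> coord_space I \<Longrightarrow> x + y \<in> coord_space I"
  and coord_space_smult: "x \<in> coord_space I \<Longrightarrow> c *s x \<in> coord_space I"
  and coord_proj_in [simp]: "coord_proj I x \<in> coord_space I"
  and coord_proj_id: "x \<in> coord_space I \<Longrightarrow> coord_proj I x = x"
  and coord_proj_add: "coord_proj I (x + y) = coord_proj I x + coord_proj I y"
  and coord_proj_smult: "coord_proj I (c *s x) = c *s coord_proj I x"
  and coord_proj_scaleR: "coord_proj I (r *\<^sub>R x) = r *\<^sub>R coord_proj I x"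
  by (auto simp: coord_space_def coord_proj_def vec_eq_iff)

lemma closed_coord_space: "closed (coord_space I :: (complex^'n::finite) set)"
proof -
  have "coord_space I = (\<Inter>a\<in>- I. {x :: complex^'n. x $ a = 0})" by (auto simp: coord_space_def)
  moreover have "closed {x :: complex^'n. x $ a = 0}" for a
    by (intro closed_Collect_eq continuous_on_component continuous_intros)
  ultimately show ?thesis by (simp add: closed_INT)
qed

section \<open>The unit ball of a Jordan triple system: convexity and peak functions\<close>

context
  fixes I :: "'n::finite set" and T :: "complex^'n \<Rightarrow> complex^'n \<Rightarrow> complex^'n \<Rightarrow> complex^'n"
  assumes jts: "positive_hermitian_jts I T"
begin

text \<open>For fixed \<open>v\<close> this is a positive semidefinite Hermitian form in
  \<open>x\<close> and \<open>y\<close>, and the ball is cut out by bounds on these forms on the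
  diagonal.\<close>

abbreviation jform :: "complex^'n \<Rightarrow> complex^'n \<Rightarrow> complex^'n \<Rightarrow> complex" where
  "jform v x y \<equiv> herm_prod (T x y v) v"

lemma herm_prod_add: "herm_prod (x + y) v = herm_prod x v + herm_prod y v"
  and herm_prod_smult: "herm_prod (c *s x) v = c * herm_prod x v"
  and herm_prod_cnj: "herm_prod v x = cnj (herm_prod x v)"
  by (simp_all add: herm_prod_def sum.distrib algebra_simps sum_distrib_left)

text \<open>Hermitian symmetry holds because \<open>D(y,x)\<close> is the adjoint of
  \<open>D(x,y)\<close>; the remaining rules are the sesquilinearity and positivity of the triple
  product.\<close>

lemma jform_rules:
  assumes "v \<in> coord_space I" "x \<in> coord_space I" "y \<in> coord_space I" "u \<in> coord_space I"
  shows "jform v (x + u) y = jform v x y + jform v u y" "jform v x (y + u) = jform v x y + jform v x u"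
    "jform v (c *s x) y = c * jform v x y" "jform v x (c *s y) = cnj c * jform v x y"
    "jform v y x = cnj (jform v x y)" "0 \<le> Re (jform v x x)"
proof -
  note j = jts[unfolded positive_hermitian_jts_def]
  have 1: "\<forall>u\<in>coord_space I. T (x + u) y v = T x y v + T u y v \<and> T x (y + u) v = T x y v + T x u v"
    and 2: "\<forall>c. T (c *s x) y v = c *s T x y v \<and> T x (c *s y) v = cnj c *s T x y v"
    using j assms by blast+
  show "jform v (x + u) y = jform v x y + jform v u y" "jform v x (y + u) = jform v x y + jform v x u"
    "jform v (c *s x) y = c * jform v x y" "jform v x (c *s y) = cnj c * jform v x y"
    using 1 2 assms by (simp_all add: herm_prod_add herm_prod_smult)
  have "herm_prod (T y x v) v = herm_prod v (T x y v)" using j assms by blast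
  then show "jform v y x = cnj (jform v x y)" using herm_prod_cnj by metis
  show "0 \<le> Re (jform v x x)" using j assms by blast
qed

text \<open>This is positivity of the form at \<open>x - y\<close>. It bounds the cross terms, both
  for convexity and for the peak function.\<close>

lemma jform_arith_mean:
  assumes v: "v \<in> coord_space I" and x: "x \<in> coord_space I" and y: "y \<in> coord_space I"
  shows "2 * Re (jform v x y) \<le> Re (jform v x x) + Re (jform v y y)"
proof -
  define n where "n = (-1) *s y"
  have n: "n \<in> coord_space I" unfolding n_def by (rule coord_space_smult[OF y])
  have "0 \<le> Re (jform v (x + n) (x + n))"
    by (rule jform_rules(6)[OF v coord_space_add[OF x n] x x])
  also have "jform v (x + n) (x + n) = jform v x x + jform v n x + jform v x n + jform v n n"
    using jform_rules(1,2)[OF v] x n coord_space_add[OF x n] by simp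
  also have "jform v n x = - jform v y x"
    using jform_rules(3)[OF v y x x, of "-1"] by (simp add: n_def)
  also have "jform v x n = - jform v x y"
    using jform_rules(4)[OF v x y y, of "-1"] by (simp add: n_def)
  also have "jform v n n = jform v y y"
    using jform_rules(3)[OF v y n n, of "-1"] jform_rules(4)[OF v y y y, of "-1"] by (simp add: n_def)
  finally show ?thesis using jform_rules(5)[OF v x y y] by simp
qed

lemma jts_ball_iff:
  "x \<in> jts_ball I T \<longleftrightarrow> x \<in> coord_space I \<and>
    (\<forall>v\<in>coord_space I. v \<noteq> 0 \<longrightarrow> Re (jform v x x) < Re (herm_prod v v))"
  by (simp add: jts_ball_def)

lemma jts_ball_zero: "0 \<in> jts_ball I T"
proof -
  have "Re (jform v 0 0) < Re (herm_prod v v)" if v: "v \<in> coord_space I" "v \<noteq> 0" for v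
  proof -
    have "jform v (0 *s 0) 0 = 0" using jform_rules(3)[OF v(1) coord_space_0 coord_space_0 coord_space_0, of 0] by simp
    then have "jform v 0 0 = 0" by simp
    moreover have "herm_prod v v = (\<Sum>a\<in>UNIV. of_real ((cmod (v $ a))\<^sup>2))"
      unfolding herm_prod_def complex_norm_square by simp
    moreover obtain a where "v $ a \<noteq> 0" using v(2) by (auto simp: vec_eq_iff)
    moreover have "(\<Sum>a\<in>UNIV. (cmod (v $ a))\<^sup>2) > 0"
      using \<open>v $ a \<noteq> 0\<close> by (intro sum_pos2[of _ a]) auto
    ultimately show ?thesis by simp
  qed
  then show ?thesis by (simp add: jts_ball_iff)
qed

lemma jts_ball_smult:
  assumes "x \<in> jts_ball I T" "cmod c \<le> 1"
  shows "c *s x \<in> jts_ball I T"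
proof -
  have x: "x \<in> coord_space I" using assms by (simp add: jts_ball_iff)
  have "Re (jform v (c *s x) (c *s x)) < Re (herm_prod v v)" if v: "v \<in> coord_space I" "v \<noteq> 0" for v
  proof -
    have "jform v (c *s x) (c *s x) = (c * cnj c) * jform v x x"
      using jform_rules(3)[OF v(1) x coord_space_smult[OF x] x] jform_rules(4)[OF v(1) x x x] by simp
    then have "Re (jform v (c *s x) (c *s x)) = (cmod c)\<^sup>2 * Re (jform v x x)"
      by (simp add: complex_norm_square[symmetric])
    also have "\<dots> \<le> 1 * Re (jform v x x)"
      using assms(2) jform_rules(6)[OF v(1) x x x] by (intro mult_right_mono) (auto simp: power_le_one)
    finally show ?thesis using assms(1) v by (force simp: jts_ball_iff)
  qed
  then show ?thesis using coord_space_smult[OF x] by (simp add: jts_ball_iff)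
qed

lemma convex_jts_ball: "convex (jts_ball I T)"
proof (rule convexI)
  fix x y and s t :: real
  assume xy: "x \<in> jts_ball I T" "y \<in> jts_ball I T" and st: "0 \<le> s" "0 \<le> t" "s + t = 1"
  have x: "x \<in> coord_space I" and y: "y \<in> coord_space I" using xy by (auto simp: jts_ball_iff)
  let ?s = "complex_of_real s *s x" and ?t = "complex_of_real t *s y"
  have s: "?s \<in> coord_space I" and t: "?t \<in> coord_space I" using coord_space_smult x y by auto
  have "Re (jform v (?s + ?t) (?s + ?t)) < Re (herm_prod v v)" if v: "v \<in> coord_space I" "v \<noteq> 0" for v
  proof -
    have "jform v (?s + ?t) (?s + ?t) = jform v ?s ?s + jform v ?t ?s + jform v ?s ?t + jform v ?t ?t"
      using jform_rules(1,2)[OF v(1)] s t coord_space_add[OF s t] by simp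
    also have "\<dots> = s\<^sup>2 * jform v x x + s * t * (jform v x y + jform v y x) + t\<^sup>2 * jform v y y"
      using jform_rules(3,4)[OF v(1)] s t x y by (simp add: power2_eq_square algebra_simps)
    finally have "Re (jform v (?s + ?t) (?s + ?t)) =
        s\<^sup>2 * Re (jform v x x) + s * t * (2 * Re (jform v x y)) + t\<^sup>2 * Re (jform v y y)"
      using jform_rules(5)[OF v(1) x y y] by simp
    also have "\<dots> \<le> s\<^sup>2 * Re (jform v x x) + s * t * (Re (jform v x x) + Re (jform v y y)) + t\<^sup>2 * Re (jform v y y)"
      using jform_arith_mean[OF v(1) x y] st by (simp add: mult_left_mono)
    also have "\<dots> = (s + t) * (s * Re (jform v x x) + t * Re (jform v y y))"
      by (simp add: power2_eq_square algebra_simps)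
    also have "\<dots> = s * Re (jform v x x) + t * Re (jform v y y)" using st by simp
    also have "\<dots> < Re (herm_prod v v)"
      using xy v st convex_bound_lt[of "Re (jform v x x)" _ "Re (jform v y y)" s t] by (simp add: jts_ball_iff)
    finally show ?thesis .
  qed
  then show "s *\<^sub>R x + t *\<^sub>R y \<in> jts_ball I T"
    unfolding scaleR_eq_smult using coord_space_add[OF s t] by (simp add: jts_ball_iff)
qed

text \<open>A vector \<open>v\<close> that violates the defining inequality at \<open>q\<close>
  yields the linear functional \<open>x \<mapsto> jform v x q / jform v q q\<close>. Because the
  ball is circular, \<open>x\<close> can be rotated until the numerator is real and nonnegative, and
  the arithmetic mean inequality bounds it strictly by the denominator.\<close>

lemma jts_ball_peak:
  assumes q: "q \<in> coord_space I" "q \<notin> jts_ball I T"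
  obtains \<phi> where "hol_fun \<phi> UNIV" "\<And>x. x \<in> jts_ball I T \<Longrightarrow> cmod (\<phi> x) < 1" "\<phi> q = 1"
proof -
  obtain v where v: "v \<in> coord_space I" "v \<noteq> 0" "Re (herm_prod v v) \<le> Re (jform v q q)"
    using q by (auto simp: jts_ball_iff not_less)
  have im: "jform v q q = of_real (Re (jform v q q))"
    using jform_rules(5)[OF v(1) q(1) q(1) q(1)] by (auto simp: complex_eq_iff)
  have lt: "Re (jform v x x) < Re (jform v q q)" if "x \<in> jts_ball I T" for x
    using that v by (force simp: jts_ball_iff)
  have pos: "Re (jform v q q) > 0"
    using lt[OF jts_ball_zero] jform_rules(6)[OF v(1) coord_space_0 coord_space_0 coord_space_0] by simp
  \<comment> \<open>The rules for the triple product hold on \<open>coord_space I\<close> only; the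
    projection extends the functional linearly to the whole space.\<close>
  define \<phi> where "\<phi> = (\<lambda>x. jform v (coord_proj I x) q / jform v q q)"
  have add: "\<phi> (x + y) = \<phi> x + \<phi> y" for x y
    using jform_rules(1)[OF v(1) coord_proj_in q(1) coord_proj_in]
    by (simp add: \<phi>_def coord_proj_add add_divide_distrib)
  have smult: "\<phi> (c *s x) = c * \<phi> x" for c x
    using jform_rules(3)[OF v(1) coord_proj_in q(1) coord_proj_in]
    by (simp add: \<phi>_def coord_proj_smult)
  have "linear \<phi>" by (rule linearI) (simp_all add: add smult scaleR_eq_smult scaleR_conv_of_real)
  then have "bounded_linear \<phi>" by (simp add: linear_conv_bounded_linear)
  then have hol: "hol_fun \<phi> UNIV"
    by (intro hol_funI exI[of _ \<phi>]) (simp add: smult bounded_linear_imp_has_derivative)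
  have "cmod (\<phi> x) < 1" if x: "x \<in> jts_ball I T" for x
  proof -
    have xI: "x \<in> coord_space I" using x by (simp add: jts_ball_iff)
    define b where "b = jform v x q"
    \<comment> \<open>The rotation that turns \<open>b\<close> into its modulus. For
      \<open>b = 0\<close> any unimodular number will do.\<close>
    define u where "u = (if b = 0 then 1 else cnj b / cmod b)"
    have u: "cmod u = 1" "u * b = cmod b"
      using complex_norm_square[of b] by (auto simp: u_def norm_divide power2_eq_square mult.commute divide_eq_eq)
    have ux: "u *s x \<in> jts_ball I T" using jts_ball_smult[OF x] u by simp
    have "2 * Re (jform v (u *s x) q) \<le> Re (jform v (u *s x) (u *s x)) + Re (jform v q q)"
      using jform_arith_mean[OF v(1) coord_space_smult[OF xI] q(1)] .
    also have "jform v (u *s x) q = cmod b"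
      using jform_rules(3)[OF v(1) xI q(1) q(1)] u by (simp add: b_def)
    finally have "cmod b < Re (jform v q q)" using lt[OF ux] by simp
    then show ?thesis
      using pos by (subst \<phi>_def, subst im) (simp add: coord_proj_id[OF xI] norm_divide b_def)
  qed
  moreover have "\<phi> q = 1" using pos by (auto simp: \<phi>_def coord_proj_id[OF q(1)])
  ultimately show thesis using hol that by blast
qed

end

section \<open>Sesquilinear expansion of the defining polynomial\<close>

lemma homogeneous_poly_properties:
  assumes "homogeneous_poly I d G"
  shows "hol_fun G X" "G (c *s z) = c ^ d * G z"
proof -
  obtain A C where A: "finite A" "\<forall>\<alpha>\<in>A. (\<Sum>a\<in>I. \<alpha> a) = d" "\<And>z. G z = (\<Sum>\<alpha>\<in>A. C \<alpha> * (\<Prod>a\<in>I. (z $ a) ^ \<alpha> a))"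
    using assms unfolding homogeneous_poly_def by blast
  show "hol_fun G X"
    unfolding A(3) by (intro hol_fun_sum hol_fun_mult hol_fun_const hol_fun_prod hol_fun_power hol_fun_nth)
  have "(\<Prod>a\<in>I. (c * z $ a) ^ \<alpha> a) = c ^ d * (\<Prod>a\<in>I. (z $ a) ^ \<alpha> a)" if "\<alpha> \<in> A" for \<alpha>
    using A(2) that by (auto simp: power_mult_distrib prod.distrib power_sum)
  then show "G (c *s z) = c ^ d * G z"
    unfolding A(3) by (simp add: sum_distrib_left mult_ac)
qed

text \<open>On a line through 0 the polynomial is \<open>s^d G(v)\<close>, which vanishes to second
  order as \<open>d \<ge> 2\<close>. Thus only the coordinate terms contribute to the first order of
  \<open>h\<close> at 0.\<close>

lemma homogeneous_poly_at_0:
  assumes "homogeneous_poly I d G" "d \<ge> 2"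
  shows "G 0 = 0" "frechet_derivative G (at 0) v = 0"
proof -
  show "G 0 = 0" using homogeneous_poly_properties(2)[OF assms(1), of 0 0] assms(2) by (simp add: power_0_left)
  have "((\<lambda>s. G (0 + s *s v)) has_field_derivative frechet_derivative G (at (0 + 0 *s v)) v) (at 0)"
    by (rule hol_fun_line[OF homogeneous_poly_properties(1)[OF assms(1)] open_UNIV]) simp
  then have "((\<lambda>s. s ^ d * G v) has_field_derivative frechet_derivative G (at 0) v) (at 0)"
    by (simp add: homogeneous_poly_properties(2)[OF assms(1)])
  moreover have "((\<lambda>s. s ^ d * G v) has_field_derivative 0) (at 0)"
    using assms(2) by (auto intro!: derivative_eq_intros simp: power_0_left)
  ultimately show "frechet_derivative G (at 0) v = 0" by (rule DERIV_unique)
qed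

lemma sum_lessThan_add: "(\<Sum>k<p + (L::nat). f k) = (\<Sum>k<p. f k) + (\<Sum>l<L. f (p + l))"
  for f :: "nat \<Rightarrow> 'a::comm_monoid_add"
  by (induction L) (simp_all add: add.assoc)

text \<open>The last two conditions say that \<open>h\<close> agrees with \<open>1 - \<Sum>\<^sub>a z\<^sub>a cnj \<xi>\<^sub>a\<close> to first order in \<open>cnj \<xi>\<close>.\<close>

definition potential_expansion ::
    "'n set \<Rightarrow> (complex^'n::finite \<Rightarrow> complex^'n \<Rightarrow> complex) \<Rightarrow>
     nat \<Rightarrow> (nat \<Rightarrow> real) \<Rightarrow> (nat \<Rightarrow> complex^'n \<Rightarrow> complex) \<Rightarrow> bool" where
  "potential_expansion I h m \<epsilon> g \<longleftrightarrow>
     (\<forall>z \<xi>. h z \<xi> = 1 + hform m \<epsilon> (\<lambda>k. g k z) (\<lambda>k. g k \<xi>)) \<and>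
     (\<forall>k<m. hol_fun (g k) UNIV \<and> g k 0 = 0) \<and>
     (\<forall>z v. hform m \<epsilon> (\<lambda>k. g k z) (\<lambda>k. frechet_derivative (g k) (at 0) v) = - (\<Sum>a\<in>I. z $ a * cnj (v $ a))) \<and>
     (\<forall>z u v. hform m \<epsilon> (\<lambda>k. frechet_derivative (g k) (at z) u) (\<lambda>k. frechet_derivative (g k) (at 0) v) =
       - (\<Sum>a\<in>I. u $ a * cnj (v $ a)))"

lemma frechet_derivative_component: "frechet_derivative (\<lambda>z. z $ a) (at z) v = (v::complex^'n::finite) $ a"
  using frechet_derivative_at[OF bounded_linear_imp_has_derivative[OF bounded_linear_vec_nth[of a]], of z]
  by (metis)

text \<open>The list \<open>g\<close> consists of the coordinates from \<open>I\<close>, with sign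
  -1, followed by the polynomials \<open>G l\<close>, with sign \<open>(-1) ^ d l\<close>. The
  derivatives of the latter vanish at 0, which leaves the standard Hermitian product.\<close>

lemma hc_polynomial_expansion:
  assumes "hc_polynomial I U h"
  obtains m \<epsilon> g where "potential_expansion I h m \<epsilon> g"
proof -
  obtain L :: nat and d G where G: "\<And>l. l < L \<Longrightarrow> d l \<ge> 2 \<and> homogeneous_poly I (d l) (G l)"
    and h: "\<And>z \<xi>. h z \<xi> = 1 - (\<Sum>a\<in>I. z $ a * cnj (\<xi> $ a)) + (\<Sum>l<L. (-1) ^ d l * G l z * cnj (G l \<xi>))"
    using assms unfolding hc_polynomial_def by blast
  obtain e where e: "bij_betw e {..<card I} I"
    using ex_bij_betw_nat_finite[of I] by (auto simp: atLeast0LessThan)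
  define p where "p = card I"
  define g where "g = (\<lambda>k z. if k < p then z $ e k else G (k - p) z)"
  define \<epsilon> where "\<epsilon> = (\<lambda>k. if k < p then -1 else (-1) ^ d (k - p) :: real)"
  have form: "hform (p + L) \<epsilon> x y = - (\<Sum>k<p. x k * cnj (y k)) + (\<Sum>l<L. (-1) ^ d l * x (p + l) * cnj (y (p + l)))" for x y
    unfolding hform_def sum_lessThan_add by (simp add: \<epsilon>_def sum_negf)
  have e_sum: "(\<Sum>k<p. f (e k)) = (\<Sum>a\<in>I. f a)" for f :: "'a \<Rightarrow> complex"
    using sum.reindex_bij_betw[OF e, of f] by (simp add: p_def)
  have d1: "frechet_derivative (g k) (at z) v = v $ e k" if "k < p" for k z v
    using that by (simp add: g_def frechet_derivative_component)
  have d2: "frechet_derivative (g (p + l)) (at 0) v = 0" if "l < L" for l v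
    using homogeneous_poly_at_0(2)[of I "d l" "G l" v] G[OF that] by (simp add: g_def)
  have "potential_expansion I h (p + L) \<epsilon> g"
    unfolding potential_expansion_def
  proof (intro conjI allI impI)
    show "h z \<xi> = 1 + hform (p + L) \<epsilon> (\<lambda>k. g k z) (\<lambda>k. g k \<xi>)" for z \<xi>
      unfolding h form using e_sum[of "\<lambda>a. z $ a * cnj (\<xi> $ a)"] by (simp add: g_def)
    show "hol_fun (g k) UNIV" "g k 0 = 0" if "k < p + L" for k
      using that G[of "k - p"] homogeneous_poly_properties(1)[of I "d (k - p)" "G (k - p)"]
        homogeneous_poly_at_0(1)[of I "d (k - p)" "G (k - p)"]
      by (cases "k < p"; simp add: g_def hol_fun_nth)+
    show "hform (p + L) \<epsilon> (\<lambda>k. g k z) (\<lambda>k. frechet_derivative (g k) (at 0) v) = - (\<Sum>a\<in>I. z $ a * cnj (v $ a))" for z v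
      unfolding form using e_sum[of "\<lambda>a. z $ a * cnj (v $ a)"] by (simp add: d1 d2) (simp add: g_def)
    show "hform (p + L) \<epsilon> (\<lambda>k. frechet_derivative (g k) (at z) u) (\<lambda>k. frechet_derivative (g k) (at 0) v) =
       - (\<Sum>a\<in>I. u $ a * cnj (v $ a))" for z u v
      unfolding form using e_sum[of "\<lambda>a. u $ a * cnj (v $ a)"] by (simp add: d1 d2)
  qed
  then show thesis by (rule that)
qed

text \<open>The two Wirtinger derivatives are the complex linear and the antilinear part of the real
  differential, so it suffices to exhibit any such decomposition.\<close>

lemma wirtinger_derivatives:
  assumes "(u has_derivative (\<lambda>v. A v + B v)) (at z)" "\<And>v. A (\<i> *s v) = \<i> * A v" "\<And>v. B (\<i> *s v) = - (\<i> * B v)"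
  shows "wirt u v z = A v" "wirt_bar u v z = B v"
proof -
  have "frechet_derivative u (at z) = (\<lambda>v. A v + B v)" using frechet_derivative_at[OF assms(1)] by simp
  then show "wirt u v z = A v" "wirt_bar u v z = B v"
    by (simp_all add: wirt_def wirt_bar_def assms(2,3) algebra_simps)
qed

text \<open>The conjugate derivative of \<open>log h\<close> is \<open>hform g (dg w) / h\<close>;
  the complex linear part of its differential is minus the \<open>log_hessian\<close>, and the
  second derivatives of \<open>g\<close> occur in the antilinear part only.\<close>

lemma herm_metric_eq_log_hessian:
  assumes pe: "potential_expansion I h m \<epsilon> g" and z: "Re (h z z) > 0"
  shows "herm_metric h z v w = log_hessian m \<epsilon> (\<lambda>k. g k z) (\<lambda>k. frechet_derivative (g k) (at z) v)
      (\<lambda>k. g k z) (\<lambda>k. frechet_derivative (g k) (at z) w)"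
proof -
  let ?d = "\<lambda>z v k. frechet_derivative (g k) (at z) v"
  let ?g = "\<lambda>z k. g k z"
  have h: "h z \<xi> = 1 + hform m \<epsilon> (?g z) (?g \<xi>)" for z \<xi>
    using pe by (simp add: potential_expansion_def)
  have hol: "hol_fun (g k) UNIV" if "k < m" for k
    using pe that by (simp add: potential_expansion_def)
  have dg: "((\<lambda>z. ?g z k) has_derivative (\<lambda>v. ?d z v k)) (at z)" if "k < m" for k z
    using hol_fun_has_derivative(1)[OF hol[OF that]] by simp
  have lin: "hform m \<epsilon> (?d z (\<i> *s v)) y = \<i> * hform m \<epsilon> (?d z v) y"
      "hform m \<epsilon> y (?d z (\<i> *s v)) = - (\<i> * hform m \<epsilon> y (?d z v))" for z v y
    using hol_fun_has_derivative(2)[OF hol open_UNIV UNIV_I]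
    by (auto simp: hform_def sum_distrib_left mult_ac simp flip: sum_negf intro!: sum.cong)
  have re: "h z z = of_real (Re (h z z))" for z
    unfolding h using cnj_hform[of m \<epsilon> "?g z" "?g z"] by (auto simp: complex_eq_iff)
  have dh: "((\<lambda>\<zeta>. h \<zeta> \<zeta>) has_derivative (\<lambda>v. hform m \<epsilon> (?g z) (?d z v) + hform m \<epsilon> (?d z v) (?g z))) (at z)" for z
    using has_derivative_add[OF has_derivative_const has_derivative_hform[OF dg dg]]
    unfolding h by simp
  \<comment> \<open>The formula for the first derivative is needed on a neighbourhood of
    \<open>z\<close>, as it is differentiated once more.\<close>
  let ?W = "{\<zeta>. Re (h \<zeta> \<zeta>) > 0}"
  have "continuous_on UNIV (\<lambda>\<zeta>. h \<zeta> \<zeta>)"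
    using has_derivative_continuous[OF dh] by (simp add: continuous_on_eq_continuous_within)
  then have W: "open ?W" by (intro open_Collect_less continuous_intros)
  have bar: "wirt_bar (\<lambda>\<zeta>. complex_of_real (ln (Re (h \<zeta> \<zeta>)))) w \<zeta> = hform m \<epsilon> (?g \<zeta>) (?d \<zeta> w) / h \<zeta> \<zeta>"
    if "\<zeta> \<in> ?W" for \<zeta>
  proof (rule wirtinger_derivatives(2))
    let ?h1 = "\<lambda>v. hform m \<epsilon> (?d \<zeta> v) (?g \<zeta>)"
    have "((\<lambda>\<zeta>. ln (Re (h \<zeta> \<zeta>))) has_derivative
        (\<lambda>v. Re (hform m \<epsilon> (?g \<zeta>) (?d \<zeta> v) + ?h1 v) * inverse (Re (h \<zeta> \<zeta>)))) (at \<zeta>)"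
      using that by (intro has_derivative_ln has_derivative_Re dh) simp
    then have "((\<lambda>\<zeta>. complex_of_real (ln (Re (h \<zeta> \<zeta>)))) has_derivative
        (\<lambda>v. of_real (Re (hform m \<epsilon> (?g \<zeta>) (?d \<zeta> v) + ?h1 v) * inverse (Re (h \<zeta> \<zeta>))))) (at \<zeta>)"
      by (rule has_derivative_of_real)
    moreover have "of_real (Re (hform m \<epsilon> (?g \<zeta>) (?d \<zeta> v) + ?h1 v) * inverse (Re (h \<zeta> \<zeta>))) =
        ?h1 v / h \<zeta> \<zeta> + hform m \<epsilon> (?g \<zeta>) (?d \<zeta> v) / h \<zeta> \<zeta>" for v
    proof -
      define r where "r = Re (h \<zeta> \<zeta>)"
      have "h \<zeta> \<zeta> = of_real r" unfolding r_def by (rule re)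
      moreover have "hform m \<epsilon> (?g \<zeta>) (?d \<zeta> v) = cnj (?h1 v)" by (simp add: cnj_hform)
      ultimately show ?thesis by (simp add: complex_eq_iff divide_inverse algebra_simps)
    qed
    ultimately show "((\<lambda>\<zeta>. complex_of_real (ln (Re (h \<zeta> \<zeta>)))) has_derivative
        (\<lambda>v. ?h1 v / h \<zeta> \<zeta> + hform m \<epsilon> (?g \<zeta>) (?d \<zeta> v) / h \<zeta> \<zeta>)) (at \<zeta>)" by simp
  qed (simp_all add: lin)
  have "levi (\<lambda>\<zeta>. ln (Re (h \<zeta> \<zeta>))) z v w = - log_hessian m \<epsilon> (?g z) (?d z v) (?g z) (?d z w)"
    unfolding levi_def
  proof (rule wirtinger_derivatives(1))
    have nz: "h z z \<noteq> 0" using z by auto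
    have ddg: "((\<lambda>z. ?d z w k) has_derivative frechet_derivative (\<lambda>z. ?d z w k) (at z)) (at z)" if "k < m" for k
      by (rule hol_fun_has_derivative(1)[OF hol_fun_frechet_derivative[OF hol[OF that] open_UNIV]]) auto
    let ?dd = "\<lambda>v k. frechet_derivative (\<lambda>z. ?d z w k) (at z) v"
    have "((\<lambda>\<zeta>. hform m \<epsilon> (?g \<zeta>) (?d \<zeta> w)) has_derivative
        (\<lambda>v. hform m \<epsilon> (?g z) (?dd v) + hform m \<epsilon> (?d z v) (?d z w))) (at z)"
      by (rule has_derivative_hform[OF dg ddg])
    \<comment> \<open>The differential is arranged as a complex linear term followed by an
      antilinear one.\<close>
    from has_derivative_divide'[OF this dh nz]
    have "((\<lambda>\<zeta>. hform m \<epsilon> (?g \<zeta>) (?d \<zeta> w) / h \<zeta> \<zeta>) has_derivative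
        (\<lambda>v. - log_hessian m \<epsilon> (?g z) (?d z v) (?g z) (?d z w) +
          (hform m \<epsilon> (?g z) (?dd v) * h z z - hform m \<epsilon> (?g z) (?d z w) * hform m \<epsilon> (?g z) (?d z v)) / (h z z * h z z))) (at z)"
      by (rule has_derivative_eq_rhs)
        (simp add: log_hessian_def fun_eq_iff power2_eq_square h algebra_simps diff_divide_distrib add_divide_distrib)
    then show "((\<lambda>\<zeta>. wirt_bar (\<lambda>\<zeta>. complex_of_real (ln (Re (h \<zeta> \<zeta>)))) w \<zeta>) has_derivative
        (\<lambda>v. - log_hessian m \<epsilon> (?g z) (?d z v) (?g z) (?d z w) +
          (hform m \<epsilon> (?g z) (?dd v) * h z z - hform m \<epsilon> (?g z) (?d z w) * hform m \<epsilon> (?g z) (?d z v)) / (h z z * h z z))) (at z)"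
      by (rule has_derivative_transform_within_open[OF _ W]) (use z bar in auto)
    show "- log_hessian m \<epsilon> (?g z) (?d z (\<i> *s v)) (?g z) (?d z w) =
        \<i> * - log_hessian m \<epsilon> (?g z) (?d z v) (?g z) (?d z w)" for v
      by (simp add: log_hessian_def lin algebra_simps)
    show "(hform m \<epsilon> (?g z) (?dd (\<i> *s v)) * h z z - hform m \<epsilon> (?g z) (?d z w) * hform m \<epsilon> (?g z) (?d z (\<i> *s v))) / (h z z * h z z) =
      - (\<i> * ((hform m \<epsilon> (?g z) (?dd v) * h z z - hform m \<epsilon> (?g z) (?d z w) * hform m \<epsilon> (?g z) (?d z v)) / (h z z * h z z)))" for v
    proof -
      have "hform m \<epsilon> (?g z) (?dd (\<i> *s v)) = - (\<i> * hform m \<epsilon> (?g z) (?dd v))"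
        using hol_fun_has_derivative(2)[OF hol_fun_frechet_derivative[OF hol open_UNIV] open_UNIV UNIV_I]
        by (auto simp: hform_def sum_distrib_left mult_ac simp flip: sum_negf intro!: sum.cong)
      then show ?thesis by (simp add: lin algebra_simps minus_divide_left)
    qed
  qed
  then show ?thesis by (simp add: herm_metric_def)
qed

section \<open>The Bergman kernel at the boundary\<close>

text \<open>The continuous function \<open>K k^p\<close> is \<open>c\<close> where \<open>k\<close>
  is nonzero and 0 elsewhere. Its range is finite, so it is constant on the connected set
  \<open>U\<close>. The convention \<open>inverse 0 = 0\<close> means that the kernel formula alone
  does not exclude zeros of \<open>k\<close>.\<close>

lemma kernel_denominator_nonzero:
  assumes K: "continuous_on U (\<lambda>z. K z)" "\<And>z. z \<in> U \<Longrightarrow> K z = c * inverse (k z ^ p)"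
    and k: "continuous_on U k" "z0 \<in> U" "k z0 \<noteq> 0" and U: "connected U" and "p > 0" and z: "z \<in> U"
    and c: "(c::complex) \<noteq> 0"
  shows "k z \<noteq> 0"
proof
  assume "k z = 0"
  let ?f = "\<lambda>z. K z * k z ^ p"
  have f: "?f z = (if k z = 0 then 0 else c)" if "z \<in> U" for z
    using K(2)[OF that] \<open>p > 0\<close> by simp
  have "continuous_on U ?f" by (intro continuous_intros K k)
  moreover have "finite (?f ` U)"
    by (rule finite_subset[of _ "{0, c}"]) (use f in auto)
  ultimately have "?f constant_on U"
    using continuous_finite_range_constant[OF U] by blast
  then obtain d where "\<And>z. z \<in> U \<Longrightarrow> ?f z = d" unfolding constant_on_def by blast
  then have "?f z = ?f z0" using z k(2) by simp
  then show False using f[OF z] f[OF k(2)] k(3) \<open>k z = 0\<close> c by simp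
qed

lemma sets_coord_measure [measurable_cong]: "sets (coord_measure I) = sets borel"
  by (simp add: coord_measure_def)

text \<open>
  At a boundary point \<open>q\<close> with a peak function \<open>\<phi>\<close>, the powers of \<open>\<phi>\<close> have value \<open>1\<close> at \<open>q\<close>, but their norms in
  the Bergman space tend to \<open>0\<close>. As the kernel reproduces them, it cannot be bounded near \<open>q\<close>.
\<close>

lemma bergman_kernel_unbounded:
  assumes K: "bergman_kernel I U K" and int: "integrable (coord_measure I) (indicat_real U)"
    and \<phi>: "hol_fun \<phi> UNIV" "\<And>x. x \<in> U \<Longrightarrow> cmod (\<phi> x) < 1" "\<phi> q = 1"
    and \<xi>: "\<And>n::nat. \<xi> n \<in> U" "\<xi> \<longlonglongrightarrow> q" and C: "\<And>n. cmod (K (\<xi> n) (\<xi> n)) \<le> C" "C > 0"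
  shows False
proof -
  let ?M = "coord_measure I"
  let ?i = "indicat_real U"
  have [measurable]: "?i \<in> borel_measurable ?M" using int by (rule borel_measurable_integrable)
  have "\<phi> \<in> borel_measurable borel"
    by (intro borel_measurable_continuous_onI hol_fun_continuous_on \<phi>(1))
  then have [measurable]: "\<phi> \<in> borel_measurable ?M"
    by (simp add: measurable_cong_sets[OF sets_coord_measure refl])
  \<comment> \<open>The squared Bergman norm of the power \<open>\<phi>^n\<close>. It tends to 0 by
    dominated convergence, with the indicator function of \<open>U\<close> as bound.\<close>
  define J where "J = (\<lambda>n. \<integral>z. ?i z * (cmod (\<phi> z)) ^ (2 * n) \<partial>?M)"
  have le1: "?i z * (cmod (\<phi> z)) ^ (2 * n) \<le> ?i z" for z n
    using \<phi>(2)[of z] by (cases "z \<in> U") (auto simp: power_le_one)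
  have intJ: "integrable ?M (\<lambda>z. ?i z * (cmod (\<phi> z)) ^ (2 * n))" for n
    by (rule Bochner_Integration.integrable_bound[OF int]) (use le1 in auto)
  have "J \<longlonglongrightarrow> (\<integral>z. 0 \<partial>?M)"
    unfolding J_def
  proof (rule integral_dominated_convergence[OF _ _ int])
    show "AE z in ?M. (\<lambda>n. ?i z * (cmod (\<phi> z)) ^ (2 * n)) \<longlonglongrightarrow> 0"
    proof (rule AE_I2)
      fix z
      show "(\<lambda>n. ?i z * (cmod (\<phi> z)) ^ (2 * n)) \<longlonglongrightarrow> 0"
      proof (cases "z \<in> U")
        case True
        have "(cmod (\<phi> z))\<^sup>2 < 1" using \<phi>(2)[OF True] by (simp add: power_less_one_iff)
        then show ?thesis using True by (simp add: power_mult LIMSEQ_realpow_zero)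
      qed simp
    qed
  qed (use le1 in auto)
  then have J0: "J \<longlonglongrightarrow> 0" by simp
  \<comment> \<open>The reproducing integral is estimated by
    \<open>a b \<le> C a^2 / 2 + b^2 / (2 C)\<close>. The squared norm of the kernel function at
    \<open>x\<close> is \<open>K x x\<close>, so the second term contributes at most 1/2.\<close>
  have bound: "cmod (\<phi> x) ^ n \<le> C / 2 * J n + 1 / 2" if x: "x \<in> U" and Cx: "cmod (K x x) \<le> C" for x n
  proof -
    have Kx: "(\<lambda>z. K z x) \<in> bergman_space I U" using K x unfolding bergman_kernel_def by blast
    then have iK: "integrable ?M (\<lambda>z. ?i z * (cmod (K z x))\<^sup>2)"
      by (simp add: bergman_space_def set_integrable_def)
    have rep: "g y = (\<integral>z. ?i z *\<^sub>R (g z * cnj (K z y)) \<partial>?M)" if "g \<in> bergman_space I U" "y \<in> U" for g y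
      using K that unfolding bergman_kernel_def set_lebesgue_integral_def by blast
    have "K x x = (\<integral>z. of_real (?i z * (cmod (K z x))\<^sup>2) \<partial>?M)"
      using rep[OF Kx x] by (simp add: complex_norm_square[symmetric] scaleR_conv_of_real)
    then have "K x x = of_real (\<integral>z. ?i z * (cmod (K z x))\<^sup>2 \<partial>?M)"
      unfolding integral_complex_of_real .
    then have "\<bar>\<integral>z. ?i z * (cmod (K z x))\<^sup>2 \<partial>?M\<bar> \<le> C" using Cx by (simp only: norm_of_real)
    then have Kxx: "(\<integral>z. ?i z * (cmod (K z x))\<^sup>2 \<partial>?M) \<le> C" by simp
    have "(\<lambda>z. \<phi> z ^ n) \<in> bergman_space I U"
      using intJ[of n] hol_fun_power[OF hol_fun_subset[OF \<phi>(1)], of U n]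
      by (simp add: bergman_space_def set_integrable_def norm_power power_mult[symmetric] mult.commute)
    from rep[OF this x] have "cmod (\<phi> x ^ n) = norm (\<integral>z. ?i z *\<^sub>R (\<phi> z ^ n * cnj (K z x)) \<partial>?M)" by simp
    also have "\<dots> \<le> (\<integral>z. norm (?i z *\<^sub>R (\<phi> z ^ n * cnj (K z x))) \<partial>?M)"
      by (rule integral_norm_bound)
    also have "\<dots> \<le> (\<integral>z. C / 2 * (?i z * (cmod (\<phi> z)) ^ (2 * n)) + 1 / (2 * C) * (?i z * (cmod (K z x))\<^sup>2) \<partial>?M)"
    proof (rule integral_mono')
      show "integrable ?M (\<lambda>z. C / 2 * (?i z * (cmod (\<phi> z)) ^ (2 * n)) + 1 / (2 * C) * (?i z * (cmod (K z x))\<^sup>2))"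
        by (intro Bochner_Integration.integrable_add integrable_mult_right intJ iK)
      fix z
      define a b where "a = cmod (\<phi> z) ^ n" and "b = cmod (K z x)"
      have "0 \<le> (C * a - b)\<^sup>2 / (2 * C)" using C(2) by simp
      also have "\<dots> = C / 2 * a\<^sup>2 + 1 / (2 * C) * b\<^sup>2 - a * b"
        using C(2) by (simp add: power2_eq_square field_simps)
      finally have "a * b \<le> C / 2 * a\<^sup>2 + 1 / (2 * C) * b\<^sup>2" by simp
      then show "norm (?i z *\<^sub>R (\<phi> z ^ n * cnj (K z x))) \<le>
          C / 2 * (?i z * (cmod (\<phi> z)) ^ (2 * n)) + 1 / (2 * C) * (?i z * (cmod (K z x))\<^sup>2)"
        by (cases "z \<in> U") (simp_all add: a_def b_def norm_mult norm_power power_mult[symmetric] mult.commute)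
      show "0 \<le> C / 2 * (?i z * (cmod (\<phi> z)) ^ (2 * n)) + 1 / (2 * C) * (?i z * (cmod (K z x))\<^sup>2)"
        using C(2) by (intro add_nonneg_nonneg mult_nonneg_nonneg) auto
    qed
    also have "\<dots> = C / 2 * J n + 1 / (2 * C) * (\<integral>z. ?i z * (cmod (K z x))\<^sup>2 \<partial>?M)"
      using intJ[of n] iK by (simp add: J_def)
    also have "\<dots> \<le> C / 2 * J n + 1 / (2 * C) * C"
      using Kxx C(2) by (intro add_left_mono mult_left_mono) auto
    finally show ?thesis using C(2) by (simp add: norm_power)
  qed
  \<comment> \<open>Here the points tend to \<open>q\<close> with \<open>n\<close> fixed; afterwards
    \<open>n\<close> tends to infinity and leaves \<open>1 \<le> 1 / 2\<close>.\<close>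
  have "1 \<le> C / 2 * J n + 1 / 2" for n
  proof (rule LIMSEQ_le_const2)
    have "isCont \<phi> q" using hol_fun_continuous_on[OF \<phi>(1)] by (simp add: continuous_on_eq_continuous_at)
    then have "(\<lambda>k. \<phi> (\<xi> k)) \<longlonglongrightarrow> \<phi> q" using \<xi>(2) by (rule isCont_tendsto_compose)
    then have "(\<lambda>k. cmod (\<phi> (\<xi> k)) ^ n) \<longlonglongrightarrow> cmod (\<phi> q) ^ n" by (intro tendsto_intros)
    then show "(\<lambda>k. cmod (\<phi> (\<xi> k)) ^ n) \<longlonglongrightarrow> 1" using \<phi>(3) by simp
  qed (use bound \<xi>(1) C(1) in blast)
  moreover have "(\<lambda>n. C / 2 * J n + 1 / 2) \<longlonglongrightarrow> C / 2 * 0 + 1 / 2"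
    by (intro tendsto_intros J0)
  ultimately have "1 \<le> C / 2 * 0 + (1 / 2 :: real)"
    by (intro LIMSEQ_le_const) auto
  then show False by simp
qed

text \<open>Convexity and the balanced property come from the Jordan ball, the absence of zeros of
  \<open>h\<close> from the kernel. On the diagonal \<open>h\<close> is real, has no zeros, and is 1
  at the origin, so it is positive on the connected set \<open>U\<close>. At a boundary point with
  \<open>h q q\<close> nonzero the kernel would stay bounded, contrary to the peak function
  argument.\<close>

lemma hc_domain_properties:
  assumes hc: "hc_domain I U h" and pe: "potential_expansion I h m \<epsilon> g"
  shows "openin (top_of_set (coord_space I)) U" "bounded U" "convex U" "0 \<in> U"
    "\<And>z c. z \<in> U \<Longrightarrow> cmod c \<le> 1 \<Longrightarrow> c *s z \<in> U"
    "\<And>z \<xi>. z \<in> U \<Longrightarrow> \<xi> \<in> U \<Longrightarrow> h z \<xi> \<noteq> 0"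
    "\<And>z. z \<in> U \<Longrightarrow> Re (h z z) > 0"
    "\<And>q. q \<in> closure U \<Longrightarrow> q \<notin> U \<Longrightarrow> h q q = 0"
proof -
  obtain T where T: "positive_hermitian_jts I T" "U = jts_ball I T"
    using hc unfolding hc_domain_def by blast
  show op: "openin (top_of_set (coord_space I)) U" and "bounded U"
    using hc unfolding hc_domain_def coord_domain_def by blast+
  show cv: "convex U" unfolding T(2) by (rule convex_jts_ball[OF T(1)])
  show 0: "0 \<in> U" unfolding T(2) by (rule jts_ball_zero[OF T(1)])
  show "\<And>z c. z \<in> U \<Longrightarrow> cmod c \<le> 1 \<Longrightarrow> c *s z \<in> U"
    unfolding T(2) by (rule jts_ball_smult[OF T(1)])
  have sub: "U \<subseteq> coord_space I" by (auto simp: T(2) jts_ball_def)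
  have conn: "connected U" using cv by (rule convex_connected)
  have "\<exists>K (c::real) (p::nat). bergman_kernel I U K \<and> c > 0 \<and> p > 0 \<and>
      (\<forall>z\<in>U. \<forall>\<xi>\<in>U. K z \<xi> = c * inverse (h z \<xi> ^ p))"
    using hc unfolding hc_domain_def hc_polynomial_def by (elim conjE)
  then obtain K and c :: real and p :: nat where K: "bergman_kernel I U K" and c': "0 < complex_of_real c" and p: "p > 0"
    and Kh: "\<And>z \<xi>. z \<in> U \<Longrightarrow> \<xi> \<in> U \<Longrightarrow> K z \<xi> = c * inverse (h z \<xi> ^ p)"
    by (elim exE conjE) blast
  have c: "c > 0" using c' by (simp add: less_complex_def)
  have h: "h z \<xi> = 1 + hform m \<epsilon> (\<lambda>k. g k z) (\<lambda>k. g k \<xi>)" for z \<xi>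
    using pe by (simp add: potential_expansion_def)
  have g: "hol_fun (g k) UNIV" "g k 0 = 0" if "k < m" for k
    using pe that by (simp_all add: potential_expansion_def)
  have h0: "h z 0 = 1" "h 0 z = 1" for z using g(2) by (simp_all add: h hform_def)
  have hcont: "continuous_on UNIV (\<lambda>z. h z \<xi>)" for \<xi>
    unfolding h hform_def using hol_fun_continuous_on[OF g(1)] by (intro continuous_intros) auto
  have hcont2: "continuous_on UNIV (\<lambda>z. h z z)"
    unfolding h hform_def using hol_fun_continuous_on[OF g(1)] by (intro continuous_intros) auto
  show nz: "h z \<xi> \<noteq> 0" if "z \<in> U" "\<xi> \<in> U" for z \<xi>
  proof (rule kernel_denominator_nonzero[of U "\<lambda>z. K z \<xi>" "of_real c" "\<lambda>z. h z \<xi>" p 0])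
    show "continuous_on U (\<lambda>z. K z \<xi>)"
      using K that by (auto simp: bergman_kernel_def bergman_space_def intro: hol_fun_continuous_on)
    show "continuous_on U (\<lambda>z. h z \<xi>)" using hcont by (rule continuous_on_subset) simp
  qed (use Kh that 0 h0 c p conn in auto)
  have im: "h z z = of_real (Re (h z z))" for z
    unfolding h using cnj_hform[of m \<epsilon> "\<lambda>k. g k z" "\<lambda>k. g k z"] by (auto simp: complex_eq_iff)
  show "Re (h z z) > 0" if "z \<in> U" for z
  proof (rule ccontr)
    assume neg: "\<not> Re (h z z) > 0"
    have "connected ((\<lambda>z. Re (h z z)) ` U)"
      by (intro connected_continuous_image[OF _ conn] continuous_on_Re continuous_on_subset[OF hcont2]) simp
    moreover have "Re (h z z) \<in> (\<lambda>z. Re (h z z)) ` U" "1 \<in> (\<lambda>z. Re (h z z)) ` U"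
      using that 0 h0 by (auto intro!: image_eqI[of 1 _ 0])
    ultimately have "0 \<in> (\<lambda>z. Re (h z z)) ` U"
      using connectedD_interval[of "(\<lambda>z. Re (h z z)) ` U" "Re (h z z)" 1 0] neg by simp
    then obtain x where "x \<in> U" "Re (h x x) = 0" by auto
    then show False using nz[of x x] im[of x] by simp
  qed
  show "h q q = 0" if q: "q \<in> closure U" "q \<notin> U" for q
  proof (rule ccontr)
    assume hq: "h q q \<noteq> 0"
    have qI: "q \<in> coord_space I"
      using q(1) closure_minimal[OF sub closed_coord_space] by blast
    obtain \<phi> where \<phi>: "hol_fun \<phi> UNIV" "\<And>x. x \<in> U \<Longrightarrow> cmod (\<phi> x) < 1" "\<phi> q = 1"
      using jts_ball_peak[OF T(1) qI] q(2) unfolding T(2) by blast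
    obtain \<xi> where \<xi>: "\<And>n. \<xi> n \<in> U" "\<xi> \<longlonglongrightarrow> q" using q(1) unfolding closure_sequential by blast
    have "isCont (\<lambda>z. h z z) q" using hcont2 by (simp add: continuous_on_eq_continuous_at)
    then have "(\<lambda>n. h (\<xi> n) (\<xi> n)) \<longlonglongrightarrow> h q q" using \<xi>(2) by (rule isCont_tendsto_compose)
    then have "(\<lambda>n. c * inverse (h (\<xi> n) (\<xi> n) ^ p)) \<longlonglongrightarrow> c * inverse (h q q ^ p)"
      by (intro tendsto_intros) (use hq in auto)
    then have "(\<lambda>n. K (\<xi> n) (\<xi> n)) \<longlonglongrightarrow> c * inverse (h q q ^ p)" using Kh \<xi>(1) by simp
    then have "Bseq (\<lambda>n. K (\<xi> n) (\<xi> n))" by (intro convergent_imp_Bseq convergentI)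
    then obtain C where C: "C > 0" "\<And>n. cmod (K (\<xi> n) (\<xi> n)) \<le> C" by (auto simp: Bseq_def)
    \<comment> \<open>As \<open>h z 0 = 1\<close>, the kernel function at 0 is the constant
      \<open>c\<close>. Its square integrability says that \<open>U\<close> has finite
      volume.\<close>
    have "(\<lambda>z. K z 0) \<in> bergman_space I U" using K 0 unfolding bergman_kernel_def by blast
    then have "integrable (coord_measure I) (\<lambda>z. indicat_real U z * (cmod (K z 0))\<^sup>2)"
      by (simp add: bergman_space_def set_integrable_def)
    also have "(\<lambda>z. indicat_real U z * (cmod (K z 0))\<^sup>2) = (\<lambda>z. indicat_real U z * c\<^sup>2)"
      using Kh[OF _ 0] h0 c by (auto simp: fun_eq_iff indicator_def)
    finally have "integrable (coord_measure I) (\<lambda>z. indicat_real U z * c\<^sup>2 * inverse (c\<^sup>2))"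
      by (rule integrable_mult_left)
    then have "integrable (coord_measure I) (indicat_real U)" using c by (simp add: mult.assoc)
    from bergman_kernel_unbounded[OF K this \<phi> \<xi> C(2,1)] show False .
  qed
qed

section \<open>Holomorphic frames\<close>

text \<open>Frames are stored in square matrices of which only the columns in \<open>J\<close>
  matter. This projection discards the others, and adding its complement produces matrices that can
  be inverted.\<close>

definition coord_matrix :: "'n set \<Rightarrow> complex^'n^'n::finite" where
  "coord_matrix J = (\<chi> a b. if a = b \<and> a \<in> J then 1 else 0)"

lemma coord_matrix_mult: "coord_matrix J *v x = coord_proj J x"
proof -
  have "(\<Sum>b\<in>UNIV. (if a = b \<and> a \<in> J then 1 else 0) * x $ b) = (if a \<in> J then x $ a else 0)" for a
    by (cases "a \<in> J") (simp_all add: if_distrib[of "\<lambda>c. c * _"] cong: if_cong)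
  then show ?thesis by (simp add: coord_matrix_def coord_proj_def matrix_vector_mult_def vec_eq_iff)
qed

lemma coord_matrix_in [simp]: "coord_matrix J *v x \<in> coord_space J"
  by (simp add: coord_matrix_mult)

lemma coord_matrix_id: "x \<in> coord_space J \<Longrightarrow> coord_matrix J *v x = x"
  by (simp add: coord_matrix_mult coord_proj_id)

lemma subspace_coord_space: "vec.subspace (coord_space J)"
  unfolding vec.subspace_def by (auto simp: coord_space_add coord_space_smult)

lemma dim_coord_space: "vec.dim (coord_space J :: (complex^'n::finite) set) = card J"
proof (rule vec.dim_unique[where B = "(\<lambda>a. axis a 1) ` J"])
  show "(\<lambda>a. axis a 1) ` J \<subseteq> (coord_space J :: (complex^'n) set)"
    by (auto simp: coord_space_def axis_def)
  show "coord_space J \<subseteq> vec.span ((\<lambda>a. axis a 1) ` J :: (complex^'n) set)"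
  proof
    fix x :: "complex^'n" assume x: "x \<in> coord_space J"
    have "x = (\<Sum>a\<in>UNIV. x $ a *s axis a 1)" by (simp add: basis_expansion)
    also have "\<dots> = (\<Sum>a\<in>J. x $ a *s axis a 1)"
      using x by (intro sum.mono_neutral_right) (auto simp: coord_space_def)
    finally show "x \<in> vec.span ((\<lambda>a. axis a 1) ` J)"
      by (metis (no_types, lifting) image_eqI vec.span_base vec.span_scale vec.span_sum)
  qed
  show "vec.independent ((\<lambda>a. axis a 1) ` J :: (complex^'n) set)"
    by (rule vec.independent_mono[OF independent_cart_basis]) (auto simp: cart_basis_def)
  show "card ((\<lambda>a. axis a (1::complex)) ` J) = card J"
    by (intro card_image) (auto simp: inj_on_def axis_eq_axis)
qed

lemma subspace_coordinates:
  assumes "vec.subspace (F :: (complex^'n::finite) set)"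
  obtains J and B :: "complex^'n^'n" where "card J = vec.dim F" "bij_betw ((*v) B) (coord_space J) F"
proof -
  have "vec.dim F \<le> CARD('n)" using vec.dim_subset_UNIV[of F] by (simp add: vec.dimension_def card_cart_basis)
  then obtain J :: "'n set" where J: "card J = vec.dim F" using obtain_subset_with_card_n by blast
  have "\<exists>f. Vector_Spaces.linear (*s) (*s) f \<and> f ` coord_space J = F \<and> inj_on f (coord_space J)"
    by (rule vec.subspace_isomorphism[OF subspace_coord_space assms]) (simp add: dim_coord_space J)
  then obtain f where f: "Vector_Spaces.linear (*s) (*s) f" "f ` coord_space J = F" "inj_on f (coord_space J)"
    by blast
  then have "(*v) (matrix f) = f" using matrix_works by blast
  with f J show thesis by (intro that[of J "matrix f"]) (auto simp: bij_betw_def)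
qed

lemma left_inverse_matrix:
  fixes A :: "complex^'n::finite^'m::finite"
  assumes "inj_on ((*v) A) (coord_space J)"
  obtains B where "\<And>x. x \<in> coord_space J \<Longrightarrow> B *v (A *v x) = x" "\<And>y. B *v y \<in> coord_space J"
proof -
  obtain g where g: "range g \<subseteq> coord_space J" "Vector_Spaces.linear (*s) (*s) g"
      "\<forall>v\<in>coord_space J. g (A *v v) = v"
    using vec.linear_exists_left_inverse_on[OF matrix_vector_mul_linear_gen subspace_coord_space assms] by blast
  have "matrix g *v y = g y" for y using g(2) matrix_works by blast
  with g show thesis by (intro that[of "matrix g"]) auto
qed

lemma right_inverse_matrix:
  fixes A :: "complex^'n::finite^'m::finite"
  obtains B where "\<And>x. x \<in> range ((*v) A) \<Longrightarrow> A *v (B *v x) = x"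
proof -
  obtain g where g: "Vector_Spaces.linear (*s) (*s) g" "\<forall>v\<in>range ((*v) A). A *v g v = v"
    using vec.linear_exists_right_inverse_on[OF matrix_vector_mul_linear_gen vec.subspace_UNIV] by blast
  have "matrix g *v y = g y" for y using g(1) matrix_works by blast
  with g show thesis by (intro that[of "matrix g"]) auto
qed

section \<open>Holomorphic solutions of linear systems\<close>

lemma hol_matrix_transpose: "hol_matrix A X \<Longrightarrow> hol_matrix (\<lambda>q. transpose (A q)) X"
  by (simp add: hol_matrix_def transpose_def)

text \<open>By Cramer's rule the entries of \<open>C\<close> are quotients of determinants of
  holomorphic matrices.\<close>

lemma hol_matrix_solve_left:
  fixes E :: "complex^'n::finite \<Rightarrow> complex^'l::finite^'l" and C :: "complex^'n \<Rightarrow> complex^'k::finite^'l"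
  assumes E: "hol_matrix E X" and R: "hol_matrix R X"
    and eq: "\<And>q. q \<in> X \<Longrightarrow> E q ** C q = R q" and nz: "\<And>q. q \<in> X \<Longrightarrow> det (E q) \<noteq> 0"
  shows "hol_matrix C X"
  unfolding hol_matrix_def
proof (intro allI)
  fix a b
  have "C q $ a $ b = det (\<chi> i j. if j = a then R q $ i $ b else E q $ i $ j) / det (E q)" if q: "q \<in> X" for q
  proof -
    have "E q *v column b (C q) = column b (R q)"
      unfolding eq[OF q, symmetric] by (simp add: vec_eq_iff column_def matrix_vector_mult_def matrix_matrix_mult_def)
    then have "column b (C q) = (\<chi> k. det (\<chi> i j. if j = k then column b (R q) $ i else E q $ i $ j) / det (E q))"
      using cramer[OF nz[OF q]] by blast
    then have "column b (C q) $ a = det (\<chi> i j. if j = a then column b (R q) $ i else E q $ i $ j) / det (E q)" by simp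
    then show ?thesis by (simp add: column_def cong: if_cong)
  qed
  moreover have "hol_matrix (\<lambda>q. \<chi> i j. if j = a then R q $ i $ b else E q $ i $ j) X"
    unfolding hol_matrix_def
  proof (intro allI)
    show "hol_fun (\<lambda>q. (\<chi> i j. if j = a then R q $ i $ b else E q $ i $ j) $ i $ j) X" for i j
      using R E by (cases "j = a") (simp_all add: hol_matrix_def)
  qed
  then have "hol_fun (\<lambda>q. det (\<chi> i j. if j = a then R q $ i $ b else E q $ i $ j) / det (E q)) X"
    by (intro hol_fun_divide hol_fun_det E nz)
  ultimately show "hol_fun (\<lambda>q. C q $ a $ b) X" by (subst hol_fun_cong)
qed

lemma hol_matrix_solve_right:
  fixes E :: "complex^'n::finite \<Rightarrow> complex^'l::finite^'l" and C :: "complex^'n \<Rightarrow> complex^'l^'k::finite"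
  assumes "hol_matrix E X" "hol_matrix R X"
    and "\<And>q. q \<in> X \<Longrightarrow> C q ** E q = R q" and "\<And>q. q \<in> X \<Longrightarrow> det (E q) \<noteq> 0"
  shows "hol_matrix C X"
proof -
  have "hol_matrix (\<lambda>q. transpose (C q)) X"
    by (rule hol_matrix_solve_left[OF hol_matrix_transpose[OF assms(1)] hol_matrix_transpose[OF assms(2)]])
      (use assms(3,4) in \<open>auto simp: matrix_transpose_mul[symmetric]\<close>)
  then show ?thesis using hol_matrix_transpose by fastforce
qed

lemma hol_matrix_local:
  assumes "\<And>z. z \<in> X \<Longrightarrow> \<exists>V. open V \<and> z \<in> V \<and> hol_matrix g (X \<inter> V)"
  shows "hol_matrix g X"
  unfolding hol_matrix_def by (intro allI hol_fun_local) (use assms in \<open>force simp: hol_matrix_def\<close>)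

lemma det_nonzero_nearby:
  assumes "hol_matrix E X"
  obtains V where "open V" "X \<inter> V = {q \<in> X. det (E q) \<noteq> 0}"
proof -
  have "openin (top_of_set X) (X \<inter> (\<lambda>q. det (E q)) -` (- {0}))"
    by (rule continuous_openin_preimage_gen[OF hol_fun_continuous_on[OF hol_fun_det[OF assms]]]) auto
  then obtain V where "open V" "X \<inter> (\<lambda>q. det (E q)) -` (- {0}) = X \<inter> V" unfolding openin_open by blast
  then show thesis by (intro that[of V]) auto
qed

lemma matrix_id_if: "(\<And>x. A *v x = x) \<Longrightarrow> A = mat 1"
  by (simp add: matrix_eq)

text \<open>The system \<open>A C = R\<close> is overdetermined. Multiplication by a constant left
  inverse \<open>B\<close> of \<open>A\<close> at \<open>q0\<close> makes it square:
  \<open>B A\<close>, completed by the identity outside \<open>K\<close>, is the identity at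
  \<open>q0\<close> and hence invertible nearby. No holomorphic choice of left inverses is
  involved.\<close>

lemma frame_coefficients_holomorphic:
  fixes A R C :: "complex^'n::finite \<Rightarrow> complex^'n^'n"
  assumes A: "hol_matrix A X" and R: "hol_matrix R X"
    and inj: "\<And>q. q \<in> X \<Longrightarrow> inj_on ((*v) (A q)) (coord_space K)"
    and C: "\<And>q x. q \<in> X \<Longrightarrow> C q *v x \<in> coord_space K" "\<And>q x. q \<in> X \<Longrightarrow> A q *v (C q *v x) = R q *v x"
  shows "hol_matrix C X"
proof (rule hol_matrix_local)
  fix q0 assume q0: "q0 \<in> X"
  obtain B where B: "\<And>x. x \<in> coord_space K \<Longrightarrow> B *v (A q0 *v x) = x" "\<And>y. B *v y \<in> coord_space K"
    using left_inverse_matrix[OF inj[OF q0]] by blast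
  define E where "E = (\<lambda>q. B ** A q ** coord_matrix K + (mat 1 - coord_matrix K))"
  have E: "hol_matrix E X"
    unfolding E_def by (intro hol_matrix_add hol_matrix_mult hol_matrix_const A)
  have "E q0 *v x = x" for x
    by (simp add: E_def matrix_vector_mult_add_rdistrib matrix_vector_mult_diff_rdistrib B(1)
        flip: matrix_vector_mul_assoc)
  then have E0: "E q0 = mat 1" by (rule matrix_id_if)
  obtain V where V: "open V" "X \<inter> V = {q \<in> X. det (E q) \<noteq> 0}" using det_nonzero_nearby[OF E] .
  have "hol_matrix C (X \<inter> V)"
  proof (rule hol_matrix_solve_left)
    show "hol_matrix E (X \<inter> V)" by (rule hol_matrix_subset[OF E]) blast
    show "hol_matrix (\<lambda>q. B ** R q) (X \<inter> V)"
      by (intro hol_matrix_mult hol_matrix_const hol_matrix_subset[OF R]) auto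
    show "E q ** C q = B ** R q" if "q \<in> X \<inter> V" for q
      unfolding matrix_eq using that C
      by (simp add: E_def matrix_vector_mult_add_rdistrib matrix_vector_mult_diff_rdistrib coord_matrix_id
          flip: matrix_vector_mul_assoc)
    show "det (E q) \<noteq> 0" if "q \<in> X \<inter> V" for q using that V by blast
  qed
  moreover have "q0 \<in> X \<inter> V" unfolding V(2) using q0 E0 by simp
  ultimately show "\<exists>V. open V \<and> q0 \<in> V \<and> hol_matrix C (X \<inter> V)" using V(1) by blast
qed

text \<open>The dual situation: a constant right inverse of the surjective \<open>A\<close> at
  \<open>q0\<close> turns \<open>C A = R\<close> into a square system near
  \<open>q0\<close>.\<close>

lemma coframe_coefficients_holomorphic:
  fixes A R C :: "complex^'n::finite \<Rightarrow> complex^'n^'n"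
  assumes A: "hol_matrix A X" and R: "hol_matrix R X"
    and onto: "\<And>q. q \<in> X \<Longrightarrow> range ((*v) (A q)) = coord_space J"
    and C: "\<And>q x. q \<in> X \<Longrightarrow> C q *v x = C q *v (coord_matrix J *v x)" "\<And>q x. q \<in> X \<Longrightarrow> C q *v (A q *v x) = R q *v x"
  shows "hol_matrix C X"
proof (rule hol_matrix_local)
  fix q0 assume q0: "q0 \<in> X"
  obtain B where "\<And>x. x \<in> range ((*v) (A q0)) \<Longrightarrow> A q0 *v (B *v x) = x"
    by (rule right_inverse_matrix) (rule that)
  then have B: "\<And>x. x \<in> coord_space J \<Longrightarrow> A q0 *v (B *v x) = x" unfolding onto[OF q0] .
  define E where "E = (\<lambda>q. A q ** B ** coord_matrix J + (mat 1 - coord_matrix J))"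
  have E: "hol_matrix E X"
    unfolding E_def by (intro hol_matrix_add hol_matrix_mult hol_matrix_const A)
  have "E q0 *v x = x" for x
    by (simp add: E_def matrix_vector_mult_add_rdistrib matrix_vector_mult_diff_rdistrib B
        flip: matrix_vector_mul_assoc)
  then have E0: "E q0 = mat 1" by (rule matrix_id_if)
  obtain V where V: "open V" "X \<inter> V = {q \<in> X. det (E q) \<noteq> 0}" using det_nonzero_nearby[OF E] .
  have "hol_matrix C (X \<inter> V)"
  proof (rule hol_matrix_solve_right)
    show "hol_matrix E (X \<inter> V)" by (rule hol_matrix_subset[OF E]) blast
    show "hol_matrix (\<lambda>q. R q ** B ** coord_matrix J) (X \<inter> V)"
      by (intro hol_matrix_mult hol_matrix_const hol_matrix_subset[OF R]) auto
    show "C q ** E q = R q ** B ** coord_matrix J" if q: "q \<in> X \<inter> V" for q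
      unfolding matrix_eq
    proof
      fix x
      have "C q *v (x - coord_matrix J *v x) = 0"
        using C(1)[of q x] q by (simp add: matrix_vector_mult_diff_distrib)
      then show "C q ** E q *v x = R q ** B ** coord_matrix J *v x"
        using q C(2) by (simp add: E_def matrix_vector_mult_add_rdistrib matrix_vector_mult_diff_rdistrib
          matrix_vector_right_distrib flip: matrix_vector_mul_assoc)
    qed
    show "det (E q) \<noteq> 0" if "q \<in> X \<inter> V" for q using that V by blast
  qed
  moreover have "q0 \<in> X \<inter> V" unfolding V(2) using q0 E0 by simp
  ultimately show "\<exists>V. open V \<and> q0 \<in> V \<and> hol_matrix C (X \<inter> V)" using V(1) by blast
qed

section \<open>Charts of subbundles and quotient bundles, and maps between them\<close>

lemma subbundle_chart:
  assumes "(V, J, \<tau>) \<in> charts (subbundle S F)"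
  obtains A where "open V" "hol_matrix A (S \<inter> V)"
    "\<And>q. q \<in> S \<inter> V \<Longrightarrow> bij_betw ((*v) (A q)) (coord_space J) (F q)"
    "\<And>q x. q \<in> S \<inter> V \<Longrightarrow> x \<in> coord_space J \<Longrightarrow> \<tau> q (A q *v x) = x"
    "\<And>q. q \<in> S \<inter> V \<Longrightarrow> bij_betw (\<tau> q) (F q) (coord_space J)"
    "\<And>q x. q \<in> S \<inter> V \<Longrightarrow> x \<in> coord_space J \<Longrightarrow> inv_into (F q) (\<tau> q) x = A q *v x"
proof -
  obtain A where A: "open V" "hol_matrix A (S \<inter> V)"
    "\<And>q. q \<in> S \<inter> V \<Longrightarrow> bij_betw ((*v) (A q)) (coord_space J) (F q)"
    "\<And>q x. q \<in> S \<inter> V \<Longrightarrow> x \<in> coord_space J \<Longrightarrow> \<tau> q (A q *v x) = x"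
    using assms unfolding subbundle_def by auto
  have b: "bij_betw (\<tau> q) (F q) (coord_space J)" if "q \<in> S \<inter> V" for q
  proof -
    have F: "F q = (*v) (A q) ` coord_space J" using A(3)[OF that] by (simp add: bij_betw_def)
    show ?thesis unfolding F
      by (rule bij_betw_byWitness[where f' = "(*v) (A q)"]) (use A(4)[OF that] in auto)
  qed
  have "inv_into (F q) (\<tau> q) x = A q *v x" if "q \<in> S \<inter> V" "x \<in> coord_space J" for q x
  proof (rule inv_into_f_eq)
    show "inj_on (\<tau> q) (F q)" using b[OF that(1)] by (simp add: bij_betw_def)
    show "A q *v x \<in> F q" using A(3)[OF that(1)] that(2) by (auto simp: bij_betw_def)
  qed (rule A(4)[OF that])
  with A b that show thesis by blast
qed

lemma quotient_chart:
  assumes "(V, J, \<tau>) \<in> charts (quotient_bundle S F E)"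
    and F: "\<And>q. q \<in> S \<Longrightarrow> F q = UNIV"
  obtains A where "open V" "hol_matrix A (S \<inter> V)"
    "\<And>q. q \<in> S \<inter> V \<Longrightarrow> range ((*v) (A q)) = coord_space J"
    "\<And>q. q \<in> S \<inter> V \<Longrightarrow> E q = {v. A q *v v = 0}"
    "\<And>q v. q \<in> S \<inter> V \<Longrightarrow> \<tau> q (coset (E q) v) = A q *v v"
    "\<And>q. q \<in> S \<inter> V \<Longrightarrow> bij_betw (\<tau> q) (coset (E q) ` F q) (coord_space J)"
proof -
  obtain A where A: "open V" "hol_matrix A (S \<inter> V)"
    "\<And>q. q \<in> S \<inter> V \<Longrightarrow> (\<lambda>v. A q *v v) ` F q = coord_space J"
    "\<And>q. q \<in> S \<inter> V \<Longrightarrow> E q = {v \<in> F q. A q *v v = 0}"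
    "\<And>q v. q \<in> S \<inter> V \<Longrightarrow> v \<in> F q \<Longrightarrow> \<tau> q (coset (E q) v) = A q *v v"
  proof -
    have "open V \<and> (\<exists>A. hol_matrix A (S \<inter> V) \<and> (\<forall>q\<in>S \<inter> V. (\<lambda>v. A q *v v) ` F q = coord_space J \<and>
        E q = {v \<in> F q. A q *v v = 0} \<and> (\<forall>v\<in>F q. \<tau> q (coset (E q) v) = A q *v v)))"
      using assms(1) unfolding quotient_bundle_def by simp
    then show thesis using that by blast
  qed
  have r: "range ((*v) (A q)) = coord_space J" "E q = {v. A q *v v = 0}"
      "\<tau> q (coset (E q) v) = A q *v v" if "q \<in> S \<inter> V" for q v
    using A(3-5)[OF that] F[of q] that by auto
  have "bij_betw (\<tau> q) (coset (E q) ` F q) (coord_space J)" if q: "q \<in> S \<inter> V" for q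
    unfolding bij_betw_def
  proof
    show "inj_on (\<tau> q) (coset (E q) ` F q)"
    proof (rule inj_onI, clarify)
      fix v w assume "\<tau> q (coset (E q) v) = \<tau> q (coset (E q) w)"
      then have vw: "A q *v (v - w) = 0" using r(3)[OF q] by (simp add: matrix_vector_mult_diff_distrib)
      have "coset (E q) v = coset (E q) w"
        unfolding coset_def r(2)[OF q]
      proof safe
        fix e assume "A q *v e = 0"
        then show "\<exists>e'. v + e = w + e' \<and> e' \<in> {v. A q *v v = 0}"
          using vw by (intro exI[of _ "v - w + e"]) (simp add: matrix_vector_right_distrib)
        show "\<exists>e'. w + e = v + e' \<and> e' \<in> {v. A q *v v = 0}"
          using vw \<open>A q *v e = 0\<close>
          by (intro exI[of _ "e - (v - w)"]) (simp add: matrix_vector_mult_diff_distrib)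
      qed
      then show "coset (E q) v = coset (E q) w" .
    qed
    show "\<tau> q ` (coset (E q) ` F q) = coord_space J"
      using r(1,3)[OF q] F[of q] q by (simp add: image_image)
  qed
  with A(1,2) r that show thesis by blast
qed

lemma bundle_mapI:
  assumes "\<And>q. q \<in> S \<Longrightarrow> \<Phi> q ` fibre E q \<subseteq> fibre F q"
    and "\<And>V J \<tau> W K \<sigma>. (V, J, \<tau>) \<in> charts E \<Longrightarrow> (W, K, \<sigma>) \<in> charts F \<Longrightarrow>
      \<exists>A. hol_matrix A (S \<inter> V \<inter> W) \<and>
        (\<forall>q\<in>S \<inter> V \<inter> W. \<forall>x\<in>coord_space J. \<sigma> q (\<Phi> q (inv_into (fibre E q) (\<tau> q) x)) = A q *v x)"
  shows "bundle_map S E F \<Phi>"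
  unfolding bundle_map_def
proof (rule conjI)
  show "\<forall>q\<in>S. \<Phi> q ` fibre E q \<subseteq> fibre F q" using assms(1) by blast
qed (clarify, rule assms(2))

text \<open>The frames \<open>A\<close> and \<open>A'\<close> are arbitrary, so the coefficient
  matrix \<open>C\<close> is built pointwise from left inverses \<open>B q\<close> of
  \<open>A'\<close>, chosen without any regularity. Holomorphy of \<open>C\<close> follows
  afterwards from the relation \<open>A' C = P A\<close>.\<close>

lemma bundle_map_subbundles:
  assumes P: "hol_matrix P S" and maps: "\<And>q v. q \<in> S \<Longrightarrow> v \<in> F q \<Longrightarrow> \<Phi> q v \<in> F' q"
    and \<Phi>: "\<And>q v. q \<in> S \<Longrightarrow> v \<in> F q \<Longrightarrow> \<Phi> q v = P q *v v"
  shows "bundle_map S (subbundle S F) (subbundle S F') \<Phi>"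
proof (rule bundle_mapI, goal_cases)
  case (1 q)
  then show ?case using maps by (auto simp: subbundle_def)
next
  case (2 V J \<tau> W K \<sigma>)
  obtain A where "open V" and A: "hol_matrix A (S \<inter> V)"
    "\<And>q. q \<in> S \<inter> V \<Longrightarrow> bij_betw ((*v) (A q)) (coord_space J) (F q)"
    "\<And>q x. q \<in> S \<inter> V \<Longrightarrow> x \<in> coord_space J \<Longrightarrow> \<tau> q (A q *v x) = x"
    "\<And>q. q \<in> S \<inter> V \<Longrightarrow> bij_betw (\<tau> q) (F q) (coord_space J)"
    "\<And>q x. q \<in> S \<inter> V \<Longrightarrow> x \<in> coord_space J \<Longrightarrow> inv_into (F q) (\<tau> q) x = A q *v x"
    by (rule subbundle_chart[OF 2(1)]) (rule that)
  obtain A' where "open W" and A': "hol_matrix A' (S \<inter> W)"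
    "\<And>q. q \<in> S \<inter> W \<Longrightarrow> bij_betw ((*v) (A' q)) (coord_space K) (F' q)"
    "\<And>q x. q \<in> S \<inter> W \<Longrightarrow> x \<in> coord_space K \<Longrightarrow> \<sigma> q (A' q *v x) = x"
    "\<And>q. q \<in> S \<inter> W \<Longrightarrow> bij_betw (\<sigma> q) (F' q) (coord_space K)"
    "\<And>q x. q \<in> S \<inter> W \<Longrightarrow> x \<in> coord_space K \<Longrightarrow> inv_into (F' q) (\<sigma> q) x = A' q *v x"
    by (rule subbundle_chart[OF 2(2)]) (rule that)
  let ?X = "S \<inter> V \<inter> W"
  have inj: "inj_on ((*v) (A' q)) (coord_space K)" if "q \<in> ?X" for q
    using A'(2)[of q] that by (auto simp: bij_betw_def)
  have "\<exists>B. (\<forall>x\<in>coord_space K. B *v (A' q *v x) = x) \<and> (\<forall>y. B *v y \<in> coord_space K)" if "q \<in> ?X" for q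
    by (rule left_inverse_matrix[OF inj[OF that]]) blast
  then have "\<exists>B. \<forall>q\<in>?X. (\<forall>x\<in>coord_space K. B q *v (A' q *v x) = x) \<and> (\<forall>y. B q *v y \<in> coord_space K)"
    by (intro bchoice) blast
  then obtain B where B: "\<And>q x. q \<in> ?X \<Longrightarrow> x \<in> coord_space K \<Longrightarrow> B q *v (A' q *v x) = x"
      "\<And>q y. q \<in> ?X \<Longrightarrow> B q *v y \<in> coord_space K" by blast
  define C where "C = (\<lambda>q. B q ** P q ** A q ** coord_matrix J)"
  have A'B: "A' q *v (B q *v y) = y \<and> B q *v y = \<sigma> q y" if q: "q \<in> ?X" and y: "y \<in> F' q" for q y
  proof -
    obtain x where x: "x \<in> coord_space K" "y = A' q *v x"
      using A'(2)[of q] q y by (auto simp: bij_betw_def)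
    then show ?thesis using B(1)[OF q x(1)] A'(3)[of q x] q by simp
  qed
  have PA: "P q *v (A q *v x) \<in> F' q" "\<Phi> q (A q *v x) = P q *v (A q *v x)"
    if q: "q \<in> ?X" and x: "x \<in> coord_space J" for q x
  proof -
    have "A q *v x \<in> F q" using A(2)[of q] q x by (auto simp: bij_betw_def)
    then show "P q *v (A q *v x) \<in> F' q" "\<Phi> q (A q *v x) = P q *v (A q *v x)"
      using maps[of q "A q *v x"] \<Phi>[of q "A q *v x"] q by auto
  qed
  have "hol_matrix C ?X"
  proof (rule frame_coefficients_holomorphic[where A = A' and R = "\<lambda>q. P q ** A q ** coord_matrix J", OF _ _ inj])
    show "hol_matrix A' ?X" by (rule hol_matrix_subset[OF A'(1)]) blast
    show "hol_matrix (\<lambda>q. P q ** A q ** coord_matrix J) ?X"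
      by (intro hol_matrix_mult hol_matrix_const hol_matrix_subset[OF P] hol_matrix_subset[OF A(1)]) auto
    show "C q *v x \<in> coord_space K" if "q \<in> ?X" for q x
      using B(2)[OF that] by (simp add: C_def flip: matrix_vector_mul_assoc)
    show "A' q *v (C q *v x) = P q ** A q ** coord_matrix J *v x" if "q \<in> ?X" for q x
      using A'B[OF that PA(1)[OF that coord_matrix_in], THEN conjunct1] by (simp add: C_def flip: matrix_vector_mul_assoc)
  qed
  moreover have "\<sigma> q (\<Phi> q (inv_into (F q) (\<tau> q) x)) = C q *v x" if q: "q \<in> ?X" and x: "x \<in> coord_space J" for q x
    using A(5)[of q x] q x PA[OF q x] A'B[OF q PA(1)[OF q x]]
    by (simp add: C_def coord_matrix_id flip: matrix_vector_mul_assoc)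
  ultimately show ?case by (auto simp: subbundle_def)
qed

lemma bundle_map_coset:
  assumes E: "\<And>q. q \<in> S \<Longrightarrow> F q = UNIV"
  shows "bundle_map S (subbundle S F) (quotient_bundle S F E) (\<lambda>q. coset (E q))"
proof (rule bundle_mapI, goal_cases)
  case (1 q)
  then show ?case by (auto simp: subbundle_def quotient_bundle_def)
next
  case (2 V J \<tau> W K \<sigma>)
  obtain A where "open V" and A: "hol_matrix A (S \<inter> V)"
    "\<And>q. q \<in> S \<inter> V \<Longrightarrow> bij_betw ((*v) (A q)) (coord_space J) (F q)"
    "\<And>q x. q \<in> S \<inter> V \<Longrightarrow> x \<in> coord_space J \<Longrightarrow> \<tau> q (A q *v x) = x"
    "\<And>q. q \<in> S \<inter> V \<Longrightarrow> bij_betw (\<tau> q) (F q) (coord_space J)"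
    "\<And>q x. q \<in> S \<inter> V \<Longrightarrow> x \<in> coord_space J \<Longrightarrow> inv_into (F q) (\<tau> q) x = A q *v x"
    by (rule subbundle_chart[OF 2(1)]) (rule that)
  obtain A' where "open W" and A': "hol_matrix A' (S \<inter> W)"
    "\<And>q. q \<in> S \<inter> W \<Longrightarrow> range ((*v) (A' q)) = coord_space K"
    "\<And>q. q \<in> S \<inter> W \<Longrightarrow> E q = {v. A' q *v v = 0}"
    "\<And>q v. q \<in> S \<inter> W \<Longrightarrow> \<sigma> q (coset (E q) v) = A' q *v v"
    "\<And>q. q \<in> S \<inter> W \<Longrightarrow> bij_betw (\<sigma> q) (coset (E q) ` F q) (coord_space K)"
    by (rule quotient_chart[OF 2(2) E]) (assumption, rule that)
  have "hol_matrix (\<lambda>q. A' q ** A q) (S \<inter> V \<inter> W)"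
    by (intro hol_matrix_mult hol_matrix_subset[OF A'(1)] hol_matrix_subset[OF A(1)]) auto
  moreover have "\<sigma> q (coset (E q) (inv_into (F q) (\<tau> q) x)) = A' q ** A q *v x"
    if "q \<in> S \<inter> V \<inter> W" "x \<in> coord_space J" for q x
    using A(5)[of q x] A'(4)[of q] that by (simp flip: matrix_vector_mul_assoc)
  ultimately show ?case by (auto simp: subbundle_def)
qed

text \<open>Any two charts come from coframes with the same kernel \<open>E q\<close>, hence one
  factors through the other as \<open>A' = C A\<close>. As \<open>A\<close> is onto,
  \<open>C\<close> is determined on \<open>coord_space J\<close>, and it is holomorphic by the
  result on coframes.\<close>

lemma bundle_map_quotient_id:
  assumes F: "\<And>q. q \<in> S \<Longrightarrow> F q = UNIV"
  shows "bundle_map S (quotient_bundle S F E) (quotient_bundle S F E) (\<lambda>q v. v)"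
proof (rule bundle_mapI, goal_cases)
  case (1 q)
  then show ?case by auto
next
  case (2 V J \<tau> W K \<sigma>)
  obtain A where "open V" and A: "hol_matrix A (S \<inter> V)"
    "\<And>q. q \<in> S \<inter> V \<Longrightarrow> range ((*v) (A q)) = coord_space J"
    "\<And>q. q \<in> S \<inter> V \<Longrightarrow> E q = {v. A q *v v = 0}"
    "\<And>q v. q \<in> S \<inter> V \<Longrightarrow> \<tau> q (coset (E q) v) = A q *v v"
    "\<And>q. q \<in> S \<inter> V \<Longrightarrow> bij_betw (\<tau> q) (coset (E q) ` F q) (coord_space J)"
    by (rule quotient_chart[OF 2(1) F]) (assumption, rule that)
  obtain A' where "open W" and A': "hol_matrix A' (S \<inter> W)"
    "\<And>q. q \<in> S \<inter> W \<Longrightarrow> range ((*v) (A' q)) = coord_space K"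
    "\<And>q. q \<in> S \<inter> W \<Longrightarrow> E q = {v. A' q *v v = 0}"
    "\<And>q v. q \<in> S \<inter> W \<Longrightarrow> \<sigma> q (coset (E q) v) = A' q *v v"
    "\<And>q. q \<in> S \<inter> W \<Longrightarrow> bij_betw (\<sigma> q) (coset (E q) ` F q) (coord_space K)"
    by (rule quotient_chart[OF 2(2) F]) (assumption, rule that)
  let ?X = "S \<inter> V \<inter> W"
  have "\<exists>B. \<forall>x\<in>coord_space J. A q *v (B *v x) = x" if "q \<in> ?X" for q
  proof -
    obtain B where "\<And>x. x \<in> range ((*v) (A q)) \<Longrightarrow> A q *v (B *v x) = x"
      by (rule right_inverse_matrix) (rule that)
    then show ?thesis using A(2)[of q] that by auto
  qed
  then have "\<exists>B. \<forall>q\<in>?X. \<forall>x\<in>coord_space J. A q *v (B q *v x) = x" by (intro bchoice) blast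
  then obtain B where B: "\<And>q x. q \<in> ?X \<Longrightarrow> x \<in> coord_space J \<Longrightarrow> A q *v (B q *v x) = x" by blast
  define C where "C = (\<lambda>q. A' q ** B q ** coord_matrix J)"
  have CA: "A' q *v v = C q *v (A q *v v)" if q: "q \<in> ?X" for q v
  proof -
    have AJ: "A q *v v \<in> coord_space J" using A(2)[of q] q by blast
    then have "A q *v (v - B q *v (A q *v v)) = 0"
      using B[OF q AJ] by (simp add: matrix_vector_mult_diff_distrib)
    then have "v - B q *v (A q *v v) \<in> E q" using A(3)[of q] q by simp
    then have "A' q *v (v - B q *v (A q *v v)) = 0" using A'(3)[of q] q by simp
    then show ?thesis using AJ
      by (simp add: C_def matrix_vector_mult_diff_distrib coord_matrix_id flip: matrix_vector_mul_assoc)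
  qed
  have "hol_matrix C ?X"
  proof (rule coframe_coefficients_holomorphic[where A = A and R = A' and J = J])
    show "hol_matrix A ?X" by (rule hol_matrix_subset[OF A(1)]) blast
    show "hol_matrix A' ?X" by (rule hol_matrix_subset[OF A'(1)]) blast
    show "range ((*v) (A q)) = coord_space J" if "q \<in> ?X" for q by (rule A(2)) (use that in blast)
    show "C q *v x = C q *v (coord_matrix J *v x)" for q x
      by (simp add: C_def coord_matrix_id flip: matrix_vector_mul_assoc)
  qed (use CA in simp)
  moreover have "\<sigma> q (inv_into (coset (E q) ` F q) (\<tau> q) x) = C q *v x" if q: "q \<in> ?X" and x: "x \<in> coord_space J" for q x
  proof -
    have "x \<in> range ((*v) (A q))" using A(2)[of q] q x by simp
    then obtain v where v: "x = A q *v v" by blast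
    have "inv_into (coset (E q) ` F q) (\<tau> q) x = coset (E q) v"
    proof (rule inv_into_f_eq)
      show "inj_on (\<tau> q) (coset (E q) ` F q)" using A(5)[of q] q by (simp add: bij_betw_def)
      show "coset (E q) v \<in> coset (E q) ` F q" using F[of q] q by simp
      show "\<tau> q (coset (E q) v) = x" using A(4)[of q v] q v by simp
    qed
    then show ?thesis using A'(4)[of q v] q CA[OF q, of v] v by simp
  qed
  ultimately show ?case by (auto simp: quotient_bundle_def)
qed

section \<open>Bundles defined by holomorphic projections\<close>

text \<open>
  For projections \<open>P\<close> and \<open>P0\<close> close to each other, \<open>P P0 + (1 - P)(1 - P0)\<close> is invertible; it maps the
  range and the kernel of \<open>P0\<close> onto those of \<open>P\<close>.
\<close>

definition intertwiner :: "complex^'n^'n \<Rightarrow> complex^'n^'n \<Rightarrow> complex^'n^'n::finite" where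
  "intertwiner P P0 = P ** P0 + (mat 1 - P) ** (mat 1 - P0)"

lemma intertwiner_mult:
  "intertwiner P P0 *v x = P *v (P0 *v x) + ((x - P0 *v x) - P *v (x - P0 *v x))"
  by (simp add: intertwiner_def matrix_vector_mult_add_rdistrib matrix_vector_mult_diff_rdistrib
      matrix_vector_mult_diff_distrib flip: matrix_vector_mul_assoc)

lemma intertwiner_refl: "P ** P = P \<Longrightarrow> intertwiner P P = mat 1"
  by (rule matrix_id_if) (simp add: intertwiner_mult matrix_vector_mult_diff_distrib matrix_vector_mul_assoc)

text \<open>The intertwiner \<open>E\<close> satisfies \<open>P E = P P0 = E P0\<close>. Since
  \<open>E\<close> is onto, the range of \<open>P\<close> is the range of
  \<open>P E = E P0\<close>.\<close>

lemma intertwiner_bij: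
  assumes P: "P ** P = P" "P0 ** P0 = P0" and nz: "det (intertwiner P P0) \<noteq> 0"
  shows "bij_betw ((*v) (intertwiner P P0)) (range ((*v) P0)) (range ((*v) P))"
proof -
  let ?E = "intertwiner P P0"
  have PP: "P *v (P *v x) = P *v x" "P0 *v (P0 *v x) = P0 *v x" for x
    using P by (simp_all add: matrix_vector_mul_assoc)
  have inv: "invertible ?E" using nz by (simp add: invertible_det_nz)
  then have inj: "inj ((*v) ?E)" by (simp add: inj_matrix_vector_mult)
  have surj: "surj ((*v) ?E)" using inv by (metis invertible_def matrix_right_invertible_surjective)
  have PE: "P *v (?E *v x) = P *v (P0 *v x)" for x
  proof -
    define y where "y = x - P0 *v x"
    have "P *v (?E *v x) = P *v (P *v (P0 *v x)) + (P *v y - P *v (P *v y))"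
      unfolding intertwiner_mult[of P P0 x, folded y_def]
      by (simp only: matrix_vector_right_distrib matrix_vector_mult_diff_distrib)
    then show ?thesis by (simp add: PP)
  qed
  have EP: "?E *v (P0 *v x) = P *v (P0 *v x)" for x
    by (simp add: intertwiner_mult PP)
  show ?thesis unfolding bij_betw_def
  proof
    show "inj_on ((*v) ?E) (range ((*v) P0))" using inj inj_on_subset by blast
    show "(*v) ?E ` range ((*v) P0) = range ((*v) P)"
    proof
      show "(*v) ?E ` range ((*v) P0) \<subseteq> range ((*v) P)" using EP by auto
      show "range ((*v) P) \<subseteq> (*v) ?E ` range ((*v) P0)"
      proof clarify
        fix y
        obtain x where "y = ?E *v x" using surj by blast
        then have "P *v y = ?E *v (P0 *v x)" using PE EP by simp
        then show "P *v y \<in> (*v) ?E ` range ((*v) P0)" by blast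
      qed
    qed
  qed
qed

lemma hol_matrix_intertwiner:
  "hol_matrix P S \<Longrightarrow> hol_matrix (\<lambda>q. intertwiner (P q) P0) S"
  "hol_matrix P S \<Longrightarrow> hol_matrix (\<lambda>q. intertwiner P0 (P q)) S"
  unfolding intertwiner_def by (intro hol_matrix_add hol_matrix_mult hol_matrix_diff hol_matrix_const; assumption)+

lemma complement_idempotent:
  "P ** P = P \<Longrightarrow> (mat 1 - P) ** (mat 1 - P) = mat 1 - (P :: complex^'n::finite^'n)"
  by (simp add: matrix_eq matrix_vector_mult_diff_rdistrib matrix_vector_mult_diff_distrib
      flip: matrix_vector_mul_assoc)

lemma range_complement:
  fixes P :: "complex^'n::finite^'n"
  assumes "P ** P = P"
  shows "range ((*v) (mat 1 - P)) = {v. P *v v = 0}"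
proof -
  have PP: "P *v (P *v x) = P *v x" for x using assms by (simp add: matrix_vector_mul_assoc)
  show ?thesis
  proof (intro set_eqI iffI)
    fix v assume "v \<in> range ((*v) (mat 1 - P))"
    then show "v \<in> {v. P *v v = 0}"
      by (auto simp: matrix_vector_mult_diff_rdistrib matrix_vector_mult_diff_distrib PP)
  next
    fix v assume "v \<in> {v. P *v v = 0}"
    then have "v = (mat 1 - P) *v v" by (simp add: matrix_vector_mult_diff_rdistrib)
    then show "v \<in> range ((*v) (mat 1 - P))" by (rule range_eqI)
  qed
qed

lemma subspace_range: "vec.subspace (range ((*v) (A :: complex^'n::finite^'m::finite)))"
  by (rule vec.subspace_image[OF vec.subspace_UNIV])

text \<open>A fixed basis of the fibre over \<open>q0\<close>, transported by the intertwiner, is a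
  holomorphic frame wherever the determinant is nonzero.\<close>

lemma range_subbundle_chart:
  assumes P: "hol_matrix P S" "\<And>q. q \<in> S \<Longrightarrow> P q ** P q = P q" and F: "\<And>q. q \<in> S \<Longrightarrow> F q = range ((*v) (P q))"
    and q0: "q0 \<in> S"
  obtains V J \<tau> where "(V, J, \<tau>) \<in> charts (subbundle S F)" "q0 \<in> V"
proof -
  have E: "hol_matrix (\<lambda>q. intertwiner (P q) (P q0)) S" by (rule hol_matrix_intertwiner(1)[OF P(1)])
  obtain V where V: "open V" "S \<inter> V = {q \<in> S. det (intertwiner (P q) (P q0)) \<noteq> 0}"
    using det_nonzero_nearby[OF E] .
  obtain J and B :: "complex^'a^'a" where B: "bij_betw ((*v) B) (coord_space J) (range ((*v) (P q0)))"
    using subspace_coordinates[OF subspace_range] .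
  define A where "A = (\<lambda>q. intertwiner (P q) (P q0) ** B)"
  have A: "hol_matrix A (S \<inter> V)"
    unfolding A_def by (intro hol_matrix_mult hol_matrix_const hol_matrix_subset[OF E]) auto
  have bij: "bij_betw ((*v) (A q)) (coord_space J) (F q)" if q: "q \<in> S \<inter> V" for q
  proof -
    have qS: "q \<in> S" and nz: "det (intertwiner (P q) (P q0)) \<noteq> 0" using q V(2) by auto
    have "bij_betw ((*v) (intertwiner (P q) (P q0)) \<circ> (*v) B) (coord_space J) (range ((*v) (P q)))"
      by (rule bij_betw_trans[OF B intertwiner_bij[OF P(2)[OF qS] P(2)[OF q0] nz]])
    moreover have "(*v) (intertwiner (P q) (P q0)) \<circ> (*v) B = (*v) (A q)"
      by (simp add: A_def fun_eq_iff matrix_vector_mul_assoc)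
    ultimately show ?thesis using F[OF qS] by simp
  qed
  have "(V, J, \<lambda>q. inv_into (coord_space J) ((*v) (A q))) \<in> charts (subbundle S F)"
    unfolding subbundle_def using V(1) A bij by (auto simp: bij_betw_def intro!: exI[of _ A])
  moreover have "q0 \<in> S \<inter> V" unfolding V(2) using q0 by (simp add: intertwiner_refl[OF P(2)[OF q0]])
  ultimately show thesis using that by blast
qed

text \<open>The quotient by the range of \<open>P\<close> is modelled on the range of
  \<open>1 - P\<close>. A coframe must carry the fibre over \<open>q\<close> to the one over
  \<open>q0\<close>, so the intertwiner appears with its arguments exchanged.\<close>

lemma range_quotient_chart:
  assumes P: "hol_matrix P S" "\<And>q. q \<in> S \<Longrightarrow> P q ** P q = P q" and E: "\<And>q. q \<in> S \<Longrightarrow> E q = range ((*v) (P q))"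
    and F: "\<And>q. q \<in> S \<Longrightarrow> F q = UNIV" and q0: "q0 \<in> S"
  obtains V J \<tau> where "(V, J, \<tau>) \<in> charts (quotient_bundle S F E)" "q0 \<in> V"
proof -
  let ?Q = "\<lambda>q. mat 1 - P q"
  have Q: "hol_matrix ?Q S" by (intro hol_matrix_diff hol_matrix_const P)
  have Q2: "?Q q ** ?Q q = ?Q q" if "q \<in> S" for q by (rule complement_idempotent[OF P(2)[OF that]])
  have I: "hol_matrix (\<lambda>q. intertwiner (?Q q0) (?Q q)) S" by (rule hol_matrix_intertwiner(2)[OF Q])
  obtain V where V: "open V" "S \<inter> V = {q \<in> S. det (intertwiner (?Q q0) (?Q q)) \<noteq> 0}"
    using det_nonzero_nearby[OF I] .
  obtain J and B :: "complex^'a^'a" where B: "bij_betw ((*v) B) (coord_space J) (range ((*v) (?Q q0)))"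
    using subspace_coordinates[OF subspace_range] .
  have "inj_on ((*v) B) (coord_space J)" using B by (simp add: bij_betw_def)
  then obtain L where L: "\<And>x. x \<in> coord_space J \<Longrightarrow> L *v (B *v x) = x" and "\<And>y. L *v y \<in> coord_space J"
    by (rule left_inverse_matrix) (rule that)
  define A where "A = (\<lambda>q. L ** (?Q q0 ** ?Q q))"
  have A: "hol_matrix A (S \<inter> V)"
    unfolding A_def by (intro hol_matrix_mult hol_matrix_const hol_matrix_subset[OF Q]) auto
  have props: "range ((*v) (A q)) = coord_space J \<and> E q = {v. A q *v v = 0}" if q: "q \<in> S \<inter> V" for q
  proof -
    have qS: "q \<in> S" and nz: "det (intertwiner (?Q q0) (?Q q)) \<noteq> 0" using q V(2) by auto
    have bij: "bij_betw ((*v) (intertwiner (?Q q0) (?Q q))) (range ((*v) (?Q q))) (range ((*v) (?Q q0)))"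
      by (rule intertwiner_bij[OF Q2[OF q0] Q2[OF qS] nz])
    have eq: "intertwiner (?Q q0) (?Q q) *v (?Q q *v v) = ?Q q0 *v (?Q q *v v)" for v
    proof -
      have "?Q q *v (?Q q *v v) = ?Q q *v v" unfolding matrix_vector_mul_assoc Q2[OF qS] ..
      then show ?thesis by (simp only: intertwiner_mult) simp
    qed
    have Lbij: "bij_betw ((*v) L) (range ((*v) (?Q q0))) (coord_space J)"
    proof -
      have r: "range ((*v) (?Q q0)) = (*v) B ` coord_space J" using B by (simp add: bij_betw_def)
      show ?thesis unfolding r
        by (rule bij_betw_byWitness[where f' = "(*v) B"]) (use L in auto)
    qed
    have comp: "bij_betw ((*v) L \<circ> (*v) (intertwiner (?Q q0) (?Q q))) (range ((*v) (?Q q))) (coord_space J)"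
      by (rule bij_betw_trans[OF bij Lbij])
    have Aq: "A q *v v = ((*v) L \<circ> (*v) (intertwiner (?Q q0) (?Q q))) (?Q q *v v)" for v
      unfolding A_def o_def eq by (simp only: matrix_vector_mul_assoc matrix_mul_assoc)
    have "range ((*v) (A q)) = ((*v) L \<circ> (*v) (intertwiner (?Q q0) (?Q q))) ` range ((*v) (?Q q))"
      unfolding image_image by (rule image_cong[OF refl Aq])
    then have 1: "range ((*v) (A q)) = coord_space J" using comp by (simp add: bij_betw_def)
    have "A q *v v = 0 \<longleftrightarrow> ?Q q *v v = 0" for v
    proof
      assume "A q *v v = 0"
      then have "((*v) L \<circ> (*v) (intertwiner (?Q q0) (?Q q))) (?Q q *v v) =
          ((*v) L \<circ> (*v) (intertwiner (?Q q0) (?Q q))) (?Q q *v 0)"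
        unfolding Aq[symmetric] by simp
      then have "?Q q *v v = ?Q q *v 0"
        using comp unfolding bij_betw_def by (elim conjE) (erule inj_onD; blast)
      then show "?Q q *v v = 0" by simp
    qed (simp add: A_def flip: matrix_vector_mul_assoc)
    moreover have "range ((*v) (P q)) = {v. ?Q q *v v = 0}"
      using range_complement[OF Q2[OF qS]] by simp
    ultimately show ?thesis using 1 E[OF qS] by simp
  qed
  \<comment> \<open>Any representative of the coset gives the same value, because \<open>A q\<close>
    vanishes on \<open>E q\<close>.\<close>
  define \<tau> where "\<tau> = (\<lambda>q c. A q *v (SOME v. v \<in> c))"
  have "\<tau> q (coset (E q) v) = A q *v v" if q: "q \<in> S \<inter> V" for q v
  proof -
    have "v \<in> coset (E q) v" using props[OF q] by (auto simp: coset_def intro!: exI[of _ 0])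
    then have "(SOME w. w \<in> coset (E q) v) \<in> coset (E q) v" by (rule someI)
    then obtain e where "(SOME w. w \<in> coset (E q) v) = v + e" "A q *v e = 0"
      using props[OF q] by (auto simp: coset_def)
    then show ?thesis by (simp add: \<tau>_def matrix_vector_right_distrib)
  qed
  then have "\<forall>q\<in>S \<inter> V. (\<lambda>v. A q *v v) ` F q = coord_space J \<and>
      E q = {v \<in> F q. A q *v v = 0} \<and> (\<forall>v\<in>F q. \<tau> q (coset (E q) v) = A q *v v)"
    using props F by auto
  then have "(V, J, \<tau>) \<in> charts (quotient_bundle S F E)"
    unfolding quotient_bundle_def hvb.select_convs mem_Collect_eq prod.case using V(1) A by blast
  moreover have "q0 \<in> S \<inter> V" unfolding V(2) using q0 by (simp add: intertwiner_refl[OF Q2[OF q0]])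
  ultimately show thesis using that by blast
qed

lemma range_subbundle:
  assumes P: "hol_matrix P S" "\<And>q. q \<in> S \<Longrightarrow> P q ** P q = P q" and F: "\<And>q. q \<in> S \<Longrightarrow> F q = range ((*v) (P q))"
  shows "hol_vector_bundle S (subbundle S F)"
  unfolding hol_vector_bundle_def
proof (intro conjI)
  have "open V \<and> (\<forall>q\<in>S \<inter> V. bij_betw (\<tau> q) (F q) (coord_space J))"
    if "(V, J, \<tau>) \<in> charts (subbundle S F)" for V J \<tau>
    by (rule subbundle_chart[OF that]) blast
  then show "\<forall>(V, J, \<tau>)\<in>charts (subbundle S F). open V \<and>
      (\<forall>q\<in>S \<inter> V. bij_betw (\<tau> q) (fibre (subbundle S F) q) (coord_space J))"
    by (auto simp: subbundle_def)
  show "S \<subseteq> (\<Union>(V, J, \<tau>)\<in>charts (subbundle S F). V)"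
  proof
    fix q assume q: "q \<in> S"
    obtain V J \<tau> where "(V, J, \<tau>) \<in> charts (subbundle S F)" "q \<in> V"
      using range_subbundle_chart[OF P F q] by blast
    then show "q \<in> (\<Union>(V, J, \<tau>)\<in>charts (subbundle S F). V)" by blast
  qed
  show "bundle_map S (subbundle S F) (subbundle S F) (\<lambda>q v. v)"
    by (rule bundle_map_subbundles[where P = "\<lambda>q. mat 1"]) (auto intro: hol_matrix_const)
qed

lemma quotient_by_range:
  assumes P: "hol_matrix P S" "\<And>q. q \<in> S \<Longrightarrow> P q ** P q = P q" and E: "\<And>q. q \<in> S \<Longrightarrow> E q = range ((*v) (P q))"
    and F: "\<And>q. q \<in> S \<Longrightarrow> F q = UNIV"
  shows "hol_vector_bundle S (quotient_bundle S F E)"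
  unfolding hol_vector_bundle_def
proof (intro conjI)
  have "open V \<and> (\<forall>q\<in>S \<inter> V. bij_betw (\<tau> q) (coset (E q) ` F q) (coord_space J))"
    if "(V, J, \<tau>) \<in> charts (quotient_bundle S F E)" for V J \<tau>
    by (rule quotient_chart[OF that F]) blast+
  then show "\<forall>(V, J, \<tau>)\<in>charts (quotient_bundle S F E). open V \<and>
      (\<forall>q\<in>S \<inter> V. bij_betw (\<tau> q) (fibre (quotient_bundle S F E) q) (coord_space J))"
    by (auto simp: quotient_bundle_def)
  show "S \<subseteq> (\<Union>(V, J, \<tau>)\<in>charts (quotient_bundle S F E). V)"
  proof
    fix q assume q: "q \<in> S"
    obtain V J \<tau> where "(V, J, \<tau>) \<in> charts (quotient_bundle S F E)" "q \<in> V"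
      by (rule range_quotient_chart[where P = P and S = S and E = E and F = F, OF P E F q]) (assumption, assumption, assumption, rule that)
    then show "q \<in> (\<Union>(V, J, \<tau>)\<in>charts (quotient_bundle S F E). V)" by blast
  qed
  show "bundle_map S (quotient_bundle S F E) (quotient_bundle S F E) (\<lambda>q v. v)"
    by (rule bundle_map_quotient_id[OF F])
qed

text \<open>The zero of a fibre is defined by the charts. That it is the zero vector requires at
  least one chart around \<open>q\<close>, which the projection provides.\<close>

lemma fibre_zero_subbundle:
  assumes P: "hol_matrix P S" "\<And>q. q \<in> S \<Longrightarrow> P q ** P q = P q" and F: "\<And>q. q \<in> S \<Longrightarrow> F q = range ((*v) (P q))"
    and q: "q \<in> S"
  shows "fibre_zero (subbundle S F) q v \<longleftrightarrow> v = 0"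
proof
  assume z: "fibre_zero (subbundle S F) q v"
  obtain V J \<tau> where c: "(V, J, \<tau>) \<in> charts (subbundle S F)" "q \<in> V"
    using range_subbundle_chart[OF P F q] by blast
  obtain A where "open V" "hol_matrix A (S \<inter> V)"
    and A: "\<And>q. q \<in> S \<inter> V \<Longrightarrow> bij_betw ((*v) (A q)) (coord_space J) (F q)"
      "\<And>q x. q \<in> S \<inter> V \<Longrightarrow> x \<in> coord_space J \<Longrightarrow> \<tau> q (A q *v x) = x"
      "\<And>q. q \<in> S \<inter> V \<Longrightarrow> bij_betw (\<tau> q) (F q) (coord_space J)"
      "\<And>q x. q \<in> S \<inter> V \<Longrightarrow> x \<in> coord_space J \<Longrightarrow> inv_into (F q) (\<tau> q) x = A q *v x"
    by (rule subbundle_chart[OF c(1)]) (rule that)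
  have "\<tau> q v = 0" "v \<in> F q" using z c by (auto simp: fibre_zero_def subbundle_def)
  moreover obtain x where "x \<in> coord_space J" "v = A q *v x"
    using A(1)[of q] q c(2) \<open>v \<in> F q\<close> by (auto simp: bij_betw_def)
  ultimately show "v = 0" using A(2)[of q x] q c(2) by simp
next
  assume v: "v = 0"
  have "\<tau> q 0 = 0" if c: "(V, J, \<tau>) \<in> charts (subbundle S F)" "q \<in> V" for V J \<tau>
  proof -
    obtain A where "open V" "hol_matrix A (S \<inter> V)"
      and A: "\<And>q. q \<in> S \<inter> V \<Longrightarrow> bij_betw ((*v) (A q)) (coord_space J) (F q)"
        "\<And>q x. q \<in> S \<inter> V \<Longrightarrow> x \<in> coord_space J \<Longrightarrow> \<tau> q (A q *v x) = x"
        "\<And>q. q \<in> S \<inter> V \<Longrightarrow> bij_betw (\<tau> q) (F q) (coord_space J)"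
        "\<And>q x. q \<in> S \<inter> V \<Longrightarrow> x \<in> coord_space J \<Longrightarrow> inv_into (F q) (\<tau> q) x = A q *v x"
      by (rule subbundle_chart[OF c(1)]) (rule that)
    show ?thesis using A(2)[of q 0] q c(2) by simp
  qed
  moreover have "0 \<in> F q" using F[OF q] vec.subspace_0[OF subspace_range] by blast
  ultimately show "fibre_zero (subbundle S F) q v" using v by (auto simp: fibre_zero_def subbundle_def)
qed

lemma fibre_zero_quotient:
  assumes P: "hol_matrix P S" "\<And>q. q \<in> S \<Longrightarrow> P q ** P q = P q" and E: "\<And>q. q \<in> S \<Longrightarrow> E q = range ((*v) (P q))"
    and F: "\<And>q. q \<in> S \<Longrightarrow> F q = UNIV" and q: "q \<in> S"
  shows "fibre_zero (quotient_bundle S F E) q (coset (E q) v) \<longleftrightarrow> v \<in> E q"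
proof -
  have key: "\<tau> q (coset (E q) v) = 0 \<longleftrightarrow> v \<in> E q"
    if c: "(V, J, \<tau>) \<in> charts (quotient_bundle S F E)" "q \<in> V" for V J \<tau>
  proof -
    obtain A where "open V" "hol_matrix A (S \<inter> V)"
      and A: "\<And>q. q \<in> S \<inter> V \<Longrightarrow> range ((*v) (A q)) = coord_space J"
        "\<And>q. q \<in> S \<inter> V \<Longrightarrow> E q = {v. A q *v v = 0}"
        "\<And>q v. q \<in> S \<inter> V \<Longrightarrow> \<tau> q (coset (E q) v) = A q *v v"
        "\<And>q. q \<in> S \<inter> V \<Longrightarrow> bij_betw (\<tau> q) (coset (E q) ` F q) (coord_space J)"
      by (rule quotient_chart[OF c(1) F]) (assumption, rule that)
    show ?thesis using A(2)[of q] A(3)[of q v] q c(2) by simp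
  qed
  obtain V J \<tau> where "(V, J, \<tau>) \<in> charts (quotient_bundle S F E)" "q \<in> V"
    by (rule range_quotient_chart[where P = P and S = S and E = E and F = F, OF P E F q]) (assumption, assumption, assumption, rule that)
  moreover have "coset (E q) v \<in> fibre (quotient_bundle S F E) q"
    using F[OF q] by (simp add: quotient_bundle_def)
  ultimately show ?thesis unfolding fibre_zero_def using key by blast
qed

lemma fibre_subbundle: "fibre (subbundle S F) = F"
  by (simp add: subbundle_def)

text \<open>One map serves both sequences: \<open>P q\<close> is the identity on the tangent space,
  hence a left inverse of the inclusion, whichever model of the quotient is used. The complement
  \<open>1 - P q\<close> is the projection along the tangent space.\<close>

lemma projection_splittings:
  assumes P: "hol_matrix P S" "\<And>q. q \<in> S \<Longrightarrow> P q ** P q = P q"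
    and T: "\<And>q. q \<in> S \<Longrightarrow> tangent_space S q = range ((*v) (P q))"
    and \<Omega>: "\<And>q. q \<in> S \<Longrightarrow> tangent_space \<Omega> q = UNIV"
    and k: "\<And>q. q \<in> S \<Longrightarrow> kernel_of_differential \<Omega> \<pi> q = {v. P q *v v = 0}"
  shows "holomorphic_splitting \<Omega> S \<pi>" "tangent_sequence_splits \<Omega> S"
proof -
  let ?Q = "\<lambda>q. mat 1 - P q"
  let ?K = "kernel_of_differential \<Omega> \<pi>"
  have Q: "hol_matrix ?Q S" by (intro hol_matrix_diff hol_matrix_const P)
  have Q2: "?Q q ** ?Q q = ?Q q" if "q \<in> S" for q by (rule complement_idempotent[OF P(2)[OF that]])
  have K: "?K q = range ((*v) (?Q q))" if "q \<in> S" for q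
    using range_complement[OF P(2)[OF that]] k[OF that] by simp
  have I: "tangent_space \<Omega> q = range ((*v) (mat 1))" if "q \<in> S" for q using \<Omega>[OF that] by simp
  have PP: "P q *v (P q *v x) = P q *v x" if "q \<in> S" for q x using P(2)[OF that] by (simp add: matrix_vector_mul_assoc)
  have PT: "v \<in> tangent_space S q \<longleftrightarrow> P q *v v = v" if "q \<in> S" for q v
  proof
    assume "v \<in> tangent_space S q"
    then show "P q *v v = v" unfolding T[OF that] using PP[OF that] by auto
  next
    assume "P q *v v = v"
    then show "v \<in> tangent_space S q" unfolding T[OF that] by (metis rangeI)
  qed
  have hT: "hol_vector_bundle S (subbundle S (tangent_space S))" by (rule range_subbundle[OF P T])
  have hK: "hol_vector_bundle S (subbundle S ?K)" by (rule range_subbundle[OF Q Q2 K])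
  have h\<Omega>: "hol_vector_bundle S (subbundle S (tangent_space \<Omega>))"
    by (rule range_subbundle[where P = "\<lambda>q. mat 1", OF hol_matrix_const _ I]) simp_all
  have hN: "hol_vector_bundle S (quotient_bundle S (tangent_space \<Omega>) (tangent_space S))"
    by (rule quotient_by_range[OF P T \<Omega>])
  have inc: "bundle_map S (subbundle S (tangent_space S)) (subbundle S (tangent_space \<Omega>)) (\<lambda>q v. v)"
    by (rule bundle_map_subbundles[where P = "\<lambda>q. mat 1"]) (auto intro: hol_matrix_const simp: \<Omega>)
  have proj: "projection_along (tangent_space S q) (?K q) v = ?Q q *v v" if q: "q \<in> S" for q v
    unfolding projection_along_def
  proof (rule the_equality)
    show "?Q q *v v \<in> ?K q \<and> v - ?Q q *v v \<in> tangent_space S q"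
      by (simp add: k[OF q] PT[OF q] matrix_vector_mult_diff_rdistrib matrix_vector_mult_diff_distrib PP[OF q])
    fix y assume "y \<in> ?K q \<and> v - y \<in> tangent_space S q"
    then have "P q *v y = 0" "P q *v (v - y) = v - y" by (simp_all add: k[OF q] PT[OF q])
    then show "y = ?Q q *v v" by (simp add: matrix_vector_mult_diff_rdistrib matrix_vector_mult_diff_distrib)
  qed
  have pr: "bundle_map S (subbundle S (tangent_space \<Omega>)) (subbundle S ?K)
      (\<lambda>q. projection_along (tangent_space S q) (?K q))"
  proof (rule bundle_map_subbundles[OF Q])
    fix q v assume q: "q \<in> S"
    show "projection_along (tangent_space S q) (?K q) v = ?Q q *v v" by (rule proj[OF q])
    then show "projection_along (tangent_space S q) (?K q) v \<in> ?K q" unfolding K[OF q] by simp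
  qed
  have retr: "bundle_map S (subbundle S (tangent_space \<Omega>)) (subbundle S (tangent_space S)) (\<lambda>q v. P q *v v)"
    by (rule bundle_map_subbundles[OF P(1)]) (auto simp: T)
  have retr_id: "\<forall>q\<in>S. \<forall>v\<in>fibre (subbundle S (tangent_space S)) q. P q *v v = v"
    using PT by (auto simp: subbundle_def)
  have "short_exact S (subbundle S (tangent_space S)) (\<lambda>q v. v) (subbundle S (tangent_space \<Omega>))
       (\<lambda>q. projection_along (tangent_space S q) (?K q)) (subbundle S ?K)"
    unfolding short_exact_def
  proof (intro conjI hT h\<Omega> hK inc pr ballI)
    fix q assume q: "q \<in> S"
    show "projection_along (tangent_space S q) (?K q) ` fibre (subbundle S (tangent_space \<Omega>)) q = fibre (subbundle S ?K) q"
      using proj[OF q] K[OF q] \<Omega>[OF q] by (simp add: subbundle_def)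
    show "(\<lambda>v. v) ` fibre (subbundle S (tangent_space S)) q = {v \<in> fibre (subbundle S (tangent_space \<Omega>)) q.
        fibre_zero (subbundle S ?K) q (projection_along (tangent_space S q) (?K q) v)}"
    proof -
      have "fibre_zero (subbundle S ?K) q y \<longleftrightarrow> y = 0" for y
        by (rule fibre_zero_subbundle[OF Q _ _ q]) (use Q2 K in auto)
      then show ?thesis unfolding proj[OF q]
        using PT[OF q] \<Omega>[OF q] by (auto simp: fibre_subbundle matrix_vector_mult_diff_rdistrib)
    qed
  qed simp
  then have "splits_holomorphically S (subbundle S (tangent_space S)) (\<lambda>q v. v) (subbundle S (tangent_space \<Omega>))
       (\<lambda>q. projection_along (tangent_space S q) (?K q)) (subbundle S ?K)"
    unfolding splits_holomorphically_def using retr retr_id by blast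
  moreover have "direct_sum (tangent_space \<Omega> q) (tangent_space S q) (?K q)" if q: "q \<in> S" for q
    unfolding direct_sum_def
  proof (intro conjI)
    show "vec.subspace (tangent_space S q)" "vec.subspace (?K q)"
      unfolding T[OF q] K[OF q] by (rule subspace_range)+
    have "\<exists>x y. v = x + y \<and> x \<in> tangent_space S q \<and> y \<in> ?K q" for v
      by (rule exI[of _ "P q *v v"], rule exI[of _ "?Q q *v v"])
        (simp add: T[OF q] K[OF q] matrix_vector_mult_diff_rdistrib)
    then show "tangent_space \<Omega> q = {x + y | x y. x \<in> tangent_space S q \<and> y \<in> ?K q}"
      unfolding \<Omega>[OF q] by blast
    show "tangent_space S q \<inter> ?K q = {0}"
      by (rule set_eqI) (auto simp: PT[OF q] k[OF q])
  qed
  ultimately show "holomorphic_splitting \<Omega> S \<pi>" unfolding holomorphic_splitting_def by blast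
  have "short_exact S (subbundle S (tangent_space S)) (\<lambda>q v. v) (subbundle S (tangent_space \<Omega>))
       (\<lambda>q. coset (tangent_space S q)) (quotient_bundle S (tangent_space \<Omega>) (tangent_space S))"
    unfolding short_exact_def
  proof (intro conjI hT h\<Omega> hN inc bundle_map_coset[OF \<Omega>] ballI)
    fix q assume q: "q \<in> S"
    show "(\<lambda>v. v) ` fibre (subbundle S (tangent_space S)) q = {v \<in> fibre (subbundle S (tangent_space \<Omega>)) q.
        fibre_zero (quotient_bundle S (tangent_space \<Omega>) (tangent_space S)) q (coset (tangent_space S q) v)}"
    proof -
      have "fibre_zero (quotient_bundle S (tangent_space \<Omega>) (tangent_space S)) q (coset (tangent_space S q) y) \<longleftrightarrow>
          y \<in> tangent_space S q" for y
        by (rule fibre_zero_quotient[OF P(1) _ _ _ q]) (use P(2) T \<Omega> in auto)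
      then show ?thesis using \<Omega>[OF q] by (auto simp: fibre_subbundle)
    qed
  qed (simp_all add: subbundle_def quotient_bundle_def)
  then show "tangent_sequence_splits \<Omega> S"
    unfolding tangent_sequence_splits_def splits_holomorphically_def using retr retr_id by blast
qed

section \<open>Retractions and domains of holomorphy\<close>

definition cjacobian :: "(complex^'n::finite \<Rightarrow> complex^'m::finite) \<Rightarrow> complex^'n \<Rightarrow> complex^'n^'m" where
  "cjacobian F z = matrix (frechet_derivative F (at z))"

lemma cjacobian_works:
  assumes F: "hol_map F X" "open X" "z \<in> X"
  shows "frechet_derivative F (at z) v = cjacobian F z *v v" "(F has_derivative (*v) (cjacobian F z)) (at z)"
proof -
  have lin: "linear (frechet_derivative F (at z))"
    using hol_map_has_derivative(1)[OF F] by (rule has_derivative_linear)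
  have "Vector_Spaces.linear (*s) (*s) (frechet_derivative F (at z))"
    by (rule Vector_Spaces.linear.intro, unfold_locales)
      (auto simp: linear_add[OF lin] hol_map_has_derivative(2)[OF F])
  then show 1: "frechet_derivative F (at z) v = cjacobian F z *v v" for v
    unfolding cjacobian_def by (rule matrix_works[symmetric])
  then have "frechet_derivative F (at z) = (*v) (cjacobian F z)" by (simp add: fun_eq_iff)
  then show "(F has_derivative (*v) (cjacobian F z)) (at z)" using hol_map_has_derivative(1)[OF F] by simp
qed

lemma cjacobian_unique:
  assumes "hol_map F X" "open X" "z \<in> X" "(F has_derivative (*v) A) (at z)"
  shows "cjacobian F z = A"
proof -
  have "(*v) (cjacobian F z) = (*v) A"
    using has_derivative_unique[OF cjacobian_works(2)[OF assms(1-3)] assms(4)] .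
  then show ?thesis unfolding matrix_eq by (simp add: fun_eq_iff)
qed

lemma hol_matrix_cjacobian:
  assumes F: "hol_map F X" "open X"
  shows "hol_matrix (cjacobian F) X"
  unfolding hol_matrix_def
proof (intro allI)
  fix a b
  have "hol_fun (\<lambda>z. frechet_derivative (\<lambda>z. F z $ a) (at z) (axis b 1)) X"
    by (rule hol_fun_frechet_derivative[OF hol_map_nth[OF F(1)] F(2)])
  moreover have "frechet_derivative (\<lambda>z. F z $ a) (at z) (axis b 1) = cjacobian F z $ a $ b" if z: "z \<in> X" for z
    unfolding frechet_derivative_nth[OF F z] by (simp add: cjacobian_def matrix_def)
  ultimately show "hol_fun (\<lambda>z. cjacobian F z $ a $ b) X" by (subst (asm) hol_fun_cong)
qed

lemma tangent_space_open:
  assumes "open X" "p \<in> X"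
  shows "tangent_space X p = UNIV"
proof -
  have "v \<in> tangent_space X p" for v
  proof -
    obtain r where r: "r > 0" "ball p r \<subseteq> X" using assms openE by blast
    define e where "e = r / (norm v + 1)"
    have n: "norm v + 1 > 0" by (simp add: add_nonneg_pos)
    have e: "e > 0" unfolding e_def using r(1) n by simp
    have "norm v / (norm v + 1) < 1" using n by simp
    then have ev: "e * norm v < r" using r(1) mult_strict_left_mono[of "norm v / (norm v + 1)" 1 r]
      by (simp add: e_def)
    \<comment> \<open>Tangent vectors are velocities of curves that stay in \<open>X\<close> for all
      real times. A straight line may leave \<open>X\<close>; the sine keeps the curve within
      distance \<open>e * norm v < r\<close> of \<open>p\<close> and has slope 1 at 0 after
      scaling.\<close>
    define \<gamma> where "\<gamma> = (\<lambda>t. p + (e * sin (t / e)) *\<^sub>R v)"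
    have "\<gamma> t \<in> X" for t
    proof -
      have "\<bar>e * sin (t / e)\<bar> \<le> e" using e by (simp add: abs_mult mult_left_le)
      then have "\<bar>e * sin (t / e)\<bar> * norm v \<le> e * norm v" by (rule mult_right_mono) simp
      then have "norm ((e * sin (t / e)) *\<^sub>R v) < r" using ev by simp
      then have "\<gamma> t \<in> ball p r" by (simp add: \<gamma>_def dist_norm)
      then show ?thesis using r(2) by blast
    qed
    moreover have "(\<gamma> has_vector_derivative v) (at 0)"
      unfolding \<gamma>_def using e by (auto intro!: derivative_eq_intros simp: has_vector_derivative_def)
    moreover have "\<gamma> 0 = p" by (simp add: \<gamma>_def)
    ultimately show ?thesis unfolding tangent_space_def by blast
  qed
  then show ?thesis by blast
qed

text \<open>The map \<open>\<pi>\<close> is not assumed to send \<open>W\<close> into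
  \<open>D\<close>: it only inverts \<open>f\<close> along the image. Therefore it can be used with
  all of the target domain as \<open>W\<close>.\<close>

locale holomorphic_retraction =
  fixes D :: "(complex^'n::finite) set" and W :: "(complex^'N::finite) set"
    and f :: "complex^'n \<Rightarrow> complex^'N" and \<pi> :: "complex^'N \<Rightarrow> complex^'n"
  assumes D: "open D" and W: "open W" and f: "hol_map f D" and fD: "f ` D \<subseteq> W"
    and \<pi>: "hol_map \<pi> W" and \<pi>f: "\<And>w. w \<in> D \<Longrightarrow> \<pi> (f w) = w"
begin

abbreviation proj :: "complex^'N \<Rightarrow> complex^'N^'N" where
  "proj q \<equiv> cjacobian f (\<pi> q) ** cjacobian \<pi> q"

lemma cjacobian_retraction:
  assumes w: "w \<in> D"
  shows "cjacobian \<pi> (f w) ** cjacobian f w = mat 1"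
proof -
  have fw: "f w \<in> W" using fD w by blast
  have "((\<lambda>w. \<pi> (f w)) has_derivative (\<lambda>v. cjacobian \<pi> (f w) *v (cjacobian f w *v v))) (at w)"
    by (rule has_derivative_compose[OF cjacobian_works(2)[OF f D w] cjacobian_works(2)[OF \<pi> W fw]])
  then have "((\<lambda>w. w) has_derivative (\<lambda>v. cjacobian \<pi> (f w) *v (cjacobian f w *v v))) (at w)"
    by (rule has_derivative_transform_within_open[OF _ D w]) (simp add: \<pi>f)
  then have "(\<lambda>v. cjacobian \<pi> (f w) *v (cjacobian f w *v v)) = (\<lambda>v. v)"
    by (rule has_derivative_unique) (rule has_derivative_ident)
  then show ?thesis by (intro matrix_id_if) (simp add: fun_eq_iff flip: matrix_vector_mul_assoc)
qed

lemma cjacobian_retraction_mult: "w \<in> D \<Longrightarrow> cjacobian \<pi> (f w) *v (cjacobian f w *v v) = v"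
  using cjacobian_retraction by (simp add: matrix_vector_mul_assoc)

lemma proj_image: "w \<in> D \<Longrightarrow> proj (f w) *v (cjacobian f w *v v) = cjacobian f w *v v"
  by (simp add: \<pi>f cjacobian_retraction_mult flip: matrix_vector_mul_assoc)

lemma range_proj: "w \<in> D \<Longrightarrow> range ((*v) (proj (f w))) = range ((*v) (cjacobian f w))"
proof -
  assume w: "w \<in> D"
  have "cjacobian f w *v v \<in> range ((*v) (proj (f w)))" for v
    using proj_image[OF w, of v] by (metis rangeI)
  moreover have "proj (f w) *v v \<in> range ((*v) (cjacobian f w))" for v
    using \<pi>f[OF w] by (simp flip: matrix_vector_mul_assoc)
  ultimately show ?thesis by blast
qed

lemma proj_idempotent: "q \<in> f ` D \<Longrightarrow> proj q ** proj q = proj q"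
  using proj_image \<pi>f by (auto simp: matrix_eq simp flip: matrix_vector_mul_assoc)

lemma proj_eq_0_iff:
  assumes "w \<in> D"
  shows "proj (f w) *v v = 0 \<longleftrightarrow> cjacobian \<pi> (f w) *v v = 0"
proof
  assume "proj (f w) *v v = 0"
  then have "cjacobian \<pi> (f w) *v (cjacobian f w *v (cjacobian \<pi> (f w) *v v)) = 0"
    using \<pi>f[OF assms] by (simp flip: matrix_vector_mul_assoc)
  then show "cjacobian \<pi> (f w) *v v = 0"
    by (simp only: cjacobian_retraction_mult[OF assms])
qed (use \<pi>f[OF assms] in \<open>simp flip: matrix_vector_mul_assoc\<close>)

lemma hol_matrix_proj: "hol_matrix proj (f ` D)"
proof (rule hol_matrix_mult)
  show "hol_matrix (\<lambda>q. cjacobian f (\<pi> q)) (f ` D)"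
    by (rule hol_matrix_compose[OF hol_map_subset[OF \<pi> fD] hol_matrix_cjacobian[OF f D]]) (auto simp: \<pi>f)
  show "hol_matrix (cjacobian \<pi>) (f ` D)"
    by (rule hol_matrix_subset[OF hol_matrix_cjacobian[OF \<pi> W] fD])
qed

lemma tangent_space_image:
  assumes w: "w \<in> D"
  shows "tangent_space (f ` D) (f w) = range ((*v) (cjacobian f w))"
proof
  have fw: "f w \<in> W" using fD w by blast
  show "tangent_space (f ` D) (f w) \<subseteq> range ((*v) (cjacobian f w))"
  proof
    fix v assume "v \<in> tangent_space (f ` D) (f w)"
    then obtain \<gamma> where \<gamma>: "\<gamma> 0 = f w" "\<And>t. \<gamma> t \<in> f ` D" "(\<gamma> has_vector_derivative v) (at 0)"
      unfolding tangent_space_def by blast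
    have d: "(\<gamma> has_derivative (\<lambda>t. t *\<^sub>R v)) (at 0)" using \<gamma>(3) by (simp add: has_vector_derivative_def)
    have "((\<lambda>t. \<pi> (\<gamma> t)) has_derivative (\<lambda>t. cjacobian \<pi> (f w) *v (t *\<^sub>R v))) (at 0)"
      by (rule has_derivative_compose[OF d]) (use cjacobian_works(2)[OF \<pi> W fw] \<gamma>(1) in simp)
    then have "((\<lambda>t. f (\<pi> (\<gamma> t))) has_derivative (\<lambda>t. cjacobian f w *v (cjacobian \<pi> (f w) *v (t *\<^sub>R v)))) (at 0)"
      by (rule has_derivative_compose) (use cjacobian_works(2)[OF f D w] \<gamma>(1) \<pi>f[OF w] in simp)
    moreover have "(\<lambda>t. f (\<pi> (\<gamma> t))) = \<gamma>"
    proof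
      fix t
      obtain w' where "w' \<in> D" "\<gamma> t = f w'" using \<gamma>(2)[of t] by blast
      then show "f (\<pi> (\<gamma> t)) = \<gamma> t" by (simp add: \<pi>f)
    qed
    ultimately have "(\<lambda>t. t *\<^sub>R v) = (\<lambda>t. cjacobian f w *v (cjacobian \<pi> (f w) *v (t *\<^sub>R v)))"
      using has_derivative_unique[OF d] by simp
    then have "1 *\<^sub>R v = cjacobian f w *v (cjacobian \<pi> (f w) *v (1 *\<^sub>R v))" by (rule fun_cong)
    then show "v \<in> range ((*v) (cjacobian f w))" by (metis rangeI scaleR_one)
  qed
  show "range ((*v) (cjacobian f w)) \<subseteq> tangent_space (f ` D) (f w)"
  proof clarify
    fix u
    obtain \<gamma> where \<gamma>: "\<gamma> 0 = w" "\<And>t. \<gamma> t \<in> D" "(\<gamma> has_vector_derivative u) (at 0)"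
      using tangent_space_open[OF D w] unfolding tangent_space_def by blast
    have d: "(\<gamma> has_derivative (\<lambda>t. t *\<^sub>R u)) (at 0)" using \<gamma>(3) by (simp add: has_vector_derivative_def)
    have "((\<lambda>t. f (\<gamma> t)) has_derivative (\<lambda>t. cjacobian f w *v (t *\<^sub>R u))) (at 0)"
      by (rule has_derivative_compose[OF d]) (use cjacobian_works(2)[OF f D w] \<gamma>(1) in simp)
    then have "((\<lambda>t. f (\<gamma> t)) has_vector_derivative (cjacobian f w *v u)) (at 0)"
      by (simp add: has_vector_derivative_def linear_scale[OF matrix_vector_mul_linear])
    then show "cjacobian f w *v u \<in> tangent_space (f ` D) (f w)"
      unfolding tangent_space_def using \<gamma> by (intro CollectI exI[of _ "\<lambda>t. f (\<gamma> t)"]) auto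
  qed
qed

lemma retraction_splittings:
  assumes "open \<Omega>" "f ` D \<subseteq> \<Omega>"
  shows "holomorphic_splitting \<Omega> (f ` D) \<pi>" "tangent_sequence_splits \<Omega> (f ` D)"
proof -
  have T: "tangent_space (f ` D) q = range ((*v) (proj q))" if "q \<in> f ` D" for q
    using that tangent_space_image range_proj by blast
  have \<Omega>: "tangent_space \<Omega> q = UNIV" if "q \<in> f ` D" for q
    by (rule tangent_space_open[OF assms(1)]) (use assms(2) that in blast)
  have K: "kernel_of_differential \<Omega> \<pi> q = {v. proj q *v v = 0}" if q: "q \<in> f ` D" for q
  proof -
    obtain w where w: "w \<in> D" "q = f w" using q by blast
    have qW: "q \<in> W" using q fD by blast
    show ?thesis
      using proj_eq_0_iff[OF w(1)] \<Omega>[OF q] cjacobian_works(1)[OF \<pi> W qW]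
      by (simp add: kernel_of_differential_def w(2))
  qed
  show "holomorphic_splitting \<Omega> (f ` D) \<pi>" "tangent_sequence_splits \<Omega> (f ` D)"
    by (rule projection_splittings[OF hol_matrix_proj]; use proj_idempotent T \<Omega> K in blast)+
qed

end

section \<open>Holomorphic extension and domains of holomorphy\<close>

text \<open>For a convex set the functions \<open>1 / (l - l(q))\<close>, with \<open>l\<close> linear, separate it from every point \<open>q\<close> outside.\<close>

lemma extension_maps_into_convex:
  fixes \<Psi> :: "complex^'N::finite \<Rightarrow> complex^'m::finite"
  assumes V: "open V" "connected V" and A: "open A" "A \<noteq> {}" "A \<subseteq> V \<inter> W"
    and ext: "\<And>g. hol_fun g W \<Longrightarrow> \<exists>G. hol_fun G V \<and> (\<forall>z\<in>A. G z = g z)"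
    and \<Psi>: "hol_map \<Psi> V" "hol_map \<Psi> W" and C: "open C" "convex C" "\<Psi> ` W \<subseteq> C"
  shows "\<Psi> ` V \<subseteq> C"
proof clarify
  fix z0 assume z0: "z0 \<in> V"
  show "\<Psi> z0 \<in> C"
  proof (rule ccontr)
    assume q: "\<Psi> z0 \<notin> C"
    have "C \<noteq> {}" using A C(3) by blast
    then obtain a b where a: "a \<noteq> 0" "\<And>x. x \<in> C \<Longrightarrow> a \<bullet> x \<le> b" "b \<le> a \<bullet> \<Psi> z0"
      using separating_hyperplane_sets[OF C(2) convex_singleton, of "\<Psi> z0"] q by auto
    \<comment> \<open>Openness of \<open>C\<close> makes the separation strict: moving from
      \<open>x\<close> a little in direction \<open>a\<close> stays in \<open>C\<close> but raises
      the inner product with \<open>a\<close>.\<close>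
    have lt: "a \<bullet> x < a \<bullet> \<Psi> z0" if x: "x \<in> C" for x
    proof -
      obtain r where r: "r > 0" "ball x r \<subseteq> C" using openE[OF C(1) x] by blast
      define y where "y = x + (r / (2 * norm a)) *\<^sub>R a"
      have "y \<in> ball x r" using r(1) a(1) by (simp add: y_def dist_norm)
      then have "a \<bullet> y \<le> b" using r(2) a(2) by blast
      moreover have "a \<bullet> y = a \<bullet> x + (r / (2 * norm a)) * (a \<bullet> a)" by (simp add: y_def inner_add_right)
      moreover have "(r / (2 * norm a)) * (a \<bullet> a) > 0" using r(1) a(1) by simp
      ultimately show ?thesis using a(3) by linarith
    qed
    \<comment> \<open>The complex linear functional whose real part is the real functional of the
      separating hyperplane.\<close>
    define l where "l = (\<lambda>x :: complex^'m. \<Sum>k\<in>UNIV. cnj (a $ k) * x $ k)"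
    have Re_l: "Re (l x) = a \<bullet> x" for x by (simp add: l_def inner_vec_def inner_complex_def)
    have holl: "hol_fun (\<lambda>z. l (\<Psi> z) - l (\<Psi> z0)) X" if "hol_map \<Psi> X" for X
      unfolding l_def by (intro hol_fun_diff hol_fun_sum hol_fun_mult hol_fun_const hol_map_nth that)
    have nz: "l (\<Psi> z) - l (\<Psi> z0) \<noteq> 0" if "z \<in> W" for z
    proof -
      have "Re (l (\<Psi> z)) < Re (l (\<Psi> z0))" using lt C(3) that unfolding Re_l by blast
      then show ?thesis by auto
    qed
    obtain G where G: "hol_fun G V" "\<And>z. z \<in> A \<Longrightarrow> G z = inverse (l (\<Psi> z) - l (\<Psi> z0))"
      using ext[OF hol_fun_inverse[OF holl[OF \<Psi>(2)] nz]] by blast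
    \<comment> \<open>The relation \<open>G (l \<circ> \<Psi> - l (\<Psi> z0)) = 1\<close> persists
      from \<open>A\<close> to the connected set \<open>V\<close>, but at \<open>z0\<close> the
      second factor is zero.\<close>
    have "G z0 * (l (\<Psi> z0) - l (\<Psi> z0)) - 1 = 0"
    proof (rule hol_fun_identity[OF _ V A(1,2) _ _ z0, where g = "\<lambda>z. G z * (l (\<Psi> z) - l (\<Psi> z0)) - 1"])
      show "hol_fun (\<lambda>z. G z * (l (\<Psi> z) - l (\<Psi> z0)) - 1) V"
        by (intro hol_fun_diff hol_fun_mult G(1) holl[OF \<Psi>(1)] hol_fun_const)
      show "G y * (l (\<Psi> y) - l (\<Psi> z0)) - 1 = 0" if "y \<in> A" for y
        using G(2)[OF that] nz[of y] A(3) that by auto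
    qed (use A(3) in blast)
    then show False by simp
  qed
qed

text \<open>The order of the inclusions matters. Only after \<open>V\<close> is known to lie in
  \<open>\<Omega>\<close> can \<open>\<pi>\<close> be applied to \<open>V\<close>, and only after
  \<open>\<pi>\<close> maps \<open>V\<close> into \<open>D\<close> is \<open>\<delta>\<close>
  holomorphic on \<open>V\<close>. The extension of \<open>1 / \<delta>\<close> then excludes zeros
  of \<open>\<delta>\<close>, and \<open>V\<close>, being connected and meeting \<open>W\<close>,
  lies in that component.\<close>

lemma domain_of_holomorphy_component:
  assumes \<Omega>: "open \<Omega>" "convex \<Omega>" and D: "open D" "convex D" and \<pi>: "hol_map \<pi> \<Omega>"
    and \<delta>: "hol_fun \<delta> {z \<in> \<Omega>. \<pi> z \<in> D}" and W: "W \<in> components {z \<in> \<Omega>. \<pi> z \<in> D \<and> \<delta> z \<noteq> 0}"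
  shows "domain_of_holomorphy W"
proof -
  let ?W0 = "{z \<in> \<Omega>. \<pi> z \<in> D}" and ?W1 = "{z \<in> \<Omega>. \<pi> z \<in> D \<and> \<delta> z \<noteq> 0}"
  have W0: "open ?W0"
    using continuous_open_preimage[OF hol_map_continuous_on[OF \<pi>] \<Omega>(1) D(1)]
    by (simp add: vimage_def Int_def)
  have "open (?W0 \<inter> \<delta> -` (- {0}))"
    by (rule continuous_open_preimage[OF hol_fun_continuous_on[OF \<delta>] W0]) auto
  moreover have "?W0 \<inter> \<delta> -` (- {0}) = ?W1" by auto
  ultimately have W1: "open ?W1" by simp
  have sub: "W \<subseteq> ?W1" using W by (rule in_components_subset)
  have hol_id: "hol_map (\<lambda>z. z) X" for X :: "(complex^'a) set" by (rule hol_map_id)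
  have "V \<subseteq> W" if V: "open V" "connected V" and A: "open A" "A \<noteq> {}" "A \<subseteq> V \<inter> W"
    and ext: "\<And>g. hol_fun g W \<Longrightarrow> \<exists>G. hol_fun G V \<and> (\<forall>z\<in>A. G z = g z)" for V A
  proof -
    have "(\<lambda>z. z) ` V \<subseteq> \<Omega>"
      by (rule extension_maps_into_convex[OF V A ext hol_id hol_id \<Omega>]) (use sub in auto)
    then have V\<Omega>: "V \<subseteq> \<Omega>" by simp
    have "W \<subseteq> \<Omega>" using sub by blast
    then have "\<pi> ` V \<subseteq> D"
      by (intro extension_maps_into_convex[OF V A ext hol_map_subset[OF \<pi> V\<Omega>] hol_map_subset[OF \<pi>] D])
        (use sub in auto)
    then have V0: "V \<subseteq> ?W0" using V\<Omega> by blast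
    have \<delta>W: "hol_fun \<delta> W" by (rule hol_fun_subset[OF \<delta>]) (use sub in blast)
    obtain G where G: "hol_fun G V" "\<And>z. z \<in> A \<Longrightarrow> G z = inverse (\<delta> z)"
      using ext[OF hol_fun_inverse[OF \<delta>W]] sub by blast
    have "G z * \<delta> z - 1 = 0" if z: "z \<in> V" for z
    proof (rule hol_fun_identity[OF _ V A(1,2) _ _ z, where g = "\<lambda>z. G z * \<delta> z - 1"])
      show "hol_fun (\<lambda>z. G z * \<delta> z - 1) V"
        by (intro hol_fun_diff hol_fun_mult G(1) hol_fun_subset[OF \<delta> V0] hol_fun_const)
      show "G y * \<delta> y - 1 = 0" if "y \<in> A" for y
        using G(2)[OF that] A(3) sub that by auto
    qed (use A(3) in blast)
    then have "\<delta> z \<noteq> 0" if "z \<in> V" for z using that by force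
    then have "V \<subseteq> ?W1" using V0 by blast
    then show "V \<subseteq> W" using components_maximal[OF W V(2)] A by blast
  qed
  then show ?thesis
    unfolding domain_of_holomorphy_def
    using open_components[OF W1 W] in_components_connected[OF W] in_components_nonempty[OF W] by blast
qed

section \<open>Local coordinates along the submanifold\<close>

lemma hol_mapI:
  assumes "\<And>z. z \<in> X \<Longrightarrow> \<exists>L. (F has_derivative L) (at z within X) \<and> (\<forall>c v. L (c *s v) = c *s L v)"
  shows "hol_map F X"
  unfolding hol_map_def
proof (intro allI hol_funI)
  fix a z assume "z \<in> X"
  then obtain L where L: "(F has_derivative L) (at z within X)" "\<forall>c v. L (c *s v) = c *s L v" using assms by blast
  then show "\<exists>L. ((\<lambda>z. F z $ a) has_derivative L) (at z within X) \<and> (\<forall>c v. L (c *s v) = c * L v)"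
    by (intro exI[of _ "\<lambda>v. L v $ a"]) (simp add: has_derivative_vec_iff)
qed

lemma hol_map_cong: "(\<And>z. z \<in> X \<Longrightarrow> F z = G z) \<Longrightarrow> hol_map F X \<longleftrightarrow> hol_map G X"
  unfolding hol_map_def by (intro all_cong1 hol_fun_cong) simp

text \<open>The space is the direct sum of range and kernel of \<open>P\<close>. The coordinates in
  \<open>J\<close> are sent to the range and the complementary ones to the kernel; equality of
  dimensions makes this an isomorphism \<open>G\<close>.\<close>

lemma projection_coordinates:
  fixes P :: "complex^'N::finite^'N"
  assumes P: "P ** P = P"
  obtains J :: "'N set" and G G' where "card J = vec.dim (range ((*v) P))" "(*v) G ` coord_space J = range ((*v) P)"
    "\<And>x. G *v (G' *v x) = x" "\<And>x. G' *v (G *v x) = x"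
proof -
  let ?R = "range ((*v) P)" and ?K = "range ((*v) (mat 1 - P))"
  have PR: "P *v x = x" if "x \<in> ?R" for x using that P by (auto simp: matrix_vector_mul_assoc)
  have K: "P *v x = 0" if "x \<in> ?K" for x using that range_complement[OF P] by blast
  have sum: "{x + y | x y. x \<in> ?R \<and> y \<in> ?K} = UNIV"
  proof -
    have "\<exists>x y. v = x + y \<and> x \<in> ?R \<and> y \<in> ?K" for v
      by (rule exI[of _ "P *v v"], rule exI[of _ "(mat 1 - P) *v v"]) (simp add: matrix_vector_mult_diff_rdistrib)
    then show ?thesis by blast
  qed
  have "x = 0" if "x \<in> ?R" "x \<in> ?K" for x using PR[OF that(1)] K[OF that(2)] by simp
  then have "?R \<inter> ?K \<subseteq> {0}" by blast
  then have dim0: "vec.dim (?R \<inter> ?K) = 0" using vec.dim_subset[of "?R \<inter> ?K" "{0}"] by simp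
  have "vec.dim (UNIV :: (complex^'N) set) + 0 = vec.dim ?R + vec.dim ?K"
    using vec.dim_sums_Int[OF subspace_range[of P] subspace_range[of "mat 1 - P"]] unfolding sum dim0 .
  then have dims: "vec.dim ?R + vec.dim ?K = CARD('N)" by (simp add: card_cart_basis)
  obtain J and B :: "complex^'N^'N" where J: "card J = vec.dim ?R" "bij_betw ((*v) B) (coord_space J) ?R"
    using subspace_coordinates[OF subspace_range] .
  have "card (- J) = vec.dim ?K" using J(1) dims by (simp add: Compl_eq_Diff_UNIV card_Diff_subset)
  then have "\<exists>h. Vector_Spaces.linear (*s) (*s) h \<and> h ` coord_space (- J) = ?K \<and> inj_on h (coord_space (- J))"
    by (intro vec.subspace_isomorphism subspace_coord_space subspace_range) (simp add: dim_coord_space)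
  then obtain h where h: "Vector_Spaces.linear (*s) (*s) h" "h ` coord_space (- J) = ?K" "inj_on h (coord_space (- J))"
    by blast
  have mh: "matrix h *v x = h x" for x using h(1) by (rule matrix_works)
  define G where "G = B ** coord_matrix J + matrix h ** coord_matrix (- J)"
  have G: "G *v x = B *v (coord_proj J x) + h (coord_proj (- J) x)" for x
    by (simp add: G_def matrix_vector_mult_add_rdistrib mh coord_matrix_mult flip: matrix_vector_mul_assoc)
  have h0: "h 0 = 0" using mh[of 0] by simp
  have GJ: "G *v x = B *v x" if "x \<in> coord_space J" for x
  proof -
    have "coord_proj (- J) x = 0" using that by (auto simp: coord_proj_def coord_space_def vec_eq_iff)
    then show ?thesis using that by (simp add: G coord_proj_id h0)
  qed
  have BR: "B *v coord_proj J x \<in> ?R" for x using J(2) coord_proj_in[of J x] by (auto simp: bij_betw_def)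
  have hK: "h (coord_proj (- J) x) \<in> ?K" for x using h(2) coord_proj_in[of "- J" x] by blast
  have "x = 0" if "G *v x = 0" for x
  proof -
    have "P *v (G *v x) = B *v (coord_proj J x)"
      using PR[OF BR] K[OF hK] by (simp add: G matrix_vector_right_distrib)
    then have b: "B *v (coord_proj J x) = B *v 0" using that by simp
    then have 1: "coord_proj J x = 0"
      using J(2) inj_onD[of "(*v) B" "coord_space J", OF _ b] by (simp add: bij_betw_def)
    then have "h (coord_proj (- J) x) = h 0" using that by (simp add: G h0)
    then have 2: "coord_proj (- J) x = 0" using inj_onD[OF h(3)] by simp
    have "coord_proj J x + coord_proj (- J) x = x" by (simp add: coord_proj_def vec_eq_iff)
    then show "x = 0" using 1 2 by simp
  qed
  then have "\<exists>G'. G' ** G = mat 1" unfolding matrix_left_invertible_ker by blast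
  then obtain G' where G': "G' ** G = mat 1" by blast
  then have "G ** G' = mat 1" using matrix_left_right_inverse by blast
  with G' show thesis
  proof (intro that[of J G G'])
    show "(*v) G ` coord_space J = ?R"
      using J(2) GJ by (simp add: bij_betw_def cong: image_cong)
  qed (simp_all add: J(1) matrix_vector_mul_assoc)
qed

lemma hol_map_mult_const: "hol_map (\<lambda>x. A *v x) X"
  by (intro hol_map_matrix_vector hol_matrix_const hol_map_id)

text \<open>This is the real inverse function theorem. The derivative of the inverse is the inverse
  of a complex linear bijection and therefore complex linear.\<close>

lemma hol_inverse_function:
  fixes \<theta> :: "complex^'N::finite \<Rightarrow> complex^'N"
  assumes \<theta>: "hol_map \<theta> U" and U: "open U" "x0 \<in> U" and G': "\<And>v. G' *v (cjacobian \<theta> x0 *v v) = v"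
  obtains U' V g where "open U'" "U' \<subseteq> U" "x0 \<in> U'" "open V" "\<theta> x0 \<in> V" "homeomorphism U' V \<theta> g" "hol_map g V"
proof -
  define d where "d = (\<lambda>x. Blinfun ((*v) (cjacobian \<theta> x)))"
  have bl: "bounded_linear ((*v) A)" for A :: "complex^'N^'N"
    by (simp add: linear_conv_bounded_linear[symmetric])
  have d: "blinfun_apply (d x) = (*v) (cjacobian \<theta> x)" for x
    unfolding d_def by (rule bounded_linear_Blinfun_apply[OF bl])
  have der: "(\<theta> has_derivative blinfun_apply (d x)) (at x)" if "x \<in> U" for x
    unfolding d by (rule cjacobian_works(2)[OF \<theta> U(1) that])
  have cont: "continuous_on U d"
  proof (rule continuous_on_blinfun_componentwise)
    fix i :: "complex^'N"
    have "hol_map (\<lambda>x. cjacobian \<theta> x *v i) U"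
      by (intro hol_map_matrix_vector hol_matrix_cjacobian \<theta> U(1) hol_map_const)
    then show "continuous_on U (\<lambda>x. blinfun_apply (d x) i)" unfolding d by (rule hol_map_continuous_on)
  qed
  have "Blinfun ((*v) G') o\<^sub>L d x0 = id_blinfun"
    by (rule blinfun_eqI) (simp add: bounded_linear_Blinfun_apply[OF bl] d G')
  from inverse_function_theorem[OF U(1) der cont U(2) this]
  obtain U' V g g' where r: "open U'" "U' \<subseteq> U" "x0 \<in> U'" "open V" "\<theta> x0 \<in> V" "homeomorphism U' V \<theta> g"
      and g': "\<And>y. y \<in> V \<Longrightarrow> (g has_derivative (g' y)) (at y)" "\<And>y. y \<in> V \<Longrightarrow> g' y = inv (blinfun_apply (d (g y)))"
        "\<And>y. y \<in> V \<Longrightarrow> bij (blinfun_apply (d (g y)))" by blast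
  have "hol_map g V"
  proof (rule hol_mapI)
    fix y assume y: "y \<in> V"
    let ?L = "(*v) (cjacobian \<theta> (g y))"
    have b: "bij ?L" and gy: "g' y = inv ?L" using g'(2,3)[OF y] by (simp_all add: d)
    have "g' y (c *s v) = c *s g' y v" for c v
    proof -
      have "?L (inv ?L (c *s v)) = c *s v" by (rule surj_f_inv_f[OF bij_is_surj[OF b]])
      also have "\<dots> = c *s ?L (inv ?L v)" by (simp only: surj_f_inv_f[OF bij_is_surj[OF b]])
      also have "\<dots> = ?L (c *s inv ?L v)" by (simp add: vec.scale)
      finally show ?thesis unfolding gy using bij_is_inj[OF b] by (simp only: inj_eq)
    qed
    then show "\<exists>L. (g has_derivative L) (at y within V) \<and> (\<forall>c v. L (c *s v) = c *s L v)"
      using has_derivative_at_withinI[OF g'(1)[OF y]] by blast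
  qed
  with r show thesis by (rule that)
qed

context holomorphic_retraction
begin

text \<open>
  Near \<open>f w0\<close> the submanifold is straightened by the inverse of
  \<open>\<theta> x = f (w0 + K G x) + (1 - P) G x\<close>, where \<open>K\<close> is the differential of \<open>\<pi>\<close>, \<open>P\<close> the projection to the
  tangent space along the kernel of \<open>K\<close>, and \<open>G\<close> a linear change of coordinates.
\<close>

lemma embedded_submanifold: "embedded_complex_submanifold CARD('n) (f ` D)"
  unfolding embedded_complex_submanifold_def
proof
  fix p assume "p \<in> f ` D"
  then obtain w0 where w0: "w0 \<in> D" "p = f w0" by blast
  have pW: "p \<in> W" using w0 fD by blast
  define K F where "K = cjacobian \<pi> p" and "F = cjacobian f w0"
  define P where "P = F ** K"
  have P: "P = proj p" using w0 \<pi>f by (simp add: P_def K_def F_def)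
  have KF: "K *v (F *v v) = v" for v using cjacobian_retraction_mult[OF w0(1)] w0(2) by (simp add: K_def F_def)
  have Pm: "P *v x = F *v (K *v x)" for x by (simp add: P_def flip: matrix_vector_mul_assoc)
  have "P ** P = P" unfolding P by (rule proj_idempotent) (use w0 in blast)
  then obtain J :: "'N set" and G G' where J: "card J = vec.dim (range ((*v) P))" and GJ: "(*v) G ` coord_space J = range ((*v) P)"
      and GG': "\<And>x. G *v (G' *v x) = x" and G'G: "\<And>x. G' *v (G *v x) = x"
    by (rule projection_coordinates) (rule that)
  have "range ((*v) P) = range ((*v) F)"
    using range_proj[OF w0(1)] w0 by (simp add: P F_def)
  moreover have "inj ((*v) F)" by (rule inj_on_inverseI[of _ "(*v) K"]) (rule KF)
  then have "vec.dim ((*v) F ` UNIV) = vec.dim (UNIV :: (complex^'n) set)"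
    by (intro vec.dim_image_eq matrix_vector_mul_linear_gen) simp
  ultimately have cardJ: "card J = CARD('n)" using J by (simp add: card_cart_basis)
  define \<theta> where "\<theta> = (\<lambda>x. f (w0 + K *v (G *v x)) + (G *v x - P *v (G *v x)))"
  define U where "U = {x. w0 + K *v (G *v x) \<in> D}"
  have ha: "hol_map (\<lambda>x. w0 + K *v (G *v x)) X" for X
    by (intro hol_map_add hol_map_const hol_map_matrix_vector hol_matrix_const hol_map_id)
  have U: "open U"
    using open_vimage[OF D hol_map_continuous_on[OF ha]] by (simp add: U_def vimage_def)
  have U0: "0 \<in> U" using w0 by (simp add: U_def)
  have \<theta>: "hol_map \<theta> U"
    unfolding \<theta>_def
    by (intro hol_map_add hol_map_diff hol_map_matrix_vector hol_matrix_const hol_map_id hol_map_compose[OF ha f])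
      (auto simp: U_def)
  have "((\<lambda>x. w0 + K *v (G *v x)) has_derivative (\<lambda>v. K *v (G *v v))) (at 0)"
    by (rule has_derivative_eq_rhs[OF has_derivative_add[OF has_derivative_const
        bounded_linear_imp_has_derivative]]) (auto simp: matrix_vector_mul_assoc linear_conv_bounded_linear[symmetric])
  then have "((\<lambda>x. f (w0 + K *v (G *v x))) has_derivative (\<lambda>v. F *v (K *v (G *v v)))) (at 0)"
    by (rule has_derivative_compose) (use cjacobian_works(2)[OF f D w0(1)] in \<open>simp add: F_def\<close>)
  moreover have "((\<lambda>x. G *v x - P *v (G *v x)) has_derivative (\<lambda>v. G *v v - P *v (G *v v))) (at 0)"
    by (intro has_derivative_diff bounded_linear_imp_has_derivative)
      (auto simp: matrix_vector_mul_assoc linear_conv_bounded_linear[symmetric])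
  \<comment> \<open>Since \<open>P = F K\<close>, the terms with \<open>P\<close> cancel and the
    differential of \<open>\<theta>\<close> at 0 is the invertible map \<open>G\<close>.\<close>
  ultimately have "(\<theta> has_derivative (\<lambda>v. F *v (K *v (G *v v)) + (G *v v - P *v (G *v v)))) (at 0)"
    unfolding \<theta>_def by (rule has_derivative_add)
  then have "(\<theta> has_derivative (*v) G) (at 0)" by (simp add: Pm)
  then have jac: "cjacobian \<theta> 0 = G" by (rule cjacobian_unique[OF \<theta> U U0])
  obtain U' V g where U': "open U'" "U' \<subseteq> U" "0 \<in> U'" and V: "open V" "\<theta> 0 \<in> V"
      and hom: "homeomorphism U' V \<theta> g" and g: "hol_map g V"
  proof (rule hol_inverse_function[OF \<theta> U U0])
    show "G' *v (cjacobian \<theta> 0 *v v) = v" for v by (simp add: jac G'G)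
  qed (rule that)
  have \<theta>g: "\<theta> (g y) = y" "g y \<in> U'" if "y \<in> V" for y using hom that by (auto simp: homeomorphism_def)
  have g\<theta>: "g (\<theta> x) = x" "\<theta> x \<in> V" if "x \<in> U'" for x using hom that by (auto simp: homeomorphism_def)
  \<comment> \<open>For \<open>z = f w\<close> this is the point with
    \<open>\<theta> (b z) = z\<close>. Restricting to those \<open>z\<close> with
    \<open>b z \<in> U'\<close> guarantees that \<open>g\<close> returns exactly this point, which
    lies in the coordinate space of \<open>J\<close>.\<close>
  define b where "b = (\<lambda>z. G' *v (F *v (\<pi> z - w0)))"
  define V1 where "V1 = {z \<in> W \<inter> V. b z \<in> U'}"
  have hb: "hol_map b W" unfolding b_def by (intro hol_map_matrix_vector hol_matrix_const hol_map_diff \<pi> hol_map_const)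
  have "continuous_on (W \<inter> V) b"
    by (rule hol_map_continuous_on[OF hol_map_subset[OF hb]]) simp
  then have V1: "open V1"
    using continuous_open_preimage[OF _ open_Int[OF W V(1)] U'(1)] by (simp add: V1_def vimage_def Int_def)
  have "\<theta> 0 = p" by (simp add: \<theta>_def w0)
  then have p: "p \<in> V1" using V(2) pW U'(3) w0 \<pi>f by (simp add: V1_def b_def)
  have image: "g ` V1 = {x \<in> U'. \<theta> x \<in> V1}"
  proof (intro set_eqI iffI)
    fix x assume "x \<in> g ` V1"
    then obtain y where y: "y \<in> V1" "x = g y" by blast
    then have "y \<in> V" by (simp add: V1_def)
    then show "x \<in> {x \<in> U'. \<theta> x \<in> V1}" using y \<theta>g[of y] by simp
  next
    fix x assume "x \<in> {x \<in> U'. \<theta> x \<in> V1}"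
    then show "x \<in> g ` V1" using g\<theta>[of x] by (intro image_eqI[of _ _ "\<theta> x"]) auto
  qed
  have "open (U' \<inter> \<theta> -` V1)"
    using hol_map_continuous_on[OF hol_map_subset[OF \<theta> U'(2)]] by (rule continuous_open_preimage[OF _ U'(1) V1])
  then have open_image: "open (g ` V1)" unfolding image by (simp add: vimage_def Int_def)
  have inv: "inv_into V1 g x = \<theta> x" if "x \<in> g ` V1" for x
  proof -
    have x: "x \<in> U'" "\<theta> x \<in> V1" using that unfolding image by auto
    have "inj_on g V1" by (rule inj_on_inverseI[of _ \<theta>]) (use \<theta>g in \<open>simp add: V1_def\<close>)
    then show ?thesis using inv_into_f_f[of g V1 "\<theta> x"] x g\<theta>[of x] by simp
  qed
  have "biholomorphic V1 (g ` V1) g"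
    unfolding biholomorphic_def
  proof (intro conjI)
    show "hol_map g V1" by (rule hol_map_subset[OF g]) (auto simp: V1_def)
    have "inj_on g V1" by (rule inj_on_inverseI[of _ \<theta>]) (use \<theta>g in \<open>simp add: V1_def\<close>)
    then show "bij_betw g V1 (g ` V1)" by (simp add: bij_betw_def)
    have "hol_map \<theta> (g ` V1)" by (rule hol_map_subset[OF \<theta>]) (use U'(2) image in blast)
    then show "hol_map (inv_into V1 g) (g ` V1)" using hol_map_cong[of "g ` V1" "inv_into V1 g" \<theta>] inv by blast
  qed
  moreover have "g ` (f ` D \<inter> V1) = g ` V1 \<inter> coord_space J"
  proof (intro set_eqI iffI)
    fix x assume "x \<in> g ` (f ` D \<inter> V1)"
    then obtain w where w: "w \<in> D" "f w \<in> V1" "x = g (f w)" by blast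
    define y where "y = b (f w)"
    have y: "y \<in> U'" using w(2) by (simp add: V1_def y_def)
    have Gy: "G *v y = F *v (w - w0)" using w(1) by (simp add: y_def b_def GG' \<pi>f)
    have "\<theta> y = f w" by (simp add: \<theta>_def Gy Pm KF)
    then have "x = y" using w(3) g\<theta>(1)[OF y] by simp
    have "G *v y \<in> range ((*v) P)" unfolding Gy by (rule range_eqI[of _ _ "F *v (w - w0)"]) (simp add: Pm KF)
    then obtain y' where "y' \<in> coord_space J" "G *v y = G *v y'" unfolding GJ[symmetric] by blast
    then have "y \<in> coord_space J" using G'G by metis
    then show "x \<in> g ` V1 \<inter> coord_space J" using w \<open>x = y\<close> by blast
  next
    fix x assume x: "x \<in> g ` V1 \<inter> coord_space J"
    then obtain z where z: "z \<in> V1" "x = g z" by blast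
    then have zV: "z \<in> V" by (simp add: V1_def)
    have "x \<in> U" using \<theta>g(2)[OF zV] z U'(2) by blast
    have "G *v x \<in> range ((*v) P)" using x GJ by blast
    then obtain u where u: "G *v x = P *v u" by blast
    \<comment> \<open>For \<open>x\<close> in the coordinate space of \<open>J\<close> the second
      summand of \<open>\<theta> x\<close> vanishes, so that \<open>\<theta> x\<close> is a value of
      \<open>f\<close>.\<close>
    have "P *v (G *v x) = G *v x" unfolding u by (simp add: Pm KF)
    then have "\<theta> x = f (w0 + K *v (G *v x))" by (simp add: \<theta>_def)
    then have "z \<in> f ` D" using \<theta>g(1)[OF zV] z \<open>x \<in> U\<close> by (auto simp: U_def)
    then show "x \<in> g ` (f ` D \<inter> V1)" using z by blast
  qed
  ultimately show "\<exists>V (\<psi> :: complex^'N \<Rightarrow> complex^'N) J. open V \<and> p \<in> V \<and> open (\<psi> ` V) \<and>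
      biholomorphic V (\<psi> ` V) \<psi> \<and> card J = CARD('n) \<and> \<psi> ` (f ` D \<inter> V) = \<psi> ` V \<inter> coord_space J"
    using V1 p open_image cardJ by blast
qed

end

section \<open>The isometry condition\<close>

lemma hform_cong:
  "(\<And>k. k < m \<Longrightarrow> x k = x' k) \<Longrightarrow> (\<And>k. k < m \<Longrightarrow> y k = y' k) \<Longrightarrow> hform m \<epsilon> x y = hform m \<epsilon> x' y'"
  unfolding hform_def by (intro sum.cong) auto

section \<open>Block projections and products of domains\<close>

lemma block_proj_linear:
  "block_proj b i (x + y) = block_proj b i x + block_proj b i y"
  "block_proj b i (c *s x) = c *s block_proj b i x"
  "block_proj b i (r *\<^sub>R x) = r *\<^sub>R block_proj b i x"
  "block_proj b i 0 = 0"
  by (simp_all add: block_proj_def coord_proj_add coord_proj_smult coord_proj_scaleR coord_proj_id)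

lemma block_proj_nth: "block_proj b i x $ a = (if b a = i then x $ a else 0)"
  by (simp add: block_proj_def coord_proj_def)

lemma hol_map_block_proj: "hol_map (block_proj b i) X"
  unfolding block_proj_def coord_matrix_mult[symmetric] by (rule hol_map_mult_const)

lemma continuous_on_block_proj: "continuous_on X (block_proj b i)"
  by (rule hol_map_continuous_on[OF hol_map_block_proj])

lemma has_derivative_block_proj: "(block_proj b i has_derivative block_proj b i) (at x within X)"
  unfolding block_proj_def coord_matrix_mult[symmetric]
  by (rule bounded_linear_imp_has_derivative) (simp add: linear_conv_bounded_linear[symmetric])

lemma sum_block_proj: "(\<Sum>i\<in>UNIV. block_proj b i x) = x"
  for b :: "'n::finite \<Rightarrow> 'k::finite"
proof -
  have "(\<Sum>i\<in>UNIV. if b a = i then x $ a else 0) = x $ a" for a by simp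
  then show ?thesis by (simp add: vec_eq_iff block_proj_nth)
qed

context
  fixes b :: "'n::finite \<Rightarrow> 'k::finite" and U :: "'k \<Rightarrow> (complex^'n) set"
  assumes op: "\<And>i. openin (top_of_set (coord_space (b -` {i}))) (U i)"
begin

lemma open_domain_product: "open (domain_product b U)"
proof -
  have "open {w. block_proj b i w \<in> U i}" for i
  proof -
    obtain T where T: "open T" "U i = coord_space (b -` {i}) \<inter> T" using op unfolding openin_open by blast
    have "{w. block_proj b i w \<in> U i} = block_proj b i -` T"
      using T(2) by (auto simp: block_proj_def)
    then show ?thesis using open_vimage[OF T(1) continuous_on_block_proj] by simp
  qed
  moreover have "domain_product b U = (\<Inter>i. {w. block_proj b i w \<in> U i})" by (auto simp: domain_product_def)
  ultimately show ?thesis by (simp add: open_INT)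
qed

lemma convex_domain_product:
  assumes "\<And>i. convex (U i)"
  shows "convex (domain_product b U)"
proof (rule convexI)
  fix x y and s t :: real
  assume "x \<in> domain_product b U" "y \<in> domain_product b U" "0 \<le> s" "0 \<le> t" "s + t = 1"
  then show "s *\<^sub>R x + t *\<^sub>R y \<in> domain_product b U"
    using assms unfolding domain_product_def convex_def by (simp add: block_proj_linear)
qed

lemma bounded_domain_product:
  assumes "\<And>i. bounded (U i)"
  shows "bounded (domain_product b U)"
proof -
  have "\<exists>B. \<forall>x\<in>U i. norm x \<le> B" for i using assms[of i] by (simp add: bounded_iff)
  then obtain B where B: "\<And>i x. x \<in> U i \<Longrightarrow> norm x \<le> B i" by metis
  have "norm x \<le> (\<Sum>i\<in>UNIV. B i)" if "x \<in> domain_product b U" for x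
  proof -
    have "norm x = norm (\<Sum>i\<in>UNIV. block_proj b i x)" by (simp add: sum_block_proj)
    also have "\<dots> \<le> (\<Sum>i\<in>UNIV. norm (block_proj b i x))" by (rule norm_sum)
    also have "\<dots> \<le> (\<Sum>i\<in>UNIV. B i)" using that B by (intro sum_mono) (auto simp: domain_product_def)
    finally show ?thesis .
  qed
  then show ?thesis by (auto simp: bounded_iff)
qed

text \<open>Some block of \<open>q\<close> lies outside its factor, and continuity of the block
  projection keeps it in the closure of that factor.\<close>

lemma closure_domain_product:
  assumes "q \<in> closure (domain_product b U)" "q \<notin> domain_product b U"
  obtains i where "block_proj b i q \<in> closure (U i)" "block_proj b i q \<notin> U i"
proof -
  obtain i where i: "block_proj b i q \<notin> U i" using assms(2) by (auto simp: domain_product_def)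
  have "block_proj b i ` closure (domain_product b U) \<subseteq> closure (U i)"
    by (rule image_closure_subset[OF continuous_on_block_proj closed_closure])
      (use closure_subset in \<open>auto simp: domain_product_def\<close>)
  then show thesis using that i assms(1) by blast
qed

end

lemma log_hessian_smult:
  "log_hessian m \<epsilon> x (\<lambda>k. c * x' k) y y' = c * log_hessian m \<epsilon> x x' y y'"
  "log_hessian m \<epsilon> x x' y (\<lambda>k. c * y' k) = cnj c * log_hessian m \<epsilon> x x' y y'"
  by (simp_all add: log_hessian_def hform_smult_left hform_smult_right algebra_simps)

lemma log_hessian_cong:
  assumes "\<And>k. k < m \<Longrightarrow> x k = a k" "\<And>k. k < m \<Longrightarrow> x' k = a' k" "\<And>k. k < m \<Longrightarrow> y k = b k" "\<And>k. k < m \<Longrightarrow> y' k = b' k"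
  shows "log_hessian m \<epsilon> x x' y y' = log_hessian m \<epsilon> a a' b b'"
proof -
  have "hform m \<epsilon> x y = hform m \<epsilon> a b" "hform m \<epsilon> x' y = hform m \<epsilon> a' b"
    "hform m \<epsilon> x y' = hform m \<epsilon> a b'" "hform m \<epsilon> x' y' = hform m \<epsilon> a' b'"
    by (intro hform_cong assms; assumption)+
  then show ?thesis by (simp add: log_hessian_def)
qed

text \<open>By the chain rule, pulling back amounts to replacing every \<open>g k\<close> by
  \<open>g k \<circ> \<Phi>\<close>. All factors thus become potentials on the single domain
  \<open>D\<close>.\<close>

lemma pullback_kahler_form:
  assumes pe: "potential_expansion I h m \<epsilon> g" and \<Phi>: "hol_map \<Phi> D" "open D" and w: "w \<in> D"
    and pos: "Re (h (\<Phi> w) (\<Phi> w)) > 0"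
  defines "L \<equiv> \<lambda>v v'. log_hessian m \<epsilon> (\<lambda>k. g k (\<Phi> w)) (\<lambda>k. frechet_derivative (\<lambda>w. g k (\<Phi> w)) (at w) v)
      (\<lambda>k. g k (\<Phi> w)) (\<lambda>k. frechet_derivative (\<lambda>w. g k (\<Phi> w)) (at w) v')"
  shows "pullback D \<Phi> (kahler_form h) w v v' = \<i> * (L v v' - L v' v)"
proof -
  have hol: "hol_fun (g k) UNIV" if "k < m" for k using pe that by (simp add: potential_expansion_def)
  have "frechet_derivative (\<lambda>w. g k (\<Phi> w)) (at w) v = frechet_derivative (g k) (at (\<Phi> w)) (frechet_derivative \<Phi> (at w) v)"
    if "k < m" for k v
  proof -
    have "((\<lambda>w. g k (\<Phi> w)) has_derivative (\<lambda>v. frechet_derivative (g k) (at (\<Phi> w)) (frechet_derivative \<Phi> (at w) v))) (at w)"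
      by (rule has_derivative_compose[where g = "g k", OF hol_map_has_derivative(1)[OF \<Phi> w]])
        (rule hol_fun_has_derivative(1)[OF hol[OF that] open_UNIV UNIV_I])
    then show ?thesis using frechet_derivative_at by (metis (no_types))
  qed
  then have "L v v' = herm_metric h (\<Phi> w) (frechet_derivative \<Phi> (at w) v) (frechet_derivative \<Phi> (at w) v')" for v v'
    unfolding L_def herm_metric_eq_log_hessian[OF pe pos] by (intro log_hessian_cong) auto
  then show ?thesis by (simp add: pullback_def kahler_form_def at_within_open[OF w \<Phi>(2)])
qed

locale hc_isometry =
  fixes bD :: "'n::finite \<Rightarrow> 'k::finite"
    and Dfac :: "'k \<Rightarrow> (complex^'n) set"
    and hD :: "'k \<Rightarrow> complex^'n \<Rightarrow> complex^'n \<Rightarrow> complex"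
    and lam :: "'k \<Rightarrow> real"
    and bO :: "'N::finite \<Rightarrow> 'm::finite"
    and Ofac :: "'m \<Rightarrow> (complex^'N) set"
    and hO :: "'m \<Rightarrow> complex^'N \<Rightarrow> complex^'N \<Rightarrow> complex"
    and mu :: "'m \<Rightarrow> real"
    and f :: "complex^'n \<Rightarrow> complex^'N"
    and mD \<epsilon>D gD mO \<epsilon>O gO
  assumes hcD: "\<And>i. hc_domain (bD -` {i}) (Dfac i) (hD i)"
    and hcO: "\<And>j. hc_domain (bO -` {j}) (Ofac j) (hO j)"
    and lam: "\<And>i. lam i > 0"
    and iso: "hol_isometric_embedding bD Dfac hD lam bO Ofac hO mu f"
    and peD: "\<And>i. potential_expansion (bD -` {i}) (hD i) (mD i) (\<epsilon>D i) (gD i)"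
    and peO: "\<And>j. potential_expansion (bO -` {j}) (hO j) (mO j) (\<epsilon>O j) (gO j)"
begin

abbreviation "D \<equiv> domain_product bD Dfac"
abbreviation "\<Omega> \<equiv> domain_product bO Ofac"
abbreviation "p \<equiv> f 0"

lemmas D_factor = hc_domain_properties[OF hcD peD]
lemmas O_factor = hc_domain_properties[OF hcO peO]

lemma domain_D: "open D" "convex D" "bounded D" "0 \<in> D"
  using open_domain_product[OF D_factor(1)] convex_domain_product[OF D_factor(1) D_factor(3)]
    bounded_domain_product[OF D_factor(1) D_factor(2)] D_factor(4)
  by (auto simp: domain_product_def block_proj_linear)

lemma domain_\<Omega>: "open \<Omega>" "convex \<Omega>" "bounded \<Omega>"
  using open_domain_product[OF O_factor(1)] convex_domain_product[OF O_factor(1) O_factor(3)]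
    bounded_domain_product[OF O_factor(1) O_factor(2)] by auto

lemma hol_f: "hol_map f D" "f ` D \<subseteq> \<Omega>"
  using iso unfolding hol_isometric_embedding_def hol_embedding_def by blast+

lemma in_D: "w \<in> D \<Longrightarrow> block_proj bD i w \<in> Dfac i"
  and in_\<Omega>: "z \<in> \<Omega> \<Longrightarrow> block_proj bO j z \<in> Ofac j"
  by (auto simp: domain_product_def)

lemma p_in: "p \<in> \<Omega>" using hol_f(2) domain_D(4) by blast

text \<open>Factors of both products are indexed by the sum type. With negative weights on the
  source, the isometry condition becomes the vanishing of one weighted sum.\<close>

definition weight :: "'k + 'm \<Rightarrow> real" where
  "weight = case_sum (\<lambda>i. - lam i) mu"

definition expo :: "'k + 'm \<Rightarrow> nat" where
  "expo = case_sum mD mO"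

definition sgns :: "'k + 'm \<Rightarrow> nat \<Rightarrow> real" where
  "sgns = case_sum \<epsilon>D \<epsilon>O"

definition funs :: "'k + 'm \<Rightarrow> nat \<Rightarrow> complex^'n \<Rightarrow> complex" where
  "funs = case_sum (\<lambda>i k w. gD i k (block_proj bD i w)) (\<lambda>j k w. gO j k (block_proj bO j (f w)))"

lemmas data_defs = weight_def expo_def sgns_def funs_def

lemma sum_Plus: "(\<Sum>s\<in>UNIV. F s) = (\<Sum>i\<in>UNIV. F (Inl i)) + (\<Sum>j\<in>UNIV. F (Inr j))"
  for F :: "'k + 'm \<Rightarrow> 'b::comm_monoid_add"
  unfolding UNIV_Plus_UNIV[symmetric] by (subst sum.Plus) (simp_all add: o_def)

lemma hD_eq: "hD i z \<xi> = 1 + hform (mD i) (\<epsilon>D i) (\<lambda>k. gD i k z) (\<lambda>k. gD i k \<xi>)"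
  and hO_eq: "hO j z' \<xi>' = 1 + hform (mO j) (\<epsilon>O j) (\<lambda>k. gO j k z') (\<lambda>k. gO j k \<xi>')"
  using peD[of i] peO[of j] by (simp_all add: potential_expansion_def)

lemma gD: "k < mD i \<Longrightarrow> hol_fun (gD i k) UNIV" "k < mD i \<Longrightarrow> gD i k 0 = 0"
  and gO: "k' < mO j \<Longrightarrow> hol_fun (gO j k') UNIV" "k' < mO j \<Longrightarrow> gO j k' 0 = 0"
  using peD[of i] peO[of j] by (simp_all add: potential_expansion_def)

lemma hol_map_block_f: "hol_map (\<lambda>x. block_proj bO j (f x)) D"
  by (rule hol_map_compose[OF hol_f(1) hol_map_block_proj subset_UNIV])

lemma hol_funs: "k < expo s \<Longrightarrow> hol_fun (funs s k) D"
proof (cases s)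
  case (Inl i)
  assume k: "k < expo s"
  have "hol_fun (\<lambda>w. gD i k (block_proj bD i w)) D"
    by (rule hol_fun_compose[OF hol_map_block_proj gD(1) subset_UNIV]) (use k Inl in \<open>simp add: data_defs\<close>)
  then show ?thesis using Inl by (simp add: data_defs)
next
  case (Inr j)
  assume k: "k < expo s"
  have "hol_fun (\<lambda>w. gO j k (block_proj bO j (f w))) D"
    by (rule hol_fun_compose[OF hol_map_block_f gO(1) subset_UNIV]) (use k Inr in \<open>simp add: data_defs\<close>)
  then show ?thesis using Inr by (simp add: data_defs)
qed

lemma H_eq:
  "1 + hform (expo (Inl i)) (sgns (Inl i)) (\<lambda>k. funs (Inl i) k w) (\<lambda>k. funs (Inl i) k \<xi>) =
    hD i (block_proj bD i w) (block_proj bD i \<xi>)"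
  "1 + hform (expo (Inr j)) (sgns (Inr j)) (\<lambda>k. funs (Inr j) k w) (\<lambda>k. funs (Inr j) k \<xi>) =
    hO j (block_proj bO j (f w)) (block_proj bO j (f \<xi>))"
  by (simp_all add: data_defs hD_eq hO_eq)

lemma potentials: "hermitian_potentials D UNIV weight expo sgns funs"
proof
  show "open D" "convex D" "0 \<in> D" by (rule domain_D)+
  show "k < expo s \<Longrightarrow> hol_fun (funs s k) D" for s k by (rule hol_funs)
  show "1 + hform (expo s) (sgns s) (\<lambda>k. funs s k w) (\<lambda>k. funs s k \<xi>) \<noteq> 0" if "w \<in> D" "\<xi> \<in> D" for s w \<xi>
  proof (cases s)
    case (Inl i)
    show ?thesis unfolding Inl H_eq by (rule D_factor(6)) (use that in \<open>auto simp: in_D\<close>)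
  next
    case (Inr j)
    have "f w \<in> \<Omega>" "f \<xi> \<in> \<Omega>" using hol_f(2) that by blast+
    then show ?thesis unfolding Inr H_eq by (intro O_factor(6) in_\<Omega>)
  qed
  fix w v v' assume w: "w \<in> D"
  define L where "L = (\<lambda>s v v'. log_hessian (expo s) (sgns s) (\<lambda>k. funs s k w)
      (\<lambda>k. frechet_derivative (funs s k) (at w) v) (\<lambda>k. funs s k w) (\<lambda>k. frechet_derivative (funs s k) (at w) v'))"
  define A where "A = (\<lambda>v v'. \<Sum>s\<in>UNIV. of_real (weight s) * L s v v')"
  have lin: "frechet_derivative (funs s k) (at w) (c *s v) = c * frechet_derivative (funs s k) (at w) v"
    if "k < expo s" for s k c v
    by (rule hol_fun_has_derivative(2)[OF hol_funs[OF that] domain_D(1) w])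
  have L1: "L s (c *s v) v' = c * L s v v'" for s c v v'
    unfolding L_def log_hessian_smult(1)[symmetric] by (rule log_hessian_cong) (simp_all add: lin)
  have L2: "L s v (c *s v') = cnj c * L s v v'" for s c v v'
    unfolding L_def log_hessian_smult(2)[symmetric] by (rule log_hessian_cong) (simp_all add: lin)
  have A_smult: "A (c *s v) v' = c * A v v'" "A v (c *s v') = cnj c * A v v'" for c v v'
    using L1 L2 by (simp_all add: A_def sum_distrib_left mult_ac)
  have fw: "f w \<in> \<Omega>" using hol_f(2) w by blast
  have pD: "pullback D (block_proj bD i) (kahler_form (hD i)) w v v' = \<i> * (L (Inl i) v v' - L (Inl i) v' v)" for i v v'
    unfolding pullback_kahler_form[OF peD hol_map_block_proj domain_D(1) w D_factor(7)[OF in_D[OF w]]]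
    by (simp add: L_def data_defs)
  have pO: "pullback D (\<lambda>x. block_proj bO j (f x)) (kahler_form (hO j)) w v v' = \<i> * (L (Inr j) v v' - L (Inr j) v' v)" for j v v'
    unfolding pullback_kahler_form[OF peO hol_map_block_f domain_D(1) w O_factor(7)[OF in_\<Omega>[OF fw]]]
    by (simp add: L_def data_defs)
  \<comment> \<open>A Kaehler form is \<open>\<i>\<close> times the antisymmetrization of the
    Hermitian form, so equality of the forms says only that the difference \<open>A\<close> of the
    Hermitian forms is symmetric.\<close>
  have sym: "A v v' = A v' v" for v v'
  proof -
    have "(\<Sum>j\<in>UNIV. of_real (mu j) * (\<i> * (L (Inr j) v v' - L (Inr j) v' v))) =
        (\<Sum>i\<in>UNIV. of_real (lam i) * (\<i> * (L (Inl i) v v' - L (Inl i) v' v)))"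
      using iso w unfolding hol_isometric_embedding_def pD[symmetric] pO[symmetric] by blast
    then have "\<i> * (A v v' - A v' v) = 0"
      unfolding A_def sum_Plus
      by (simp add: weight_def sum_subtractf sum_distrib_left sum_negf algebra_simps)
    then show ?thesis by simp
  qed
  \<comment> \<open>Symmetry is incompatible with sesquilinearity: replacing \<open>v\<close> by
    \<open>\<i> *s v\<close> multiplies one side by \<open>\<i>\<close> and the other by
    \<open>- \<i>\<close>.\<close>
  have "A (\<i> *s v) v' = A v' (\<i> *s v)" by (rule sym)
  then have "\<i> * A v v' = - (\<i> * A v v')" using sym[of v v'] by (simp add: A_smult)
  then have "A v v' = 0" by (simp add: eq_neg_iff_add_eq_0)
  then show "(\<Sum>s\<in>UNIV. of_real (weight s) * log_hessian (expo s) (sgns s)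
         (\<lambda>k. funs s k w) (\<lambda>k. frechet_derivative (funs s k) (at w) v)
         (\<lambda>k. funs s k w) (\<lambda>k. frechet_derivative (funs s k) (at w) v')) = 0"
    by (simp add: A_def L_def)
qed

end

section \<open>The retraction and properness\<close>

text \<open>A right inverse of \<open>M\<close> makes the transpose injective, so the row space,
  which is the range of the transpose, has full dimension.\<close>

lemma rank_right_invertible:
  fixes M :: "complex^'N::finite^'n::finite"
  assumes "M ** B = mat 1"
  shows "rank M = CARD('n)"
proof -
  have T: "transpose B ** transpose M = mat 1"
    using assms by (metis matrix_transpose_mul transpose_mat)
  then have inj: "inj ((*v) (transpose M))"
    by (intro inj_on_inverseI[of _ "(*v) (transpose B)"]) (simp only: matrix_vector_mul_assoc T matrix_vector_mul_lid)
  have "range ((*v) (transpose M)) = vec.span (rows M)"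
  proof
    have "transpose M *v x \<in> vec.span (columns (transpose M))" for x
      by (rule matrix_vector_mult_in_columnspace_gen)
    then show "range ((*v) (transpose M)) \<subseteq> vec.span (rows M)" by (auto simp: columns_transpose)
    have "column i (transpose M) \<in> range ((*v) (transpose M))" for i
      by (rule range_eqI[of _ _ "axis i 1"]) (simp add: vec_eq_iff matrix_vector_mult_def column_def axis_def
          if_distrib[of "\<lambda>c. _ * c"] cong: if_cong)
    then have "columns (transpose M) \<subseteq> range ((*v) (transpose M))" by (auto simp: columns_def)
    then show "vec.span (rows M) \<subseteq> range ((*v) (transpose M))"
      unfolding columns_transpose by (rule vec.span_minimal[OF _ subspace_range])
  qed
  moreover have "vec.dim ((*v) (transpose M) ` UNIV) = vec.dim (UNIV :: (complex^'n) set)"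
    by (rule vec.dim_image_eq[OF matrix_vector_mul_linear_gen]) (use inj in simp)
  ultimately have "vec.dim (rows M) = vec.dim (UNIV :: (complex^'n) set)" by simp
  then show ?thesis unfolding row_rank_def_gen by (simp add: card_cart_basis)
qed

context hc_isometry
begin

interpretation potentials: hermitian_potentials D UNIV weight expo sgns funs
  by (rule potentials)

text \<open>
  \<open>\<beta> j z b\<close> is the derivative of \<open>log hO(z, f(\<xi>))\<close> with respect to the conjugate of the
  coordinate \<open>b\<close> of \<open>\<xi>\<close>, at \<open>\<xi> = 0\<close>.
\<close>

definition \<beta> :: "'m \<Rightarrow> complex^'N \<Rightarrow> 'n \<Rightarrow> complex" where
  "\<beta> j z b = hform (mO j) (\<epsilon>O j) (\<lambda>k. gO j k (block_proj bO j z))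
      (\<lambda>k. frechet_derivative (gO j k) (at (block_proj bO j p)) (block_proj bO j (frechet_derivative f (at 0) (axis b 1))))
    / hO j (block_proj bO j z) (block_proj bO j p)"

text \<open>In the integrated identity at \<open>\<xi> = 0\<close>, in the direction of coordinate
  \<open>b\<close>, the source side reduces to \<open>lam (bD b) * w $ b\<close>. The formula solves
  for this coordinate, with an arbitrary point \<open>z\<close> in place of
  \<open>f w\<close>.\<close>

definition \<pi> :: "complex^'N \<Rightarrow> complex^'n" where
  "\<pi> z = (\<chi> b. (\<Sum>j\<in>UNIV. of_real (mu j) * (\<beta> j p b - \<beta> j z b)) / of_real (lam (bD b)))"

lemma hol_form: "hol_fun (\<lambda>z. hform (mO j) (\<epsilon>O j) (\<lambda>k. gO j k (block_proj bO j z)) y) X"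
  unfolding hform_def
  by (intro hol_fun_sum hol_fun_mult hol_fun_const hol_fun_compose[OF hol_map_block_proj gO(1) subset_UNIV]) auto

lemma hol_map_\<pi>: "hol_map \<pi> \<Omega>"
proof -
  have "hol_fun (\<lambda>z. \<beta> j z b) \<Omega>" for j b
    unfolding \<beta>_def hO_eq
    by (intro hol_fun_divide hol_form hol_fun_add hol_fun_const)
      (use O_factor(6)[OF in_\<Omega> in_\<Omega>[OF p_in]] in \<open>simp add: hO_eq\<close>)
  then show ?thesis
    unfolding \<pi>_def divide_inverse
    by (intro hol_map_vec_lambda hol_fun_mult hol_fun_sum hol_fun_diff hol_fun_const)
qed

lemma derivative_block_f:
  assumes "w \<in> D"
  shows "((\<lambda>x. block_proj bO j (f x)) has_derivative (\<lambda>v. block_proj bO j (frechet_derivative f (at w) v))) (at w)"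
  by (rule has_derivative_compose[OF hol_map_has_derivative(1)[OF hol_f(1) domain_D(1) assms] has_derivative_block_proj])

lemma derivative_funs:
  assumes "w \<in> D"
  shows "k < mO j \<Longrightarrow> frechet_derivative (funs (Inr j) k) (at w) v =
      frechet_derivative (gO j k) (at (block_proj bO j (f w))) (block_proj bO j (frechet_derivative f (at w) v))"
    and "k' < mD i \<Longrightarrow> frechet_derivative (funs (Inl i) k') (at w) v =
      frechet_derivative (gD i k') (at (block_proj bD i w)) (block_proj bD i v)"
proof -
  assume k: "k < mO j"
  have "((\<lambda>x. gO j k (block_proj bO j (f x))) has_derivative (\<lambda>v. frechet_derivative (gO j k) (at (block_proj bO j (f w)))
      (block_proj bO j (frechet_derivative f (at w) v)))) (at w)"
    by (rule has_derivative_compose[where g = "gO j k", OF derivative_block_f[OF assms]])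
      (rule hol_fun_has_derivative(1)[OF gO(1)[OF k] open_UNIV UNIV_I])
  from frechet_derivative_at[OF this]
  show "frechet_derivative (funs (Inr j) k) (at w) v =
      frechet_derivative (gO j k) (at (block_proj bO j (f w))) (block_proj bO j (frechet_derivative f (at w) v))"
    by (simp add: funs_def fun_eq_iff)
next
  assume k: "k' < mD i"
  have "((\<lambda>x. gD i k' (block_proj bD i x)) has_derivative (\<lambda>v. frechet_derivative (gD i k') (at (block_proj bD i w))
      (block_proj bD i v))) (at w)"
    by (rule has_derivative_compose[where g = "gD i k'", OF has_derivative_block_proj])
      (rule hol_fun_has_derivative(1)[OF gD(1)[OF k] open_UNIV UNIV_I])
  from frechet_derivative_at[OF this]
  show "frechet_derivative (funs (Inl i) k') (at w) v =
      frechet_derivative (gD i k') (at (block_proj bD i w)) (block_proj bD i v)"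
    by (simp add: funs_def fun_eq_iff)
qed

lemma hD_0: "hD i z 0 = 1" and hO_0: "hO j z' 0 = 1"
proof -
  have "hform (mD i) (\<epsilon>D i) (\<lambda>k. gD i k z) (\<lambda>k. gD i k 0) = hform (mD i) (\<epsilon>D i) (\<lambda>k. gD i k z) (\<lambda>k. 0)"
    by (rule hform_cong) (simp_all add: gD)
  then show "hD i z 0 = 1" by (simp add: hD_eq)
  have "hform (mO j) (\<epsilon>O j) (\<lambda>k. gO j k z') (\<lambda>k. gO j k 0) = hform (mO j) (\<epsilon>O j) (\<lambda>k. gO j k z') (\<lambda>k. 0)"
    by (rule hform_cong) (simp_all add: gO)
  then show "hO j z' 0 = 1" by (simp add: hO_eq)
qed

lemma \<pi>_f:
  assumes w: "w \<in> D"
  shows "\<pi> (f w) = w"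
proof -
  have "\<pi> (f w) $ b = w $ b" for b
  proof -
    let ?\<alpha> = "\<lambda>s w. hform (expo s) (sgns s) (\<lambda>k. funs s k w) (\<lambda>k. frechet_derivative (funs s k) (at 0) (axis b 1)) /
      (1 + hform (expo s) (sgns s) (\<lambda>k. funs s k w) (\<lambda>k. funs s k 0))"
    have Inr: "?\<alpha> (Inr j) w = \<beta> j (f w) b" for j w
    proof -
      have "hform (mO j) (\<epsilon>O j) (\<lambda>k. funs (Inr j) k w) (\<lambda>k. frechet_derivative (funs (Inr j) k) (at 0) (axis b 1)) =
          hform (mO j) (\<epsilon>O j) (\<lambda>k. gO j k (block_proj bO j (f w))) (\<lambda>k. frechet_derivative (gO j k)
            (at (block_proj bO j p)) (block_proj bO j (frechet_derivative f (at 0) (axis b 1))))"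
        by (rule hform_cong) (simp add: funs_def, rule derivative_funs(1)[OF domain_D(4)])
      then show ?thesis unfolding H_eq \<beta>_def by (simp add: expo_def sgns_def)
    qed
    \<comment> \<open>At \<open>\<xi> = 0\<close> the denominator is 1 and the first-order condition
      leaves the standard product with the basis vector, which is nonzero only in the block of
      \<open>b\<close>.\<close>
    have Inl: "?\<alpha> (Inl i) w = - (if bD b = i then w $ b else 0)" for i w
    proof -
      have "hform (mD i) (\<epsilon>D i) (\<lambda>k. funs (Inl i) k w) (\<lambda>k. frechet_derivative (funs (Inl i) k) (at 0) (axis b 1)) =
          hform (mD i) (\<epsilon>D i) (\<lambda>k. gD i k (block_proj bD i w)) (\<lambda>k. frechet_derivative (gD i k) (at 0) (block_proj bD i (axis b 1)))"
        by (rule hform_cong) (simp add: funs_def, simp only: derivative_funs(2)[OF domain_D(4)] block_proj_linear(4))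
      also have "\<dots> = - (\<Sum>a\<in>bD -` {i}. block_proj bD i w $ a * cnj (block_proj bD i (axis b 1) $ a))"
        using peD[of i] unfolding potential_expansion_def by blast
      also have "(\<Sum>a\<in>bD -` {i}. block_proj bD i w $ a * cnj (block_proj bD i (axis b 1) $ a)) =
          (\<Sum>a\<in>bD -` {i}. if a = b then w $ b else 0)"
        by (rule sum.cong) (auto simp: block_proj_nth axis_def)
      also have "\<dots> = (if bD b = i then w $ b else 0)" by simp
      finally have "hform (expo (Inl i)) (sgns (Inl i)) (\<lambda>k. funs (Inl i) k w)
          (\<lambda>k. frechet_derivative (funs (Inl i) k) (at 0) (axis b 1)) = - (if bD b = i then w $ b else 0)"
        by (simp add: expo_def sgns_def)
      then show ?thesis unfolding H_eq by (simp add: block_proj_linear(4) hD_0)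
    qed
    have "(\<Sum>s\<in>UNIV. of_real (weight s) * ?\<alpha> s w) = (\<Sum>s\<in>UNIV. of_real (weight s) * ?\<alpha> s 0)"
      by (rule potentials.integrated_metric[OF w domain_D(4)])
    then have "of_real (lam (bD b)) * w $ b + (\<Sum>j\<in>UNIV. of_real (mu j) * \<beta> j (f w) b) =
        (\<Sum>j\<in>UNIV. of_real (mu j) * \<beta> j p b)"
      unfolding sum_Plus Inl Inr
      by (simp add: weight_def if_distrib[of "\<lambda>c. of_real _ * c"] cong: if_cong)
    then show ?thesis using lam[of "bD b"] by (simp add: \<pi>_def right_diff_distrib sum_subtractf field_simps)
  qed
  then show ?thesis by (simp add: vec_eq_iff)
qed

lemma retraction: "holomorphic_retraction D \<Omega> f \<pi>"
  by unfold_locales (rule domain_D(1) domain_\<Omega>(1) hol_f hol_map_\<pi> \<pi>_f; assumption)+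

interpretation retraction: holomorphic_retraction D \<Omega> f \<pi>
  by (rule retraction)

text \<open>For \<open>f 0 = 0\<close> the denominators \<open>hO j z 0\<close> are 1, and the
  first-order condition on the target makes the numerators linear in \<open>z\<close>. The matrix
  \<open>M\<close> is the adjoint of the differential of \<open>f\<close> at 0 for the inner
  products weighted by \<open>lam\<close> and \<open>mu\<close>.\<close>

lemma \<pi>_linear:
  assumes p0: "p = 0"
  obtains M :: "complex^'N^'n" where "\<pi> = (*v) M"
proof -
  define u where "u = (\<lambda>b. frechet_derivative f (at 0) (axis b 1))"
  have \<beta>: "\<beta> j z b = - (\<Sum>a\<in>UNIV. if bO a = j then z $ a * cnj (u b $ a) else 0)" for j z b
  proof -
    have "\<beta> j z b = - (\<Sum>a\<in>bO -` {j}. block_proj bO j z $ a * cnj (block_proj bO j (u b) $ a))"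
      using peO[of j] unfolding \<beta>_def p0 block_proj_linear(4) hO_0 potential_expansion_def by (simp add: u_def)
    also have "\<dots> = - (\<Sum>a\<in>bO -` {j}. if bO a = j then z $ a * cnj (u b $ a) else 0)"
      by (intro arg_cong[where f = uminus] sum.cong) (auto simp: block_proj_nth)
    also have "(\<Sum>a\<in>bO -` {j}. if bO a = j then z $ a * cnj (u b $ a) else 0) =
        (\<Sum>a\<in>UNIV. if bO a = j then z $ a * cnj (u b $ a) else 0)"
      by (rule sum.mono_neutral_left) auto
    finally show ?thesis .
  qed
  have sum: "(\<Sum>j\<in>UNIV. of_real (mu j) * (\<beta> j p b - \<beta> j z b)) =
      (\<Sum>a\<in>UNIV. of_real (mu (bO a)) * (z $ a * cnj (u b $ a)))" for b z
  proof -
    have "(\<Sum>j\<in>UNIV. of_real (mu j) * (\<beta> j p b - \<beta> j z b)) =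
        (\<Sum>j\<in>UNIV. \<Sum>a\<in>UNIV. if bO a = j then of_real (mu j) * (z $ a * cnj (u b $ a)) else 0)"
      by (simp add: \<beta> p0 sum_distrib_left if_distrib[of "\<lambda>c. of_real _ * c"] cong: if_cong)
    also have "\<dots> = (\<Sum>a\<in>UNIV. \<Sum>j\<in>UNIV. if bO a = j then of_real (mu j) * (z $ a * cnj (u b $ a)) else 0)"
      by (rule sum.swap)
    finally show ?thesis by simp
  qed
  define M :: "complex^'N^'n" where
    "M = (\<chi> b a. of_real (mu (bO a)) * cnj (u b $ a) / of_real (lam (bD b)))"
  have "\<pi> z = M *v z" for z
    unfolding \<pi>_def sum by (simp add: M_def matrix_vector_mult_def sum_divide_distrib mult_ac)
  then have "\<pi> = (*v) M" by (simp add: fun_eq_iff)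
  then show thesis by (rule that)
qed

section \<open>Properness\<close>

text \<open>
  If \<open>f(w\<^sub>n)\<close> converges in \<open>\<Omega>\<close>, the diastasis stays bounded along \<open>w\<^sub>n\<close>; at a boundary point of \<open>D\<close> some
  \<open>hD i\<close> would vanish and the diastasis blow up.
\<close>

lemma limit_in_D:
  assumes w: "\<And>n::nat. w n \<in> D" and q: "q \<in> \<Omega>" "(\<lambda>n. f (w n)) \<longlonglongrightarrow> q"
  shows "w \<longlonglongrightarrow> \<pi> q" "\<pi> q \<in> D"
proof -
  have "isCont \<pi> q"
    using hol_map_continuous_on[OF hol_map_\<pi>] q(1) domain_\<Omega>(1) by (simp add: continuous_on_eq_continuous_at)
  then have "(\<lambda>n. \<pi> (f (w n))) \<longlonglongrightarrow> \<pi> q" using q(2) by (rule isCont_tendsto_compose)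
  then show lim: "w \<longlonglongrightarrow> \<pi> q" by (simp add: \<pi>_f[OF w])
  show "\<pi> q \<in> D"
  proof (rule ccontr)
    assume nD: "\<pi> q \<notin> D"
    have "\<pi> q \<in> closure D" using lim w unfolding closure_sequential by blast
    then obtain i0 where "block_proj bD i0 (\<pi> q) \<in> closure (Dfac i0)" "block_proj bD i0 (\<pi> q) \<notin> Dfac i0"
      by (rule closure_domain_product[OF D_factor(1) _ nD])
    then have h0: "hD i0 (block_proj bD i0 (\<pi> q)) (block_proj bD i0 (\<pi> q)) = 0"
      by (rule D_factor(8))
    let ?a = "\<lambda>i n. Re (hD i (block_proj bD i (w n)) (block_proj bD i (w n)))"
    have apos: "?a i n > 0" for i n by (rule D_factor(7)[OF in_D[OF w]])
    have contD: "isCont (\<lambda>z. hD i (block_proj bD i z) (block_proj bD i z)) x" for i x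
    proof -
      have "hol_fun (\<lambda>z. gD i k (block_proj bD i z)) UNIV" if "k < mD i" for k
        by (rule hol_fun_compose[OF hol_map_block_proj gD(1)[OF that] subset_UNIV])
      then have "continuous_on UNIV (\<lambda>z. hD i (block_proj bD i z) (block_proj bD i z))"
        unfolding hD_eq hform_def by (intro continuous_intros hol_fun_continuous_on) auto
      then show ?thesis by (simp add: continuous_on_eq_continuous_at)
    qed
    have alim: "?a i \<longlonglongrightarrow> Re (hD i (block_proj bD i (\<pi> q)) (block_proj bD i (\<pi> q)))" for i
      by (intro tendsto_Re isCont_tendsto_compose[OF contD lim])
    have "\<exists>B. \<forall>n. ?a i n \<le> B" for i
      using convergent_imp_Bseq[OF convergentI[OF alim[of i]]] unfolding Bseq_def by (metis abs_le_D1 real_norm_def)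
    then obtain B where B: "\<And>i n. ?a i n \<le> B i" by metis
    \<comment> \<open>The target part of the diastasis, as a function of the point \<open>z\<close>.
      It is continuous at \<open>q\<close> because \<open>q\<close> is an interior point, where
      neither logarithm is singular.\<close>
    let ?X = "\<lambda>z. \<Sum>j\<in>UNIV. mu j * (ln (Re (hO j (block_proj bO j z) (block_proj bO j z))) -
        ln ((cmod (hO j (block_proj bO j z) (block_proj bO j p)))\<^sup>2))"
    have g: "hol_fun (\<lambda>z. gO j k (block_proj bO j z)) UNIV" if "k < mO j" for j k
      by (rule hol_fun_compose[OF hol_map_block_proj gO(1)[OF that] subset_UNIV])
    have "continuous_on UNIV (\<lambda>z. hO j (block_proj bO j z) (block_proj bO j z))" for j
      unfolding hO_eq hform_def using hol_fun_continuous_on[OF g] by (intro continuous_intros) auto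
    then have c1: "isCont (\<lambda>z. hO j (block_proj bO j z) (block_proj bO j z)) q" for j
      by (simp add: continuous_on_eq_continuous_at)
    have "continuous_on UNIV (\<lambda>z. hO j (block_proj bO j z) (block_proj bO j p))" for j
      unfolding hO_eq hform_def using hol_fun_continuous_on[OF g] by (intro continuous_intros) auto
    then have c2: "isCont (\<lambda>z. hO j (block_proj bO j z) (block_proj bO j p)) q" for j
      by (simp add: continuous_on_eq_continuous_at)
    have n1: "Re (hO j (block_proj bO j q) (block_proj bO j q)) \<noteq> 0" for j
      using O_factor(7)[OF in_\<Omega>[OF q(1)], of j] by simp
    have n2: "(cmod (hO j (block_proj bO j q) (block_proj bO j p)))\<^sup>2 \<noteq> 0" for j
      using O_factor(6)[OF in_\<Omega>[OF q(1)] in_\<Omega>[OF p_in], of j] by simp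
    have "(\<lambda>n. ?X (f (w n))) \<longlonglongrightarrow> ?X q"
      by (intro tendsto_sum tendsto_mult tendsto_const tendsto_diff tendsto_ln tendsto_Re tendsto_power tendsto_norm
          isCont_tendsto_compose[OF c1 q(2)] isCont_tendsto_compose[OF c2 q(2)] n1 n2)
    then have "Bseq (\<lambda>n. ?X (f (w n)))" by (intro convergent_imp_Bseq convergentI)
    then obtain C' where "\<And>n. norm (?X (f (w n))) \<le> C'" unfolding Bseq_def by blast
    then have "\<bar>?X (f (w n))\<bar> \<le> C'" for n by (simp only: real_norm_def)
    then have C: "?X (f (w n)) \<ge> - C'" for n by (simp only: abs_le_iff minus_le_iff)
    have pos: "Re (1 + hform (expo s) (sgns s) (\<lambda>k. funs s k w) (\<lambda>k. funs s k w)) > 0" if w: "w \<in> D" for s w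
    proof (cases s)
      case (Inl i)
      show ?thesis unfolding Inl H_eq by (rule D_factor(7)[OF in_D[OF w]])
    next
      case (Inr j)
      have "f w \<in> \<Omega>" using hol_f(2) w by blast
      then show ?thesis unfolding Inr H_eq by (intro O_factor(7) in_\<Omega>)
    qed
    \<comment> \<open>As \<open>hD i z 0 = 1\<close>, the source part of the diastasis has no second
      logarithm and is zero at the origin; the constant is the target part at
      \<open>f 0\<close>.\<close>
    define E where "E = ?X p"
    have eq: "?X (f (w n)) - (\<Sum>i\<in>UNIV. lam i * ln (?a i n)) = E" for n
    proof -
      have H0: "block_proj bD i 0 = 0" for i by (rule block_proj_linear(4))
      have "(\<Sum>s\<in>UNIV. weight s * (ln (Re (1 + hform (expo s) (sgns s) (\<lambda>k. funs s k (w n)) (\<lambda>k. funs s k (w n)))) -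
            ln ((cmod (1 + hform (expo s) (sgns s) (\<lambda>k. funs s k (w n)) (\<lambda>k. funs s k 0)))\<^sup>2))) =
          (\<Sum>s\<in>UNIV. weight s * (ln (Re (1 + hform (expo s) (sgns s) (\<lambda>k. funs s k 0) (\<lambda>k. funs s k 0))) -
            ln ((cmod (1 + hform (expo s) (sgns s) (\<lambda>k. funs s k 0) (\<lambda>k. funs s k 0)))\<^sup>2)))"
        by (rule potentials.diastasis[OF pos w])
      then show ?thesis
        unfolding sum_Plus H_eq H0 hD_0 by (simp add: weight_def E_def sum_negf)
    qed
    have lower: "(\<Sum>i\<in>UNIV. lam i * ln (?a i n)) \<ge> - C' - E" for n using C[of n] eq[of n] by linarith
    \<comment> \<open>An upper bound for the other factors. Since all \<open>lam i\<close> are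
      positive, the lower bound for the sum becomes one for the logarithm of the factor
      \<open>i0\<close> alone, although this factor tends to 0.\<close>
    define R where "R = (\<Sum>i\<in>UNIV - {i0}. lam i * ln (B i))"
    have "ln (?a i0 n) \<ge> (- C' - E - R) / lam i0" for n
    proof -
      have "(\<Sum>i\<in>UNIV. lam i * ln (?a i n)) = lam i0 * ln (?a i0 n) + (\<Sum>i\<in>UNIV - {i0}. lam i * ln (?a i n))"
        by (rule sum.remove) auto
      also have "\<dots> \<le> lam i0 * ln (?a i0 n) + R"
        unfolding R_def using B apos lam
        by (intro add_left_mono sum_mono mult_left_mono ln_mono) (auto intro: less_imp_le)
      finally have "- C' - E - R \<le> lam i0 * ln (?a i0 n)" using lower[of n] by linarith
      then show ?thesis using lam[of i0] by (simp add: field_simps)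
    qed
    then have "exp ((- C' - E - R) / lam i0) \<le> ?a i0 n" for n
      using apos[of i0 n] by (metis exp_le_cancel_iff exp_ln)
    then have "exp ((- C' - E - R) / lam i0) \<le> 0"
      using LIMSEQ_le_const[OF alim[of i0], of "exp ((- C' - E - R) / lam i0)"] h0 by auto
    then show False using exp_gt_zero[of "(- C' - E - R) / lam i0"] by linarith
  qed
qed

end

context hc_isometry
begin

interpretation retraction: holomorphic_retraction D \<Omega> f \<pi>
  by (rule retraction)

text \<open>If the images of a sequence in \<open>C\<close> converge in \<open>\<Omega>\<close>, the
  retraction makes the sequence itself converge to \<open>\<pi> q\<close>, and the diastasis keeps
  this limit inside \<open>D\<close>.\<close>

lemma closed_map_f: "closed_map (top_of_set D) (top_of_set \<Omega>) f"
  unfolding closed_map_def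
proof (intro allI impI)
  fix C assume "closedin (top_of_set D) C"
  then obtain T where T: "closed T" "C = D \<inter> T" by (auto simp: closedin_closed)
  have "q \<in> f ` C" if q: "q \<in> \<Omega>" "q \<in> closure (f ` C)" for q
  proof -
    obtain x where "\<And>n. x n \<in> f ` C" "x \<longlonglongrightarrow> q" using q(2) unfolding closure_sequential by blast
    then have "\<forall>n. \<exists>w. w \<in> C \<and> x n = f w" by blast
    then obtain w where w: "\<And>n. w n \<in> C" "\<And>n. x n = f (w n)" by metis
    have wD: "\<And>n. w n \<in> D" using w(1) T(2) by blast
    have fw: "(\<lambda>n. f (w n)) \<longlonglongrightarrow> q" using \<open>x \<longlonglongrightarrow> q\<close> by (simp add: w(2)[symmetric])
    have lim: "w \<longlonglongrightarrow> \<pi> q" "\<pi> q \<in> D" by (rule limit_in_D[OF wD q(1) fw])+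
    have "isCont f (\<pi> q)"
      using hol_map_continuous_on[OF hol_f(1)] lim(2) domain_D(1) by (simp add: continuous_on_eq_continuous_at)
    then have "(\<lambda>n. f (w n)) \<longlonglongrightarrow> f (\<pi> q)" using lim(1) by (rule isCont_tendsto_compose)
    then have "f (\<pi> q) = q" using fw by (rule LIMSEQ_unique)
    moreover have "\<pi> q \<in> T" by (rule closed_sequentially[OF T(1) _ lim(1)]) (use w(1) T(2) in blast)
    ultimately show ?thesis using lim(2) T(2) by (metis IntI imageI)
  qed
  then have "\<Omega> \<inter> closure (f ` C) \<subseteq> f ` C" by blast
  moreover have "f ` C \<subseteq> \<Omega>" using hol_f(2) T(2) by blast
  moreover have "f ` C \<subseteq> closure (f ` C)" by (rule closure_subset)
  ultimately have "f ` C = \<Omega> \<inter> closure (f ` C)" by (intro equalityI Int_greatest)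
  then show "closedin (top_of_set \<Omega>) (f ` C)"
    unfolding closedin_closed by (intro exI[of _ "closure (f ` C)"] conjI closed_closure)
qed

text \<open>The map is closed, and the fibre over \<open>y\<close> contains at most the point
  \<open>\<pi> y\<close>.\<close>

lemma proper_map_f: "proper_map (top_of_set D) (top_of_set \<Omega>) f"
  unfolding proper_map_def
proof (intro conjI ballI closed_map_f)
  fix y
  have "{x \<in> D. f x = y} \<subseteq> {\<pi> y}" using \<pi>_f by auto
  then have "finite {x \<in> D. f x = y}" by (rule finite_subset) simp
  then have "compactin (top_of_set D) {x \<in> D. f x = y}" by (intro finite_imp_compactin) auto
  then show "compactin (top_of_set D) {x \<in> topspace (top_of_set D). f x = y}" by simp
qed

lemma closedin_image: "closedin (top_of_set \<Omega>) (f ` D)"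
  using closed_map_f unfolding closed_map_def by simp

lemma general_retraction:
  obtains Df where "bounded Df" "domain_of_holomorphy Df" "hol_submersion Df D \<pi>" "f ` D \<subseteq> Df" "Df \<subseteq> \<Omega>"
proof -
  define \<delta> where "\<delta> = (\<lambda>z. det (cjacobian \<pi> z ** cjacobian f (\<pi> z)))"
  let ?W0 = "{z \<in> \<Omega>. \<pi> z \<in> D}" and ?W1 = "{z \<in> \<Omega>. \<pi> z \<in> D \<and> \<delta> z \<noteq> 0}"
  have "hol_map \<pi> ?W0" by (rule hol_map_subset[OF hol_map_\<pi>]) blast
  then have "hol_matrix (\<lambda>z. cjacobian f (\<pi> z)) ?W0"
    by (rule hol_matrix_compose[OF _ hol_matrix_cjacobian[OF hol_f(1) domain_D(1)]]) blast
  moreover have "hol_matrix (cjacobian \<pi>) ?W0"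
    by (rule hol_matrix_subset[OF hol_matrix_cjacobian[OF hol_map_\<pi> domain_\<Omega>(1)]]) blast
  ultimately have \<delta>: "hol_fun \<delta> ?W0" unfolding \<delta>_def by (intro hol_fun_det hol_matrix_mult)
  have S: "f ` D \<subseteq> ?W1"
    using hol_f(2) \<pi>_f retraction.cjacobian_retraction by (auto simp: \<delta>_def)
  define Df where "Df = connected_component_set ?W1 p"
  have pW: "p \<in> ?W1" using S domain_D(4) by blast
  have comp: "Df \<in> components ?W1" unfolding Df_def components_def using pW by blast
  have "connected (f ` D)"
    by (rule connected_continuous_image[OF hol_map_continuous_on[OF hol_f(1)] convex_connected[OF domain_D(2)]])
  then have SDf: "f ` D \<subseteq> Df"
    unfolding Df_def by (rule connected_component_maximal[rotated]) (use S domain_D(4) in blast)+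
  have sub: "Df \<subseteq> ?W1" using comp by (rule in_components_subset)
  have "hol_submersion Df D \<pi>"
    unfolding hol_submersion_def
  proof (intro conjI ballI)
    show "hol_map \<pi> Df" by (rule hol_map_subset[OF hol_map_\<pi>]) (use sub in blast)
    show "\<pi> ` Df \<subseteq> D" using sub by blast
    fix z assume "z \<in> Df"
    then have z: "z \<in> \<Omega>" "\<delta> z \<noteq> 0" using sub by blast+
    have "invertible (cjacobian \<pi> z ** cjacobian f (\<pi> z))"
      using z(2) by (simp add: \<delta>_def invertible_det_nz)
    then obtain B where "cjacobian \<pi> z ** cjacobian f (\<pi> z) ** B = mat 1" unfolding invertible_def by blast
    then have "cjacobian \<pi> z *v (cjacobian f (\<pi> z) *v (B *v v)) = v" for v
      by (simp add: matrix_vector_mul_assoc matrix_mul_assoc)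
    then have "v \<in> range (frechet_derivative \<pi> (at z))" for v
      unfolding cjacobian_works(1)[OF hol_map_\<pi> domain_\<Omega>(1) z(1)] by (metis rangeI)
    then show "range (frechet_derivative \<pi> (at z)) = UNIV" by blast
  qed
  moreover have "bounded Df" by (rule bounded_subset[OF domain_\<Omega>(3)]) (use sub in blast)
  moreover have "domain_of_holomorphy Df"
    by (rule domain_of_holomorphy_component[OF domain_\<Omega>(1,2) domain_D(1,2) hol_map_\<pi> \<delta> comp])
  ultimately show thesis using SDf sub by (intro that[of Df]) auto
qed

text \<open>The domain is all of \<open>\<Omega> \<inter> M\<^sup>-\<^sup>1(D)\<close>: preimages of
  convex and balanced sets under a linear map have the same properties. The differential is
  \<open>M\<close> everywhere, and the differential of \<open>f\<close> at 0 is a right inverse of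
  it, which gives both the rank and the submersion.\<close>

lemma linear_retraction:
  assumes p0: "p = 0"
  shows "\<exists>(M :: complex^'N^'n) Df.
      rank M = CARD('n) \<and>
      open Df \<and> connected Df \<and> Df \<noteq> {} \<and> bounded Df \<and> balanced Df \<and> convex Df \<and>
      Df \<subseteq> \<Omega> \<and>
      hol_submersion Df D (\<lambda>z. z v* transpose M) \<and>
      f ` D \<subseteq> Df \<and>
      (\<forall>w\<in>D. f w v* transpose M = w) \<and>
      (\<forall>w\<in>D. direct_sum (tangent_space \<Omega> (f w)) (tangent_space (f ` D) (f w))
                (kernel_of_differential \<Omega> (\<lambda>z. z v* transpose M) (f w))) \<and>
      holomorphic_splitting \<Omega> (f ` D) (\<lambda>z. z v* transpose M)"
proof -
  obtain M :: "complex^'N^'n" where M: "\<pi> = (*v) M" using \<pi>_linear[OF p0] .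
  have eq: "z v* transpose M = \<pi> z" for z by (simp add: M)
  define Df where "Df = \<Omega> \<inter> (*v) M -` D"
  have der: "((*v) M has_derivative (*v) M) (at z)" for z
    by (rule bounded_linear_imp_has_derivative) (simp add: linear_conv_bounded_linear[symmetric])
  have "cjacobian \<pi> p = M"
    by (rule cjacobian_unique[OF hol_map_\<pi> domain_\<Omega>(1) p_in]) (unfold M, rule der)
  then have inv: "M ** cjacobian f 0 = mat 1" using retraction.cjacobian_retraction[OF domain_D(4)] by simp
  have surj: "range ((*v) M) = UNIV"
    using inv by (metis matrix_right_invertible_surjective)
  have op: "open Df"
    unfolding Df_def
    using continuous_open_preimage[OF hol_map_continuous_on[OF hol_map_mult_const[of M \<Omega>]] domain_\<Omega>(1) domain_D(1)] .
  have cv: "convex Df"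
    unfolding Df_def by (intro convex_Int domain_\<Omega>(2) convex_linear_vimage domain_D(2)) simp
  have S: "f ` D \<subseteq> Df" using hol_f(2) \<pi>_f unfolding Df_def M by auto
  have bal: "balanced Df"
    unfolding balanced_def
  proof (intro ballI allI impI)
    fix z c assume z: "z \<in> Df" and c: "cmod c \<le> 1"
    have "c *s z \<in> \<Omega>"
      using z O_factor(5)[OF _ c] by (auto simp: Df_def domain_product_def block_proj_linear)
    moreover have "M *v (c *s z) \<in> D"
      using z D_factor(5)[OF _ c] by (auto simp: Df_def domain_product_def block_proj_linear vec.scale)
    ultimately show "c *s z \<in> Df" by (simp add: Df_def)
  qed
  have sm: "hol_submersion Df D \<pi>"
    unfolding hol_submersion_def
  proof (intro conjI ballI)
    show "hol_map \<pi> Df" by (rule hol_map_subset[OF hol_map_\<pi>]) (simp add: Df_def)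
    show "\<pi> ` Df \<subseteq> D" unfolding M by (auto simp: Df_def)
    show "range (frechet_derivative \<pi> (at z)) = UNIV" for z
      using frechet_derivative_at[OF der[of z]] surj unfolding M by simp
  qed
  have split: "holomorphic_splitting \<Omega> (f ` D) \<pi>"
    by (rule retraction.retraction_splittings(1)[OF domain_\<Omega>(1) hol_f(2)])
  then have ds: "\<forall>w\<in>D. direct_sum (tangent_space \<Omega> (f w)) (tangent_space (f ` D) (f w))
                (kernel_of_differential \<Omega> \<pi> (f w))"
    unfolding holomorphic_splitting_def by blast
  have "Df \<noteq> {}" using S domain_D(4) by blast
  moreover have "Df \<subseteq> \<Omega>" by (simp add: Df_def)
  moreover have "bounded Df" by (rule bounded_subset[OF domain_\<Omega>(3)]) (simp add: Df_def)
  ultimately show ?thesis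
    by (intro exI[of _ M] exI[of _ Df], unfold eq) (intro conjI rank_right_invertible[OF inv] op cv bal
        convex_connected[OF cv] S sm split ds ballI \<pi>_f)
qed

end

theorem theorem5p5:
  fixes bD :: "'n::finite \<Rightarrow> 'k::finite"
    and Dfac :: "'k \<Rightarrow> (complex^'n) set"
    and hD :: "'k \<Rightarrow> complex^'n \<Rightarrow> complex^'n \<Rightarrow> complex"
    and lam :: "'k \<Rightarrow> real"
    and bO :: "'N::finite \<Rightarrow> 'm::finite"
    and Ofac :: "'m \<Rightarrow> (complex^'N) set"
    and hO :: "'m \<Rightarrow> complex^'N \<Rightarrow> complex^'N \<Rightarrow> complex"
    and mu :: "'m \<Rightarrow> real"
    and f :: "complex^'n \<Rightarrow> complex^'N"
    and D :: "(complex^'n) set"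
    and \<Omega> S :: "(complex^'N) set"
  assumes "\<And>i. hc_domain (bD -` {i}) (Dfac i) (hD i)"
    and "\<And>j. hc_domain (bO -` {j}) (Ofac j) (hO j)"
    and "\<And>i. lam i > 0"
    and "\<And>j. mu j > 0"
    and "hol_isometric_embedding bD Dfac hD lam bO Ofac hO mu f"
    and "D = domain_product bD Dfac"
    and "\<Omega> = domain_product bO Ofac"
    and "S = f ` D"
  shows "(f 0 = 0 \<longrightarrow>
           (\<exists>(M :: complex^'N^'n) Df.
              rank M = CARD('n) \<and>
              open Df \<and> connected Df \<and> Df \<noteq> {} \<and> bounded Df \<and> balanced Df \<and> convex Df \<and>
              Df \<subseteq> \<Omega> \<and>
              hol_submersion Df D (\<lambda>z. z v* transpose M) \<and>
              S \<subseteq> Df \<and>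
              (\<forall>w\<in>D. f w v* transpose M = w) \<and>
              (\<forall>w\<in>D. direct_sum (tangent_space \<Omega> (f w)) (tangent_space S (f w))
                        (kernel_of_differential \<Omega> (\<lambda>z. z v* transpose M) (f w))) \<and>
              holomorphic_splitting \<Omega> S (\<lambda>z. z v* transpose M)))
       \<and> proper_map (top_of_set D) (top_of_set \<Omega>) f
       \<and> closedin (top_of_set \<Omega>) S \<and> embedded_complex_submanifold CARD('n) S
       \<and> (\<exists>Df \<pi>. bounded Df \<and> domain_of_holomorphy Df \<and>
              hol_submersion Df D \<pi> \<and> S \<subseteq> Df \<and> Df \<subseteq> \<Omega> \<and>
              (\<forall>w\<in>D. \<pi> (f w) = w) \<and>
              holomorphic_splitting \<Omega> S \<pi>)
       \<and> tangent_sequence_splits \<Omega> S"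
proof -
  have "\<exists>m \<epsilon> g. potential_expansion (bD -` {i}) (hD i) m \<epsilon> g" for i
    using assms(1)[of i] hc_polynomial_expansion unfolding hc_domain_def by metis
  then obtain mD \<epsilon>D gD where peD: "\<And>i. potential_expansion (bD -` {i}) (hD i) (mD i) (\<epsilon>D i) (gD i)"
    by metis
  have "\<exists>m \<epsilon> g. potential_expansion (bO -` {j}) (hO j) m \<epsilon> g" for j
    using assms(2)[of j] hc_polynomial_expansion unfolding hc_domain_def by metis
  then obtain mO \<epsilon>O gO where peO: "\<And>j. potential_expansion (bO -` {j}) (hO j) (mO j) (\<epsilon>O j) (gO j)"
    by metis
  interpret hc_isometry bD Dfac hD lam bO Ofac hO mu f mD \<epsilon>D gD mO \<epsilon>O gO
    by unfold_locales (rule assms(1,2,3,5) peD peO)+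
  interpret retraction: holomorphic_retraction "domain_product bD Dfac" "domain_product bO Ofac" f \<pi>
    by (rule retraction)
  obtain Df where "bounded Df" "domain_of_holomorphy Df" "hol_submersion Df (domain_product bD Dfac) \<pi>"
      "f ` domain_product bD Dfac \<subseteq> Df" "Df \<subseteq> domain_product bO Ofac"
    by (rule general_retraction) (rule that)
  then show ?thesis
    unfolding assms(6-8)
    using linear_retraction proper_map_f closedin_image retraction.embedded_submanifold \<pi>_f
      retraction.retraction_splittings[OF domain_\<Omega>(1) hol_f(2)]
    by (intro conjI impI exI[of _ Df] exI[of _ \<pi>]) blast+
qed

end
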